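(* Let $\{P_\theta\}_{\theta\in\Theta}$ be a family as described in the context which is differentiable in quadratic mean, satisfies $\sup_{\theta\in K}\mathrm{E}_\theta e^{h^T\ell_\theta}<\infty$ for every compact $K\subset\Theta$ and every $h\in\mathbb{R}^m$, and satisfies $\inf_{\theta\in\Theta}\alpha_\theta>0$, where $\alpha_\theta$ is the smallest eigenvalue of $J_\theta$. Let $r\ge1$. Then for every $\theta\in\Theta$, \[ \sup_{a\ge0}\ \liminf_{n\to\infty}\ \inf_{\Lambda^{n,r}}\ \sup_{\Vert\theta'-\theta\Vert\le an^{-1/2}}\left\Vert\Lambda^{n,r}(P^n_{\theta'})-P^{rn}_{\theta'}\right\Vert_1\ \ge\ D_{r,J_\theta^{-1}}, \] where $\Lambda^{n,r}$ ranges over all Markov kernels from $\Omega^n$ to $\Omega^{rn}$.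
   Context: $\Theta$ is an open subset of $\mathbb{R}^m$, $(\Omega,\mathcal{X})$ is a Polish space with its Borel $\sigma$-algebra, each $P_\theta$ has density $p_\theta$ with respect to a fixed measure $\mu$, and $P^n_\theta:=P_\theta^{\otimes n}$ ($rn$ understood as an integer); $\mathrm{E}_\theta$ is expectation under $P_\theta$. Differentiability in quadratic mean: there is a measurable $\ell_\theta:\Omega\to\mathbb{R}^m$ with $\lim_{h\to0}\Vert h\Vert^{-2}\int\big(\sqrt{p_{\theta+h}}-\sqrt{p_\theta}-\tfrac12 h^T\ell_\theta\sqrt{p_\theta}\big)^2d\mu=0$ for all $\theta$. $J_\theta:=[\mathrm{E}_\theta\ell_{\theta,i}\ell_{\theta,j}]_{i,j}$. For positive definite $\Sigma$, $D_{r,\Sigma}:=\inf_\Lambda\sup_{h\in\mathbb{R}^m}\Vert\Lambda(\mathrm{N}(h,\Sigma))-\mathrm{N}(\sqrt r h,\Sigma)\Vert_1$ (infimum over Markov kernels on $\mathbb{R}^m$); for $r\ge1$ it equals $\Vert\mathrm{N}(0,\mathbf{1})-\mathrm{N}(0,r\mathbf{1})\Vert_1$. $\Lambda(P)$ is the image of $P$ under $\Lambda$; $\Vert\cdot\Vert_1$ is the total variation ($L^1$) norm. *)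

theory Defs
  imports "HOL-Probability.Probability"
begin

definition tv_norm :: "'b measure \<Rightarrow> 'b measure \<Rightarrow> ereal" where
  "tv_norm M N = (SUP \<A> \<in> {\<A>. finite \<A> \<and> \<A> \<subseteq> sets M \<and> disjoint \<A>}.
      ereal (\<Sum>A\<in>\<A>. \<bar>measure M A - measure N A\<bar>))"

definition markov_kernels :: "'x measure \<Rightarrow> 'y measure \<Rightarrow> ('x \<Rightarrow> 'y measure) set" where
  "markov_kernels M N = M \<rightarrow>\<^sub>M prob_algebra N"

definition gauss :: "real^'m \<Rightarrow> real^'m^'m \<Rightarrow> (real^'m) measure" where
  "gauss h \<Sigma> = density lborel (\<lambda>x.
      exp (- (1/2) * ((x - h) \<bullet> (matrix_inv \<Sigma> *v (x - h))))
      / sqrt ((2 * pi) ^ CARD('m) * det \<Sigma>))"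

definition D_const :: "real \<Rightarrow> real^'m^'m \<Rightarrow> ereal" where
  "D_const r \<Sigma> = (INF \<Lambda> \<in> markov_kernels (borel :: (real^'m) measure) borel.
      (SUP h \<in> (UNIV :: (real^'m) set). tv_norm (gauss h \<Sigma> \<bind> \<Lambda>) (gauss (sqrt r *\<^sub>R h) \<Sigma>)))"

definition eigenvalues :: "real^'m^'m \<Rightarrow> real set" where
  "eigenvalues A = {c. \<exists>v. v \<noteq> 0 \<and> A *v v = c *\<^sub>R v}"

definition min_eigenvalue :: "real^'m^'m \<Rightarrow> real" where
  "min_eigenvalue A = Inf (eigenvalues A)"

definition powM :: "'a measure \<Rightarrow> nat \<Rightarrow> (nat \<Rightarrow> 'a) measure" where
  "powM P n = PiM {..<n} (\<lambda>_. P)"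

end

theory Submission
  imports Defs
begin

text \<open>
  Let \<open>V\<close> satisfy \<open>V\<^sup>T J V = 1\<close> and put \<open>s = V\<^sup>T \<ell>\<^sub>\<theta>\<close>. The constant \<open>D\<close> is bounded from above by the kernel
  \<open>x \<mapsto> \<surd>r x\<close>, that is by \<open>2 (\<gamma>{|x| \<le> c} - \<gamma>{\<surd>r |x| \<le> c})\<close>, where \<open>\<gamma>\<close> is the standard Gaussian and \<open>c\<close> the radius at
  which the two densities cross. This bound is matched by a Bayes risk.

  Near \<open>\<theta>\<close> the model is replaced by the exponential family \<open>Q\<^sub>h = e\<^bsup>h \<cdot> s\<^esup> P\<^sub>\<theta> / M(h)\<close>: the squared Hellinger distance of
  \<open>P\<^bsub>\<theta> + V h\<^esub>\<close> and \<open>Q\<^sub>h\<close> is \<open>o(|h|\<^sup>2)\<close>, so at the scale \<open>h = g / \<surd>n\<close> the products are uniformly close. The \<open>n\<close>-fold product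
  of \<open>Q\<^sub>h\<close> has density \<open>e\<^bsup>g \<cdot> z\<^sub>n\<^esup> / M(h)\<^sup>n\<close> with \<open>z\<^sub>n = n\<^bsup>-1/2\<^esup> \<Sum> s(x\<^sub>i)\<close>, and \<open>z\<^sub>n\<close> is asymptotically \<open>\<gamma>\<close> under \<open>P\<^sub>\<theta>\<close>.

  Given a kernel, test its output against the target on the event \<open>|z\<^sub>N - \<surd>(N/n) g| \<le> c\<close>, \<open>N = rn\<close>, with \<open>g\<close> uniform on a
  large ball. Under the target the event has probability tending to \<open>\<gamma>{|x| \<le> c}\<close>. Under the kernel it is the event that an
  estimator of \<open>g\<close> has error at most \<open>c / \<surd>r\<close>; the posterior of \<open>g\<close> is close to a Gaussian centred at \<open>z\<^sub>n\<close>, and among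
  balls of a given radius the centred one has the largest Gaussian measure, so up to boundary effects this probability is
  at most \<open>\<gamma>{|x| \<le> c / \<surd>r}\<close>.
\<close>

section \<open>Total variation and linear changes of variables\<close>

text \<open>The obstacle is that the infimum over kernels stands inside the limit in n. Kernels
  between growing products offer no common space in which to pass to a limit, so no limiting kernel
  is formed. The comparison is made at fixed n: a Bayes inequality holds for every kernel, its
  right-hand side does not mention the kernel, and only that side is sent to its limit. The tilted
  family is what allows this. Its likelihood depends on the sample through z_n alone and is exactly
  a Gaussian one, except that the normaliser M(h)^n replaces exp(|g|^2/2); the discrepancy is
  controlled uniformly on balls.

  Completing the square leaves a factor exp(|z_n|^2/2), which is not integrable under the Gaussian
  limit. It is therefore truncated at a radius slightly larger than that of the prior ball. The
  Gaussian integral of the truncated factor is, up to a constant, at most the volume of the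
  truncation ball, while the uniform prior contributes the reciprocal volume of its own ball. The
  ratio of the two volumes tends to 1 as the prior spreads; this is the boundary effect.\<close>

lemma tv_norm_ge_event:
  assumes M: "prob_space M" and N: "prob_space N" and eq: "sets M = sets N" and A: "A \<in> sets M"
  shows "ereal (2 * (measure N A - measure M A)) \<le> tv_norm M N"
proof -
  interpret M: prob_space M by fact
  interpret N: prob_space N by fact
  let ?C = "space M - A"
  have sp: "space M = space N" using eq by (rule sets_eq_imp_space_eq)
  \<comment> \<open>If \<open>A\<close> coincided with its complement, the two-element family would
    collapse to a single set and the factor 2 would be lost. A probability space is nonempty, which
    excludes this.\<close>
  have neq: "A \<noteq> ?C" using M.not_empty sets.sets_into_space[OF A] by blast
  have C: "measure M ?C = 1 - measure M A" "measure N ?C = 1 - measure N A"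
    using M.prob_compl[OF A] N.prob_compl[of A] A eq sp by auto
  have "ereal (2 * (measure N A - measure M A)) \<le> ereal (\<Sum>B\<in>{A, ?C}. \<bar>measure M B - measure N B\<bar>)"
    using neq C by simp
  also have "\<dots> \<le> tv_norm M N"
    unfolding tv_norm_def using A by (intro SUP_upper) (auto simp: disjoint_def)
  finally show ?thesis .
qed

text \<open>The hypotheses make \<open>A\<close> the positive set of a Hahn decomposition of the
  signed difference \<open>d\<close>. Cutting each member of a disjoint family along
  \<open>A\<close> bounds its absolute difference by a signed one, and enlarging the covered parts
  to all of \<open>A\<close> and of its complement can only increase the total. The two halves agree
  because both measures have mass 1.\<close>

lemma tv_norm_le_Hahn:
  assumes M: "prob_space M" and N: "prob_space N" and eq: "sets M = sets N" and A: "A \<in> sets M"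
    and pos: "\<And>B. B \<in> sets M \<Longrightarrow> B \<subseteq> A \<Longrightarrow> measure N B \<le> measure M B"
    and neg: "\<And>B. B \<in> sets M \<Longrightarrow> B \<inter> A = {} \<Longrightarrow> measure M B \<le> measure N B"
  shows "tv_norm M N \<le> ereal (2 * (measure M A - measure N A))"
  unfolding tv_norm_def
proof (rule SUP_least)
  interpret M: prob_space M by fact
  interpret N: prob_space N by fact
  fix \<A> assume "\<A> \<in> {\<A>. finite \<A> \<and> \<A> \<subseteq> sets M \<and> disjoint \<A>}"
  then have fin: "finite \<A>" and sub: "\<And>B. B \<in> \<A> \<Longrightarrow> B \<in> sets M" and disj: "disjoint \<A>" by auto
  define d where "d X = measure M X - measure N X" for X
  have sp: "space M = space N" using eq by (rule sets_eq_imp_space_eq)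
  have add: "d (X \<union> Y) = d X + d Y" if "X \<in> sets M" "Y \<in> sets M" "X \<inter> Y = {}" for X Y
    using that eq by (simp add: d_def M.finite_measure_Union N.finite_measure_Union)
  have sumd: "(\<Sum>B\<in>\<A>. d (B \<inter> X)) = d (\<Union>\<A> \<inter> X)" if X: "X \<in> sets M" for X
    using fin sub disj
  proof (induction \<A> rule: finite_induct)
    case empty then show ?case by (simp add: d_def)
  next
    case (insert B \<B>)
    have "\<Union>(insert B \<B>) \<inter> X = (B \<inter> X) \<union> (\<Union>\<B> \<inter> X)" by auto
    moreover have "d ((B \<inter> X) \<union> (\<Union>\<B> \<inter> X)) = d (B \<inter> X) + d (\<Union>\<B> \<inter> X)"
      using insert X by (intro add sets.Int sets.finite_Union) (auto simp: disjoint_def)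
    moreover have "disjoint \<B>" using insert.prems(2) by (auto simp: disjoint_def)
    ultimately show ?case using insert by simp
  qed
  have U: "\<Union>\<A> \<in> sets M" using fin sub by (intro sets.finite_Union) auto
  have bound: "\<bar>measure M B - measure N B\<bar> \<le> d (B \<inter> A) - d (B \<inter> (space M - A))" if B: "B \<in> \<A>" for B
  proof -
    have Bs: "B \<in> sets M" using sub B by auto
    have "B = (B \<inter> A) \<union> (B \<inter> (space M - A))" using sets.sets_into_space[OF Bs] by auto
    then have "d B = d (B \<inter> A) + d (B \<inter> (space M - A))"
      using add[of "B \<inter> A" "B \<inter> (space M - A)"] Bs A by auto
    moreover have "d (B \<inter> A) \<ge> 0" using pos[of "B \<inter> A"] Bs A by (auto simp: d_def)
    moreover have "d (B \<inter> (space M - A)) \<le> 0"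
      using neg[of "B \<inter> (space M - A)"] Bs A by (auto simp: d_def)
    ultimately show ?thesis unfolding d_def by linarith
  qed
  have 1: "d (\<Union>\<A> \<inter> A) \<le> d A"
  proof -
    have "d (\<Union>\<A> \<inter> A \<union> (A - \<Union>\<A>)) = d (\<Union>\<A> \<inter> A) + d (A - \<Union>\<A>)"
      using U A by (intro add) auto
    moreover have "d (A - \<Union>\<A>) \<ge> 0" using pos[of "A - \<Union>\<A>"] U A by (auto simp: d_def)
    moreover have "\<Union>\<A> \<inter> A \<union> (A - \<Union>\<A>) = A" by auto
    ultimately show ?thesis by simp
  qed
  let ?C = "space M - A"
  have 2: "d ?C \<le> d (\<Union>\<A> \<inter> ?C)"
  proof -
    have "d (\<Union>\<A> \<inter> ?C \<union> (?C - \<Union>\<A>)) = d (\<Union>\<A> \<inter> ?C) + d (?C - \<Union>\<A>)"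
      using U A by (intro add) auto
    moreover have "d (?C - \<Union>\<A>) \<le> 0" using neg[of "?C - \<Union>\<A>"] U A by (auto simp: d_def)
    moreover have "\<Union>\<A> \<inter> ?C \<union> (?C - \<Union>\<A>) = ?C" by auto
    ultimately show ?thesis by simp
  qed
  have 3: "d ?C = - d A" using M.prob_compl[OF A] N.prob_compl[of A] A eq sp by (simp add: d_def)
  have "(\<Sum>B\<in>\<A>. \<bar>measure M B - measure N B\<bar>) \<le> (\<Sum>B\<in>\<A>. d (B \<inter> A) - d (B \<inter> ?C))"
    by (intro sum_mono bound)
  also have "\<dots> = d (\<Union>\<A> \<inter> A) - d (\<Union>\<A> \<inter> ?C)"
    using A by (simp add: sum_subtractf sumd)
  also have "\<dots> \<le> 2 * d A" using 1 2 3 by simp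
  finally show "ereal (\<Sum>B\<in>\<A>. \<bar>measure M B - measure N B\<bar>) \<le> ereal (2 * (measure M A - measure N A))"
    by (simp add: d_def)
qed

section \<open>Matrix inverses and bases conjugate with respect to a positive definite form\<close>

lemma matrix_inv_inverse:
  fixes A :: "'a::semiring_1^'n^'m"
  assumes "invertible A"
  shows "A ** matrix_inv A = mat 1" and "matrix_inv A ** A = mat 1"
  using someI_ex[OF assms[unfolded invertible_def]] unfolding matrix_inv_def by auto

lemma matrix_inv_matrix_inv:
  fixes A :: "real^'n^'n"
  assumes "invertible A"
  shows "matrix_inv (matrix_inv A) = A"
proof -
  have "invertible (matrix_inv A)"
    unfolding invertible_def using matrix_inv_inverse[OF assms] by blast
  from matrix_inv_inverse(1)[OF this]
  have "A ** (matrix_inv A ** matrix_inv (matrix_inv A)) = A" by (simp only: matrix_mul_rid)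
  then show ?thesis
    by (simp only: matrix_mul_assoc matrix_inv_inverse(1)[OF assms] matrix_mul_lid)
qed

text \<open>\<open>V\<close> takes the place of an inverse square root of \<open>J\<close>, without
  diagonalising \<open>J\<close>. Its columns are found one at a time: a nonzero vector that is
  Euclidean-orthogonal to the images under \<open>J\<close> of the columns chosen so far is
  conjugate to all of them, and positive definiteness allows it to be rescaled to unit
  length.\<close>

lemma ex_conjugate_basis:
  fixes J :: "real^'m^'m"
  assumes sym: "\<And>x y. x \<bullet> (J *v y) = y \<bullet> (J *v x)"
    and pd: "\<And>x. x \<noteq> 0 \<Longrightarrow> 0 < x \<bullet> (J *v x)"
  obtains V :: "real^'m^'m" where "\<And>x y. (V *v x) \<bullet> (J *v (V *v y)) = x \<bullet> y"
proof -
  have ex: "\<exists>v. \<forall>i\<in>S. \<forall>j\<in>S. v i \<bullet> (J *v v j) = (if i = j then 1 else 0)" for S :: "'m set"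
  proof (induction S rule: finite_induct[OF finite])
    case 1 then show ?case by simp
  next
    case (2 k S)
    then obtain v where v: "\<And>i j. i \<in> S \<Longrightarrow> j \<in> S \<Longrightarrow> v i \<bullet> (J *v v j) = (if i = j then 1 else 0)" by blast
    \<comment> \<open>Fewer than \<open>CARD('m)\<close> images have been produced, so their span is
      a proper subspace and leaves room for an orthogonal vector.\<close>
    have "dim ((\<lambda>j. J *v v j) ` S) \<le> card ((\<lambda>j. J *v v j) ` S)" by (intro dim_le_card') simp
    also have "\<dots> \<le> card S" by (intro card_image_le) simp
    also have "\<dots> < CARD('m)" using \<open>k \<notin> S\<close> by (intro psubset_card_mono) auto
    finally have "dim ((\<lambda>j. J *v v j) ` S) < DIM(real^'m)" by simp
    then obtain x where x: "x \<noteq> 0" "\<And>y. y \<in> span ((\<lambda>j. J *v v j) ` S) \<Longrightarrow> orthogonal x y"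
      using orthogonal_to_subspace_exists by metis
    have xJ: "x \<bullet> (J *v v j) = 0" if "j \<in> S" for j
      using x(2)[of "J *v v j"] that by (auto simp: orthogonal_def intro: span_base)
    define q where "q = x \<bullet> (J *v x)"
    have q: "q > 0" using pd x by (simp add: q_def)
    define w where "w = (1 / sqrt q) *\<^sub>R x"
    have ww: "w \<bullet> (J *v w) = 1"
      using q by (simp add: w_def matrix_vector_mult_scaleR q_def[symmetric] flip: real_sqrt_mult)
    have wv: "w \<bullet> (J *v v j) = 0" "v j \<bullet> (J *v w) = 0" if "j \<in> S" for j
      using xJ[OF that] sym[of "v j" w] by (auto simp: w_def)
    show ?case
      using v ww wv \<open>k \<notin> S\<close> by (intro exI[of _ "v(k := w)"]) auto
  qed
  from ex[of UNIV] obtain v :: "'m \<Rightarrow> real^'m" where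
    "\<forall>i\<in>UNIV. \<forall>j\<in>UNIV. v i \<bullet> (J *v v j) = (if i = j then 1 else 0 :: real)" ..
  then have v: "v i \<bullet> (J *v v j) = (if i = j then 1 else 0 :: real)" for i j by blast
  define V where "V = (\<chi> i j. v j $ i)"
  have V: "V *v x = (\<Sum>j\<in>UNIV. x $ j *\<^sub>R v j)" for x
    by (simp add: V_def matrix_vector_mult_def vec_eq_iff sum_component mult.commute)
  have "(V *v x) \<bullet> (J *v (V *v y)) = x \<bullet> y" for x y
  proof -
    have "(V *v x) \<bullet> (J *v (V *v y)) = (\<Sum>j\<in>UNIV. \<Sum>i\<in>UNIV. y $ j * (x $ i * (v i \<bullet> (J *v v j))))"
      by (simp add: V matrix_vector_right_distrib matrix_vector_mult_scaleR inner_sum_left inner_sum_right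
          linear_sum[OF matrix_vector_mul_linear] sum_distrib_left)
    also have "\<dots> = x \<bullet> y"
      unfolding v by (simp add: inner_vec_def sum.delta mult_delta_right mult.commute)
    finally show ?thesis .
  qed
  then show ?thesis by (rule that)
qed

text \<open>In matrix form the assumption reads V^T J V = 1, and taking determinants yields all
  conclusions.\<close>

lemma conjugate_basis_identities:
  fixes J V :: "real^'m^'m"
  assumes V: "\<And>x y. (V *v x) \<bullet> (J *v (V *v y)) = x \<bullet> y"
  shows "det J * (det V)\<^sup>2 = 1" and "invertible V" and "invertible J"
proof -
  have "transpose V ** J ** V = mat 1"
  proof -
    have "(transpose V ** J ** V) *v x = x" for x
    proof -
      have "y \<bullet> ((transpose V ** J ** V) *v x) = y \<bullet> x" for y
      proof -
        have "y \<bullet> ((transpose V ** J ** V) *v x) = y \<bullet> (transpose V *v (J *v (V *v x)))"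
          by (simp only: matrix_vector_mul_assoc matrix_mul_assoc)
        also have "\<dots> = (V *v y) \<bullet> (J *v (V *v x))"
          by (simp only: dot_lmul_matrix[symmetric] vector_transpose_matrix)
        finally show ?thesis by (simp only: V)
      qed
      then have "\<forall>y. y \<bullet> ((transpose V ** J ** V) *v x) = y \<bullet> x" ..
      then show ?thesis by (rule vector_eq_ldot[THEN iffD1])
    qed
    then show ?thesis by (simp only: matrix_eq matrix_vector_mul_lid simp_thms)
  qed
  then have "det (transpose V ** J ** V) = 1" by simp
  then show d: "det J * (det V)\<^sup>2 = 1"
    by (simp add: det_mul power2_eq_square mult_ac)
  show "invertible V" "invertible J" using d by (auto simp: invertible_det_nz)
qed

text \<open>With all coordinates but the one along \<open>u\<close> frozen, the shear is a
  translation of that coordinate by a constant, and Lebesgue measure on the line is translation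
  invariant. Fubini is therefore arranged with the \<open>u\<close> coordinate innermost; since
  \<open>v\<close> is another basis vector, the shift is constant there.\<close>

lemma nn_integral_lborel_shear:
  fixes f :: "'a::euclidean_space \<Rightarrow> ennreal" and u v :: 'a
  assumes f [measurable]: "f \<in> borel_measurable borel" and u: "u \<in> Basis" and v: "v \<in> Basis" "u \<noteq> v"
  shows "(\<integral>\<^sup>+x. f (x + (c * (x \<bullet> v)) *\<^sub>R u) \<partial>lborel) = (\<integral>\<^sup>+x. f x \<partial>lborel)"
proof -
  interpret product_sigma_finite "\<lambda>_::'a. lborel :: real measure" ..
  let ?I = "Basis - {u}"
  have B: "Basis = insert u ?I" using u by auto
  define e where "e w = (\<Sum>b\<in>Basis. w b *\<^sub>R b)" for w :: "'a \<Rightarrow> real"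
  have [measurable]: "e \<in> borel_measurable (\<Pi>\<^sub>M b\<in>Basis. lborel)"
    unfolding e_def by measurable
  have e_upd: "e (w(u := y)) = (\<Sum>b\<in>?I. w b *\<^sub>R b) + y *\<^sub>R u" for w y
  proof -
    have "e (w(u := y)) = y *\<^sub>R u + (\<Sum>b\<in>?I. (w(u := y)) b *\<^sub>R b)"
      unfolding e_def using u by (subst sum.remove[of _ u]) auto
    also have "(\<Sum>b\<in>?I. (w(u := y)) b *\<^sub>R b) = (\<Sum>b\<in>?I. w b *\<^sub>R b)"
      by (intro sum.cong) auto
    finally show ?thesis by (simp only: add.commute)
  qed
  have ev: "e w \<bullet> v = w v" for w
    using v by (simp add: e_def inner_sum_left inner_Basis mult_delta_right sum.delta)
  have int: "(\<integral>\<^sup>+x. g x \<partial>lborel) = (\<integral>\<^sup>+w. (\<integral>\<^sup>+y. g (e (w(u := y))) \<partial>lborel) \<partial>(\<Pi>\<^sub>M b\<in>?I. lborel))"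
    if [measurable]: "g \<in> borel_measurable borel" for g :: "'a \<Rightarrow> ennreal"
  proof -
    have "(\<integral>\<^sup>+x. g x \<partial>lborel) = (\<integral>\<^sup>+w. g (e w) \<partial>(\<Pi>\<^sub>M b\<in>Basis. lborel))"
      unfolding e_def by (subst lborel_eq) (simp add: nn_integral_distr)
    also have "\<dots> = (\<integral>\<^sup>+w. g (e w) \<partial>(\<Pi>\<^sub>M b\<in>insert u ?I. lborel))" using B by simp
    also have "\<dots> = (\<integral>\<^sup>+w. (\<integral>\<^sup>+y. g (e (w(u := y))) \<partial>lborel) \<partial>(\<Pi>\<^sub>M b\<in>?I. lborel))"
      by (rule product_nn_integral_insert) (use B in auto)
    finally show ?thesis .
  qed
  have "(\<integral>\<^sup>+x. f (x + (c * (x \<bullet> v)) *\<^sub>R u) \<partial>lborel) =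
     (\<integral>\<^sup>+w. (\<integral>\<^sup>+y. f (e (w(u := y)) + (c * (e (w(u := y)) \<bullet> v)) *\<^sub>R u) \<partial>lborel) \<partial>(\<Pi>\<^sub>M b\<in>?I. lborel))"
    by (rule int) measurable
  also have "\<dots> = (\<integral>\<^sup>+w. (\<integral>\<^sup>+y. f (e (w(u := y))) \<partial>lborel) \<partial>(\<Pi>\<^sub>M b\<in>?I. lborel))"
  proof (rule nn_integral_cong)
    fix w
    have "(\<integral>\<^sup>+y. f ((\<Sum>b\<in>?I. w b *\<^sub>R b) + y *\<^sub>R u) \<partial>lborel) =
        (\<integral>\<^sup>+y. f ((\<Sum>b\<in>?I. w b *\<^sub>R b) + (c * w v + 1 * y) *\<^sub>R u) \<partial>lborel)"
      by (subst nn_integral_real_affine[where c=1 and t="c * w v"]) simp_all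
    then show "(\<integral>\<^sup>+y. f (e (w(u := y)) + (c * (e (w(u := y)) \<bullet> v)) *\<^sub>R u) \<partial>lborel) =
        (\<integral>\<^sup>+y. f (e (w(u := y))) \<partial>lborel)"
      using \<open>u \<noteq> v\<close> unfolding ev by (simp add: e_upd algebra_simps)
  qed
  also have "\<dots> = (\<integral>\<^sup>+x. f x \<partial>lborel)" by (rule int[symmetric]) measurable
  finally show ?thesis .
qed

text \<open>A transposition of coordinates sends open boxes to open boxes with permuted side
  lengths, and the volumes of boxes determine Lebesgue measure.\<close>

lemma distr_lborel_swap:
  fixes m n :: "'n::finite"
  shows "distr lborel borel (\<lambda>x::real^'n. \<chi> i. x $ Transposition.transpose m n i) = lborel"
proof (rule lborel_eqI[symmetric])
  let ?\<tau> = "Transposition.transpose m n"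
  let ?h = "\<lambda>x::real^'n. \<chi> i. x $ ?\<tau> i"
  have "linear ?h" by (rule linearI) (simp_all add: vec_eq_iff)
  then have "continuous_on UNIV ?h" by (simp add: linear_continuous_on linear_conv_bounded_linear)
  then have [measurable]: "?h \<in> borel_measurable borel" by (rule borel_measurable_continuous_onI)
  fix l u :: "real^'n"
  assume lu: "\<And>b. b \<in> Basis \<Longrightarrow> l \<bullet> b \<le> u \<bullet> b"
  then have lu': "l $ i \<le> u $ i" for i
    using lu[of "axis i 1"] by (auto simp: inner_axis axis_in_Basis_iff)
  have "?h -` box l u = box (?h l) (?h u)"
    by (auto simp: mem_box_cart) (metis transpose_involutory)+
  then have "emeasure (distr lborel borel ?h) (box l u) = emeasure lborel (box (?h l) (?h u))"
    by (simp add: emeasure_distr)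
  also have "\<dots> = ennreal (\<Prod>b\<in>Basis. (?h u - ?h l) \<bullet> b)"
    using lu' by (intro emeasure_lborel_box) (auto simp: Basis_vec_def inner_axis)
  also have "(\<Prod>b\<in>Basis. (?h u - ?h l) \<bullet> b) = (\<Prod>i\<in>UNIV. (u - l) $ ?\<tau> i)"
    by (rule sym, rule prod.reindex_bij_witness[of _ "\<lambda>b. SOME i. b = axis i 1" "\<lambda>i. axis i 1"])
       (auto simp: Basis_vec_def inner_axis axis_eq_axis)
  also have "\<dots> = (\<Prod>i\<in>UNIV. (u - l) $ i)"
    by (rule prod.reindex_bij_witness[of _ ?\<tau> ?\<tau>]) auto
  also have "\<dots> = (\<Prod>b\<in>Basis. (u - l) \<bullet> b)"
    by (rule prod.reindex_bij_witness[of _ "\<lambda>b. SOME i. b = axis i 1" "\<lambda>i. axis i 1"])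
       (auto simp: Basis_vec_def inner_axis axis_eq_axis)
  finally show "emeasure (distr lborel borel ?h) (box l u) = ennreal (\<Prod>b\<in>Basis. (u - l) \<bullet> b)" .
qed simp

lemma borel_measurable_matrix_vector_mult [measurable]:
  "(\<lambda>x::real^'n. A *v x) \<in> borel_measurable borel"
  by (intro borel_measurable_continuous_onI continuous_intros)

text \<open>The formula is stable under matrix products, so it reduces to elementary matrices:
  diagonal ones scale the coordinates, while transpositions and shears preserve Lebesgue measure and
  have determinant of modulus 1. A zero row is excluded by the determinant.\<close>

lemma nn_integral_lborel_linear:
  fixes A :: "real^'n^'n" and f :: "real^'n \<Rightarrow> ennreal"
  assumes "f \<in> borel_measurable borel" "det A \<noteq> 0"
  shows "(\<integral>\<^sup>+x. f x \<partial>lborel) = ennreal \<bar>det A\<bar> * (\<integral>\<^sup>+x. f (A *v x) \<partial>lborel)"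
proof -
  let ?P = "\<lambda>A::real^'n^'n. det A \<noteq> 0 \<longrightarrow> (\<forall>f\<in>borel_measurable borel.
      (\<integral>\<^sup>+x. f x \<partial>lborel) = ennreal \<bar>det A\<bar> * (\<integral>\<^sup>+x. f (A *v x) \<partial>lborel))"
  have "?P A"
  proof (induction A rule: induct_matrix_elementary)
    case (1 A B)
    show ?case
    proof (intro impI ballI)
      fix f :: "real^'n \<Rightarrow> ennreal"
      assume [measurable]: "f \<in> borel_measurable borel" and d: "det (A ** B) \<noteq> 0"
      have nz: "det A \<noteq> 0" "det B \<noteq> 0" using d by (auto simp: det_mul)
      have [measurable]: "(\<lambda>x. f (A *v x)) \<in> borel_measurable borel" by measurable
      have "(\<integral>\<^sup>+x. f x \<partial>lborel) = ennreal \<bar>det A\<bar> * (\<integral>\<^sup>+x. f (A *v x) \<partial>lborel)"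
        using 1(1)[rule_format, OF nz(1), of f] by simp
      also have "(\<integral>\<^sup>+x. f (A *v x) \<partial>lborel) = ennreal \<bar>det B\<bar> * (\<integral>\<^sup>+x. f (A *v (B *v x)) \<partial>lborel)"
        using 1(2)[rule_format, OF nz(2), of "\<lambda>x. f (A *v x)"] by simp
      finally show "(\<integral>\<^sup>+x. f x \<partial>lborel) = ennreal \<bar>det (A ** B)\<bar> * (\<integral>\<^sup>+x. f ((A ** B) *v x) \<partial>lborel)"
        by (simp add: det_mul abs_mult ennreal_mult' matrix_vector_mul_assoc mult.assoc)
    qed
  next
    case (2 A i)
    then show ?case by (metis det_zero_row(2))
  next
    case (3 A)
    show ?case
    proof (intro impI ballI)
      fix f :: "real^'n \<Rightarrow> ennreal"
      assume [measurable]: "f \<in> borel_measurable borel" and d: "det A \<noteq> 0"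
      define c where "c b = b \<bullet> (A *v b)" for b
      have cA: "c (axis i 1) = A $ i $ i" for i
        by (simp add: c_def inner_axis' matrix_vector_mult_basis column_def)
      have dA: "det A = (\<Prod>i\<in>UNIV. A $ i $ i)" using 3 by (intro det_diagonal) auto
      have nz: "c b \<noteq> 0" if "b \<in> Basis" for b
        using that d dA cA by (auto simp: Basis_vec_def)
      have pr: "(\<Prod>b\<in>Basis. \<bar>c b\<bar>) = \<bar>det A\<bar>"
      proof -
        have "(\<Prod>b\<in>Basis. \<bar>c b\<bar>) = (\<Prod>i\<in>UNIV. \<bar>A $ i $ i\<bar>)"
          by (rule sym, rule prod.reindex_bij_witness[of _ "\<lambda>b. SOME i. b = axis i 1" "\<lambda>i. axis i 1"])
            (auto simp: Basis_vec_def axis_eq_axis cA)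
        then show ?thesis by (simp add: dA abs_prod)
      qed
      have Ax: "0 + (\<Sum>j\<in>Basis. (c j * (x \<bullet> j)) *\<^sub>R j) = A *v x" for x
      proof (rule euclidean_eqI)
        fix b :: "real^'n" assume b: "b \<in> Basis"
        then obtain i where bi: "b = axis i 1" by (auto simp: Basis_vec_def)
        have T: "(0 + (\<Sum>j\<in>Basis. (c j * (x \<bullet> j)) *\<^sub>R j)) \<bullet> b = c b * (x \<bullet> b)"
          using b by (simp add: inner_sum_left inner_Basis mult_delta_right sum.delta)
        have "(A *v x) $ i = (\<Sum>j\<in>UNIV. A $ i $ j * x $ j)" by (simp add: matrix_vector_mult_def)
        also have "\<dots> = (\<Sum>j\<in>UNIV. if j = i then A $ i $ i * x $ i else 0)"
          using 3 by (intro sum.cong) auto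
        also have "\<dots> = A $ i $ i * x $ i" by simp
        finally show "(0 + (\<Sum>j\<in>Basis. (c j * (x \<bullet> j)) *\<^sub>R j)) \<bullet> b = (A *v x) \<bullet> b"
          using cA T by (simp add: bi inner_axis)
      qed
      have "lborel = density (distr lborel borel (\<lambda>x. A *v x)) (\<lambda>_. ennreal \<bar>det A\<bar>)"
        using lborel_affine_euclidean[of c 0] nz unfolding Ax pr by simp
      then have "(\<integral>\<^sup>+x. f x \<partial>lborel) = (\<integral>\<^sup>+x. f x \<partial>density (distr lborel borel (\<lambda>x. A *v x)) (\<lambda>_. ennreal \<bar>det A\<bar>))"
        by simp
      also have "\<dots> = ennreal \<bar>det A\<bar> * (\<integral>\<^sup>+x. f (A *v x) \<partial>lborel)"
        by (simp add: nn_integral_density nn_integral_cmult nn_integral_distr)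
      finally show "(\<integral>\<^sup>+x. f x \<partial>lborel) = ennreal \<bar>det A\<bar> * (\<integral>\<^sup>+x. f (A *v x) \<partial>lborel)" .
    qed
  next
    case (4 m n)
    let ?S = "(\<chi> i j. mat 1 $ i $ Transposition.transpose m n j) :: real^'n^'n"
    have d: "\<bar>det ?S\<bar> = 1"
      by (simp add: det_permute_columns permutes_swap_id sign_swap_id abs_mult)
    have S: "?S *v x = (\<chi> i. x $ Transposition.transpose m n i)" for x :: "real^'n"
    proof (rule vec_eq_iff[THEN iffD2], rule allI)
      fix i
      have tr: "i = Transposition.transpose m n j \<longleftrightarrow> j = Transposition.transpose m n i" for j
        by (metis transpose_involutory)
      show "(?S *v x) $ i = (\<chi> i. x $ Transposition.transpose m n i) $ i"
        by (simp add: matrix_vector_mult_def mat_def tr mult_delta_left)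
    qed
    have [measurable]: "(\<lambda>x::real^'n. \<chi> i. x $ Transposition.transpose m n i) \<in> borel_measurable borel"
      using borel_measurable_matrix_vector_mult[of ?S] unfolding S .
    show ?case
    proof (intro impI ballI)
      fix f :: "real^'n \<Rightarrow> ennreal"
      assume [measurable]: "f \<in> borel_measurable borel"
      have "(\<integral>\<^sup>+x. f x \<partial>lborel) = (\<integral>\<^sup>+x. f x \<partial>distr lborel borel (\<lambda>x::real^'n. \<chi> i. x $ Transposition.transpose m n i))"
        by (simp add: distr_lborel_swap)
      also have "\<dots> = (\<integral>\<^sup>+x. f (?S *v x) \<partial>lborel)" unfolding S by (simp add: nn_integral_distr)
      finally show "(\<integral>\<^sup>+x. f x \<partial>lborel) = ennreal \<bar>det ?S\<bar> * (\<integral>\<^sup>+x. f (?S *v x) \<partial>lborel)"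
        unfolding d by simp
    qed
  next
    case (5 m n c)
    let ?S = "(\<chi> i j. if i = m \<and> j = n then c else of_bool (i = j)) :: real^'n^'n"
    have S: "?S *v x = x + (c * (x \<bullet> axis n 1)) *\<^sub>R axis m 1" for x :: "real^'n"
    proof (rule vec_eq_iff[THEN iffD2], rule allI)
      fix i
      have "(?S *v x) $ i = (\<Sum>j\<in>UNIV. (if j = i then x $ j else 0) + (if j = n then (if i = m then c * x $ j else 0) else 0))"
        unfolding matrix_vector_mult_def using \<open>m \<noteq> n\<close> by (auto intro!: sum.cong)
      also have "\<dots> = x $ i + (if i = m then c * x $ n else 0)"
        by (simp add: sum.distrib)
      finally show "(?S *v x) $ i = (x + (c * (x \<bullet> axis n 1)) *\<^sub>R axis m 1) $ i"
        by (simp add: inner_axis, simp add: axis_def)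
    qed
    have d: "det ?S = 1"
    proof -
      have "?S = (\<chi> k. if k = m then row m (mat 1) + c *s row n (mat 1) else row k (mat 1))"
        using \<open>m \<noteq> n\<close> by (auto simp: vec_eq_iff row_def mat_def)
      then show ?thesis using det_row_operation[OF \<open>m \<noteq> n\<close>, of "mat 1" c] by simp
    qed
    show ?case
    proof (intro impI ballI)
      fix f :: "real^'n \<Rightarrow> ennreal"
      assume f: "f \<in> borel_measurable borel"
      show "(\<integral>\<^sup>+x. f x \<partial>lborel) = ennreal \<bar>det ?S\<bar> * (\<integral>\<^sup>+x. f (?S *v x) \<partial>lborel)"
        unfolding d S using \<open>m \<noteq> n\<close> nn_integral_lborel_shear[OF f, of "axis m 1" "axis n 1" c]
        by (simp add: axis_eq_axis)
    qed
  qed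
  then show ?thesis using assms by blast
qed

section \<open>The standard Gaussian measure\<close>

definition gdens :: "'b::euclidean_space \<Rightarrow> real" where
  "gdens x = exp (- (norm x)\<^sup>2 / 2) / sqrt ((2 * pi) ^ DIM('b))"

text \<open>All Gaussian computations refer to this one measure; the laws \<open>gauss\<close> of
  the statement enter as its affine images through \<open>gauss_eq_distr\<close>.\<close>

definition std_gauss :: "'b::euclidean_space measure" where
  "std_gauss = density lborel (\<lambda>x. ennreal (gdens x))"

lemma gdens_pos: "0 < gdens x"
  by (simp add: gdens_def)

lemma gdens_nonneg [simp]: "0 \<le> gdens x"
  using gdens_pos[of x] by simp

lemma continuous_on_gdens: "continuous_on A gdens"
  unfolding gdens_def by (intro continuous_intros) auto

lemma borel_measurable_gdens [measurable]: "gdens \<in> borel_measurable borel"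
  by (intro borel_measurable_continuous_onI continuous_on_gdens)

lemma sets_std_gauss [simp, measurable_cong]: "sets std_gauss = sets borel"
  by (simp add: std_gauss_def)

lemma space_std_gauss [simp]: "space std_gauss = UNIV"
  by (simp add: std_gauss_def)

lemma gdens_eq_prod: "gdens (x::'b::euclidean_space) = (\<Prod>b\<in>Basis. std_normal_density (x \<bullet> b))"
proof -
  have n: "(norm x)\<^sup>2 = (\<Sum>b\<in>Basis. (x \<bullet> b)\<^sup>2)"
    unfolding power2_norm_eq_inner by (subst euclidean_inner) (simp add: power2_eq_square)
  have "(\<Prod>b\<in>Basis. std_normal_density (x \<bullet> b)) = (1 / sqrt (2 * pi)) ^ DIM('b) * exp (\<Sum>b\<in>Basis. - (x \<bullet> b)\<^sup>2 / 2)"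
    by (simp add: std_normal_density_def prod.distrib exp_sum prod_dividef power_one_over)
  also have "(\<Sum>b\<in>Basis. - (x \<bullet> b)\<^sup>2 / 2) = - (norm x)\<^sup>2 / 2"
    by (simp add: n sum_negf sum_divide_distrib)
  finally show ?thesis
    unfolding gdens_def real_sqrt_power by (simp add: power_one_over)
qed

lemma prob_space_std_gauss: "prob_space (std_gauss :: 'b::euclidean_space measure)"
proof
  have "emeasure (std_gauss :: 'b measure) (space std_gauss) = (\<integral>\<^sup>+x. ennreal (gdens (x::'b)) \<partial>lborel)"
    by (simp add: std_gauss_def emeasure_density)
  also have "\<dots> = (\<integral>\<^sup>+x. (\<Prod>b\<in>Basis. ennreal (std_normal_density ((x::'b) \<bullet> b))) \<partial>lborel)"
    by (simp add: gdens_eq_prod prod_ennreal)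
  also have "\<dots> = (\<Prod>b\<in>(Basis::'b set). (\<integral>\<^sup>+x. ennreal (std_normal_density x) \<partial>lborel))"
    by (rule nn_integral_lborel_prod) auto
  also have "(\<integral>\<^sup>+x. ennreal (std_normal_density x) \<partial>lborel) = 1"
    using prob_space.emeasure_space_1[OF prob_space_normal_density[of 1 0]] by (simp add: emeasure_density)
  finally show "emeasure (std_gauss :: 'b measure) (space std_gauss) = 1" by simp
qed

interpretation std_gauss: prob_space std_gauss
  by (rule prob_space_std_gauss)

lemma measure_std_gauss_UNIV [simp]: "measure std_gauss UNIV = 1"
  using std_gauss.prob_space by simp

lemma nn_integral_std_gauss:
  assumes [measurable]: "f \<in> borel_measurable borel"
  shows "(\<integral>\<^sup>+x. f x \<partial>std_gauss) = (\<integral>\<^sup>+x. ennreal (gdens x) * f x \<partial>lborel)"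
  unfolding std_gauss_def by (simp add: nn_integral_density)

lemma integral_std_gauss:
  fixes f :: "'b::euclidean_space \<Rightarrow> 'c::{banach, second_countable_topology}"
  assumes [measurable]: "f \<in> borel_measurable borel"
  shows "(\<integral>x. f x \<partial>std_gauss) = (\<integral>x. gdens x *\<^sub>R f x \<partial>lborel)"
  unfolding std_gauss_def by (simp add: integral_density)

text \<open>Density and exponential both factor over the coordinates, which reduces the claim to the
  known characteristic function on the line.\<close>

lemma std_gauss_iexp:
  "(\<integral>x. iexp (u \<bullet> x) \<partial>std_gauss) = complex_of_real (exp (- (norm (u::'b::euclidean_space))\<^sup>2 / 2))"
proof -
  interpret product_sigma_finite "\<lambda>_::'b. lborel :: real measure" ..
  let ?f = "\<lambda>b x. std_normal_density x *\<^sub>R iexp ((u \<bullet> b) * x)"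
  have one: "(\<integral>x. std_normal_density x *\<^sub>R iexp (t * x) \<partial>lborel) = complex_of_real (exp (- t\<^sup>2 / 2))" for t
  proof -
    have "char std_normal_distribution t = (\<integral>x. std_normal_density x *\<^sub>R iexp (t * x) \<partial>lborel)"
      unfolding char_def by (subst integral_density) simp_all
    then show ?thesis by (simp add: char_std_normal_distribution)
  qed
  have int: "integrable lborel (?f b)" for b
  proof -
    interpret N: prob_space std_normal_distribution
      by (rule prob_space_normal_density) simp
    have "integrable std_normal_distribution (\<lambda>x. iexp ((u \<bullet> b) * x))"
      by (rule N.integrable_const_bound[where B=1]) (auto simp: norm_exp_i_times[simplified])
    then show ?thesis by (subst (asm) integrable_density) auto
  qed
  have eq: "gdens (\<Sum>b\<in>Basis. w b *\<^sub>R b) *\<^sub>R iexp (u \<bullet> (\<Sum>b\<in>Basis. w b *\<^sub>R b)) = (\<Prod>b\<in>Basis. ?f b (w b))"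
    for w :: "'b \<Rightarrow> real"
  proof -
    have "(\<Prod>b\<in>Basis. ?f b (w b)) = (\<Prod>b\<in>Basis. complex_of_real (std_normal_density (w b))) *
         (\<Prod>b\<in>Basis. iexp ((u \<bullet> b) * w b))"
      by (simp add: scaleR_conv_of_real prod.distrib)
    also have "(\<Prod>b\<in>Basis. iexp ((u \<bullet> b) * w b)) = iexp (u \<bullet> (\<Sum>b\<in>Basis. w b *\<^sub>R b))"
      by (simp add: exp_sum[symmetric] inner_sum_right sum_distrib_left mult_ac)
    also have "(\<Prod>b\<in>Basis. complex_of_real (std_normal_density (w b))) = complex_of_real (gdens (\<Sum>b\<in>Basis. w b *\<^sub>R b))"
      by (simp add: gdens_eq_prod)
    finally show ?thesis by (simp add: scaleR_conv_of_real)
  qed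
  have "(\<integral>x. iexp (u \<bullet> x) \<partial>std_gauss) = (\<integral>x. gdens x *\<^sub>R iexp (u \<bullet> x) \<partial>lborel)"
    by (rule integral_std_gauss) measurable
  also have "\<dots> = (\<integral>w. (\<Prod>b\<in>Basis. ?f b (w b)) \<partial>(\<Pi>\<^sub>M b\<in>(Basis::'b set). lborel))"
    unfolding eq[symmetric] by (subst lborel_eq, subst integral_distr) simp_all
  also have "\<dots> = (\<Prod>b\<in>Basis. (\<integral>x. ?f b x \<partial>lborel))"
    by (rule product_integral_prod) (simp, rule int)
  also have "\<dots> = (\<Prod>b\<in>Basis. complex_of_real (exp (- (u \<bullet> b)\<^sup>2 / 2)))"
    by (simp only: one)
  also have "\<dots> = complex_of_real (exp (\<Sum>b\<in>Basis. - (u \<bullet> b)\<^sup>2 / 2))"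
    by (simp add: exp_sum)
  also have "(\<Sum>b\<in>Basis. - (u \<bullet> b)\<^sup>2 / 2) = - (norm u)\<^sup>2 / 2"
    unfolding power2_norm_eq_inner
    by (subst (2) euclidean_inner) (simp add: power2_eq_square sum_negf sum_divide_distrib)
  finally show ?thesis .
qed

text \<open>Balls of equal volume: the Gaussian density is at least its value on the sphere of radius b
  inside the centred ball and at most that value outside.\<close>

lemma std_gauss_cball_le:
  fixes v :: "'b::euclidean_space"
  shows "measure std_gauss (cball v b) \<le> measure std_gauss (cball (0::'b) b)"
proof (cases "b \<ge> 0")
  case True
  define t where "t = exp (- b\<^sup>2 / 2) / sqrt ((2 * pi) ^ DIM('b))"
  have t: "0 \<le> t" by (simp add: t_def)
  let ?A = "cball v b" and ?B = "cball (0::'b) b"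
  have in_B: "t \<le> gdens x" if "x \<in> ?B" for x
    using that power_mono[of "norm x" b 2] by (auto simp: t_def gdens_def intro!: divide_right_mono)
  have out_B: "gdens x \<le> t" if "x \<notin> ?B" for x
    using that power_mono[of b "norm x" 2] True by (auto simp: t_def gdens_def intro!: divide_right_mono)
  have "emeasure lborel ?A = emeasure lborel ?B"
    using emeasure_cball[OF True, of v] emeasure_cball[OF True, of "0::'b"] by simp
  moreover have "emeasure lborel X = emeasure lborel (X - Y) + emeasure lborel (X \<inter> Y)"
    if "X \<in> sets borel" "Y \<in> sets borel" for X Y :: "'b set"
  proof -
    have "(X - Y) \<union> (X \<inter> Y) = X" by auto
    then show ?thesis using that plus_emeasure[of "X - Y" lborel "X \<inter> Y"] by fastforce
  qed
  ultimately have "emeasure lborel (?A - ?B) + emeasure lborel (?A \<inter> ?B) = emeasure lborel (?B - ?A) + emeasure lborel (?A \<inter> ?B)"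
    by (metis Int_commute borel_closed closed_cball)
  \<comment> \<open>Volumes live in \<open>ennreal\<close>, where the common part may be cancelled
    only once it is known to be finite.\<close>
  moreover have "emeasure lborel (?A \<inter> ?B) \<noteq> \<infinity>"
    using emeasure_mono[of "?A \<inter> ?B" ?A lborel] emeasure_lborel_cball_finite[of v b] by (auto simp: top_unique)
  ultimately have vol: "emeasure lborel (?A - ?B) = emeasure lborel (?B - ?A)"
    by (simp add: ennreal_add_left_cancel add.commute)
  have "emeasure std_gauss (?A - ?B) = (\<integral>\<^sup>+x. ennreal (gdens x) * indicator (?A - ?B) x \<partial>lborel)"
    unfolding std_gauss_def by (simp add: emeasure_density)
  also have "\<dots> \<le> (\<integral>\<^sup>+x. ennreal t * indicator (?A - ?B) x \<partial>lborel)"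
    using out_B by (intro nn_integral_mono) (auto simp: indicator_def intro!: ennreal_leI)
  also have "\<dots> = (\<integral>\<^sup>+x. ennreal t * indicator (?B - ?A) x \<partial>lborel)"
    by (subst (1 2) nn_integral_cmult_indicator) (simp_all add: vol)
  also have "\<dots> \<le> (\<integral>\<^sup>+x. ennreal (gdens x) * indicator (?B - ?A) x \<partial>lborel)"
    using in_B by (intro nn_integral_mono) (auto simp: indicator_def intro!: ennreal_leI)
  also have "\<dots> = emeasure std_gauss (?B - ?A)"
    unfolding std_gauss_def by (simp add: emeasure_density)
  finally have "measure std_gauss (?A - ?B) \<le> measure std_gauss (?B - ?A)"
    by (simp add: std_gauss.emeasure_eq_measure)
  moreover have "measure std_gauss ?A = measure std_gauss (?A - ?B) + measure std_gauss (?A \<inter> ?B)"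
    by (subst std_gauss.finite_measure_Union[symmetric]) (auto intro!: arg_cong[where f="measure std_gauss"])
  moreover have "measure std_gauss ?B = measure std_gauss (?B - ?A) + measure std_gauss (?A \<inter> ?B)"
    by (subst std_gauss.finite_measure_Union[symmetric]) (auto intro!: arg_cong[where f="measure std_gauss"])
  ultimately show ?thesis by linarith
qed simp

section \<open>Gaussian tails, translations and smoothing\<close>

lemma std_gauss_tail:
  assumes "\<eta> > 0"
  obtains T where "T > 0" "measure (std_gauss :: 'b::euclidean_space measure) {x. T < norm x} < \<eta>"
proof -
  let ?A = "\<lambda>n::nat. {x::'b. real n < norm x}"
  have "(\<lambda>n. measure std_gauss (?A n)) \<longlonglongrightarrow> measure std_gauss (\<Inter>n. ?A n)"
    by (rule std_gauss.finite_Lim_measure_decseq) (auto simp: decseq_def)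
  moreover have "(\<Inter>n. ?A n) = {}"
  proof -
    have "\<exists>n. \<not> real n < norm x" for x :: 'b using real_arch_simple[of "norm x"] by (auto simp: not_less)
    then show ?thesis by auto
  qed
  ultimately have "(\<lambda>n. measure (std_gauss :: 'b measure) (?A n)) \<longlonglongrightarrow> 0" by simp
  then have "\<forall>\<^sub>F n in sequentially. measure (std_gauss :: 'b measure) (?A n) < \<eta>"
    using assms by (rule order_tendstoD)
  then have "\<forall>\<^sub>F n in sequentially. measure (std_gauss :: 'b measure) (?A n) < \<eta> \<and> 0 < n"
    using eventually_gt_at_top by (rule eventually_conj)
  then obtain n where "measure (std_gauss :: 'b measure) (?A n) < \<eta>" "0 < n"
    by (auto simp: eventually_sequentially)
  then show ?thesis by (intro that[of "real n"]) auto
qed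


text \<open>This is the Cameron-Martin formula. It identifies the limit of tilted expectations in
  \<open>tendsto_tilt\<close>: tilting the standard Gaussian amounts to shifting it.\<close>

lemma std_gauss_translate:
  fixes f :: "'b::euclidean_space \<Rightarrow> real"
  assumes [measurable]: "f \<in> borel_measurable borel"
  shows "(\<integral>z. exp (u \<bullet> z - (norm u)\<^sup>2 / 2) * f z \<partial>std_gauss) = (\<integral>z. f (u + z) \<partial>std_gauss)"
proof -
  have g: "gdens z * exp (u \<bullet> z - (norm u)\<^sup>2 / 2) = gdens (z - u)" for z
  proof -
    have "- (norm z)\<^sup>2 / 2 + (u \<bullet> z - (norm u)\<^sup>2 / 2) = - (norm (z - u))\<^sup>2 / 2"
      by (simp add: power2_norm_eq_inner inner_diff_left inner_diff_right inner_commute field_simps)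
    then have "exp (- (norm z)\<^sup>2 / 2) * exp (u \<bullet> z - (norm u)\<^sup>2 / 2) = exp (- (norm (z - u))\<^sup>2 / 2)"
      by (simp only: mult_exp_exp)
    then show ?thesis
      unfolding gdens_def by (simp only: times_divide_eq_left)
  qed
  have "(\<integral>z. exp (u \<bullet> z - (norm u)\<^sup>2 / 2) * f z \<partial>std_gauss) = (\<integral>z. gdens (z - u) * f z \<partial>lborel)"
    by (subst integral_std_gauss) (simp_all add: mult.assoc[symmetric] g)
  also have "\<dots> = (\<integral>z. gdens (z - u) * f z \<partial>distr lborel borel ((+) u))"
    by (simp add: lborel_distr_plus)
  also have "\<dots> = (\<integral>z. gdens z * f (u + z) \<partial>lborel)"
    by (subst integral_distr) simp_all
  also have "\<dots> = (\<integral>z. f (u + z) \<partial>std_gauss)"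
    by (subst integral_std_gauss) simp_all
  finally show ?thesis .
qed

text \<open>The substitution is y = x + e z. The gain lies in the left-hand side: there
  \<open>x\<close> occurs only in a Gaussian kernel, and that kernel is a characteristic function,
  the form in which convergence is assumed in \<open>tendsto_std_gauss\<close>.\<close>

lemma Gaussian_smoothing:
  fixes k :: "'b::euclidean_space \<Rightarrow> real"
  assumes k [measurable]: "k \<in> borel_measurable borel" and e: "0 < e"
  shows "(\<integral>y. k y * exp (- (norm (y - x))\<^sup>2 / (2 * e\<^sup>2)) \<partial>lborel)
    = e ^ DIM('b) * sqrt ((2 * pi) ^ DIM('b)) * (\<integral>z. k (x + e *\<^sub>R z) \<partial>std_gauss)"
proof -
  have nn: "(norm (e *\<^sub>R z))\<^sup>2 / (2 * e\<^sup>2) = (norm z)\<^sup>2 / 2" for z :: 'b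
    using e by (simp add: power_mult_distrib)
  have "(\<integral>y. k y * exp (- (norm (y - x))\<^sup>2 / (2 * e\<^sup>2)) \<partial>lborel) =
     (\<integral>y. k y * exp (- (norm (y - x))\<^sup>2 / (2 * e\<^sup>2)) \<partial>density (distr lborel borel (\<lambda>z. x + e *\<^sub>R z)) (\<lambda>_. \<bar>e\<bar> ^ DIM('b)))"
    using lborel_affine[of e x] e by simp
  also have "\<dots> = (\<integral>z. e ^ DIM('b) * (k (x + e *\<^sub>R z) * exp (- ((norm z)\<^sup>2 / 2))) \<partial>lborel)"
    using e by (subst integral_density; (subst integral_distr)?) (simp_all add: nn[symmetric])
  also have "\<dots> = (\<integral>z. e ^ DIM('b) * sqrt ((2 * pi) ^ DIM('b)) * (gdens z * k (x + e *\<^sub>R z)) \<partial>lborel)"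
    by (intro Bochner_Integration.integral_cong) (simp_all add: gdens_def)
  also have "\<dots> = e ^ DIM('b) * sqrt ((2 * pi) ^ DIM('b)) * (\<integral>z. k (x + e *\<^sub>R z) \<partial>std_gauss)"
    by (subst integral_std_gauss) simp_all
  finally show ?thesis .
qed

text \<open>Convolving the test function with a narrow Gaussian turns its integral into an average of
  characteristic functions.\<close>

lemma tendsto_std_gauss:
  fixes \<nu> :: "nat \<Rightarrow> 'b::euclidean_space measure" and k :: "'b \<Rightarrow> real"
  assumes \<nu>: "\<And>n. prob_space (\<nu> n)" and sets_\<nu> [measurable_cong]: "\<And>n. sets (\<nu> n) = sets borel"
    and char: "\<And>u. (\<lambda>n. \<integral>x. iexp (u \<bullet> x) \<partial>\<nu> n) \<longlonglongrightarrow> complex_of_real (exp (- (norm u)\<^sup>2 / 2))"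
    and k: "continuous_on UNIV k" and supp: "\<And>x. B < norm x \<Longrightarrow> k x = 0"
  shows "(\<lambda>n. \<integral>x. k x \<partial>\<nu> n) \<longlonglongrightarrow> (\<integral>x. k x \<partial>std_gauss)"
proof -
  have km [measurable]: "k \<in> borel_measurable borel" using k by (rule borel_measurable_continuous_onI)
  have comp: "compact (k ` cball 0 B)"
    by (intro compact_continuous_image continuous_on_subset[OF k]) auto
  obtain C0 where C0: "\<And>x. x \<in> cball 0 B \<Longrightarrow> \<bar>k x\<bar> \<le> C0"
    using compact_imp_bounded[OF comp] unfolding bounded_iff by (metis imageI real_norm_def)
  define C where "C = max C0 1"
  have C: "\<bar>k x\<bar> \<le> C" for x using C0[of x] supp[of x] by (cases "norm x \<le> B") (auto simp: C_def)
  have C_pos: "C > 0" by (simp add: C_def)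
  have ki: "integrable lborel k"
  proof -
    have "integrable lborel (\<lambda>x. indicator (cball 0 B) x *\<^sub>R k x)"
      by (rule borel_integrable_compact) (auto intro: continuous_on_subset[OF k])
    moreover have "(\<lambda>x. indicator (cball 0 B) x *\<^sub>R k x) = k"
      using supp by (auto simp: indicator_def fun_eq_iff not_le)
    ultimately show ?thesis by simp
  qed
  have kint: "integrable M k" if "finite_measure M" "sets M = sets borel" for M
    using that C by (intro finite_measure.integrable_const_bound[of M k C]) (auto cong: measurable_cong_sets)
  have uc: "uniformly_continuous_on UNIV k"
  proof -
    \<comment> \<open>The margin 1 deals with pairs near the boundary: two points at distance below
      1 either both lie in the enlarged ball or both have norm above \<open>B\<close>, where
      \<open>k\<close> vanishes.\<close>
    have "uniformly_continuous_on (cball 0 (B + 1)) k"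
      by (intro compact_uniformly_continuous continuous_on_subset[OF k]) auto
    show ?thesis unfolding uniformly_continuous_on_def
    proof (intro allI impI)
      fix \<eta> :: real assume \<eta>: "\<eta> > 0"
      from \<open>uniformly_continuous_on (cball 0 (B + 1)) k\<close> \<eta> obtain d where d: "d > 0"
        "\<And>x y. x \<in> cball 0 (B + 1) \<Longrightarrow> y \<in> cball 0 (B + 1) \<Longrightarrow> dist y x < d \<Longrightarrow> dist (k y) (k x) < \<eta>"
        unfolding uniformly_continuous_on_def by metis
      have "dist (k y) (k x) < \<eta>" if "dist y x < min d 1" for x y
      proof (cases "norm x \<le> B + 1 \<and> norm y \<le> B + 1")
        case True then show ?thesis using d(2)[of x y] that by auto
      next
        case False
        have "\<bar>norm y - norm x\<bar> < 1" using norm_triangle_ineq3[of y x] that by (simp add: dist_norm)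
        then have "norm x > B" "norm y > B" using False by linarith+
        then show ?thesis using supp \<eta> by simp
      qed
      then show "\<exists>d>0. \<forall>x\<in>UNIV. \<forall>x'\<in>UNIV. dist x' x < d \<longrightarrow> dist (k x') (k x) < \<eta>"
        using d(1) by (intro exI[of _ "min d 1"]) auto
    qed
  qed
  have smooth_conv: "(\<lambda>n. \<integral>x. (\<integral>z. k (x + e *\<^sub>R z) \<partial>std_gauss) \<partial>\<nu> n) \<longlonglongrightarrow>
      (\<integral>x. (\<integral>z. k (x + e *\<^sub>R z) \<partial>std_gauss) \<partial>std_gauss)" if e: "e > 0" for e
  proof -
    let ?w = "\<lambda>y x::'b. exp (- (norm (y - x))\<^sup>2 / (2 * e\<^sup>2))"
    let ?c = "e ^ DIM('b) * sqrt ((2 * pi) ^ DIM('b))"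
    have c: "?c > 0" using e by simp
    \<comment> \<open>The Gaussian kernel is its own Fourier transform up to scaling:
      \<open>?w y x\<close> is the characteristic function of the standard Gaussian at (y -
      x)/e.\<close>
    have w_char: "complex_of_real (?w y x) = (\<integral>z. iexp (((1 / e) *\<^sub>R (y - x)) \<bullet> z) \<partial>std_gauss)" for x y
      unfolding std_gauss_iexp using e by (simp add: power_mult_distrib power_divide power_one_over)
    \<comment> \<open>After exchanging the integrations, the inner one is the characteristic
      function of \<open>M\<close> at -z/e. The hypothesis \<open>char\<close> then acts pointwise
      in \<open>z\<close>, with integrands bounded by 1.\<close>
    have step: "complex_of_real (\<integral>x. ?w y x \<partial>M) = (\<integral>z. iexp ((1 / e) *\<^sub>R y \<bullet> z) *
        (\<integral>x. iexp ((- (1 / e) *\<^sub>R z) \<bullet> x) \<partial>M) \<partial>std_gauss)"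
      if M: "prob_space M" and [measurable_cong]: "sets M = sets borel" for M y
    proof -
      interpret M: prob_space M by fact
      interpret pair_prob_space M "std_gauss :: 'b measure" ..
      let ?f = "\<lambda>x z. iexp (((1 / e) *\<^sub>R (y - x)) \<bullet> z)"
      have int: "integrable (M \<Otimes>\<^sub>M std_gauss) (\<lambda>(x, z). ?f x z)"
        by (rule P.integrable_const_bound[where B=1]) (auto simp: split_beta)
      have "complex_of_real (\<integral>x. ?w y x \<partial>M) = (\<integral>x. complex_of_real (?w y x) \<partial>M)"
        by (rule integral_complex_of_real[symmetric])
      also have "\<dots> = (\<integral>x. (\<integral>z. ?f x z \<partial>std_gauss) \<partial>M)" by (simp only: w_char)
      also have "\<dots> = (\<integral>z. (\<integral>x. ?f x z \<partial>M) \<partial>std_gauss)"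
        by (rule Fubini_integral[OF int, symmetric])
      also have "\<dots> = (\<integral>z. iexp ((1 / e) *\<^sub>R y \<bullet> z) *
        (\<integral>x. iexp ((- (1 / e) *\<^sub>R z) \<bullet> x) \<partial>M) \<partial>std_gauss)"
      proof (rule Bochner_Integration.integral_cong[OF refl])
        fix z
        have "?f x z = iexp ((1 / e) *\<^sub>R y \<bullet> z) * iexp ((- (1 / e) *\<^sub>R z) \<bullet> x)" for x
          by (simp add: exp_add[symmetric] algebra_simps inner_diff_left inner_commute)
        then show "(\<integral>x. ?f x z \<partial>M) = iexp ((1 / e) *\<^sub>R y \<bullet> z) *
            (\<integral>x. iexp ((- (1 / e) *\<^sub>R z) \<bullet> x) \<partial>M)"
          by simp
      qed
      finally show ?thesis .
    qed
    have A_conv: "(\<lambda>n. \<integral>x. ?w y x \<partial>\<nu> n) \<longlonglongrightarrow> (\<integral>x. ?w y x \<partial>std_gauss)" for y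
    proof -
      have "(\<lambda>n. complex_of_real (\<integral>x. ?w y x \<partial>\<nu> n)) \<longlonglongrightarrow> complex_of_real (\<integral>x. ?w y x \<partial>std_gauss)"
        unfolding step[OF \<nu> sets_\<nu>] step[OF prob_space_std_gauss sets_std_gauss]
      proof (rule integral_dominated_convergence[where w="\<lambda>_. 1"])
        fix n
        interpret N: prob_space "\<nu> n" by (rule \<nu>)
        show "(\<lambda>z. iexp ((1 / e) *\<^sub>R y \<bullet> z) *
           (\<integral>x. iexp ((- (1 / e) *\<^sub>R z) \<bullet> x) \<partial>\<nu> n)) \<in> borel_measurable std_gauss"
          by measurable
        have "norm (\<integral>x. iexp ((- (1 / e) *\<^sub>R z) \<bullet> x) \<partial>\<nu> n) \<le> 1" for z
        proof -
          have "norm (\<integral>x. iexp ((- (1 / e) *\<^sub>R z) \<bullet> x) \<partial>\<nu> n) \<le>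
             (\<integral>x. norm (iexp ((- (1 / e) *\<^sub>R z) \<bullet> x)) \<partial>\<nu> n)" by (rule integral_norm_bound)
          then show ?thesis by (simp add: N.prob_space)
        qed
        then show "AE z in std_gauss. norm (iexp ((1 / e) *\<^sub>R y \<bullet> z) *
           (\<integral>x. iexp ((- (1 / e) *\<^sub>R z) \<bullet> x) \<partial>\<nu> n)) \<le> 1"
          by (intro AE_I2) (simp add: norm_mult)
      next
        show "AE z in std_gauss. (\<lambda>n. iexp ((1 / e) *\<^sub>R y \<bullet> z) *
           (\<integral>x. iexp ((- (1 / e) *\<^sub>R z) \<bullet> x) \<partial>\<nu> n)) \<longlonglongrightarrow>
           iexp ((1 / e) *\<^sub>R y \<bullet> z) *
           (\<integral>x. iexp ((- (1 / e) *\<^sub>R z) \<bullet> x) \<partial>std_gauss)"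
          unfolding std_gauss_iexp by (intro AE_I2 tendsto_intros char)
      qed (simp_all)
      then show ?thesis by (simp add: tendsto_of_real_iff)
    qed
    have swap: "(\<integral>x. (\<integral>z. k (x + e *\<^sub>R z) \<partial>std_gauss) \<partial>M) = (1 / ?c) * (\<integral>y. k y * (\<integral>x. ?w y x \<partial>M) \<partial>lborel)"
      if M: "prob_space M" and [measurable_cong]: "sets M = sets borel" for M
    proof -
      interpret M: prob_space M by fact
      interpret pair_sigma_finite M "lborel :: 'b measure" ..
      have int: "integrable (M \<Otimes>\<^sub>M lborel) (\<lambda>(x, y). k y * ?w y x)"
      proof (rule Bochner_Integration.integrable_bound)
        show "integrable (M \<Otimes>\<^sub>M lborel) (\<lambda>(x, y). 1 * k y)"
          using ki by (intro Fubini_integrable) simp_all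
      qed (auto simp: split_beta abs_mult mult_left_le)
      have "?c * (\<integral>x. (\<integral>z. k (x + e *\<^sub>R z) \<partial>std_gauss) \<partial>M) = (\<integral>x. (\<integral>y. k y * ?w y x \<partial>lborel) \<partial>M)"
        unfolding Gaussian_smoothing[OF km e] by (rule integral_mult_right_zero[symmetric])
      also have "\<dots> = (\<integral>y. (\<integral>x. k y * ?w y x \<partial>M) \<partial>lborel)"
        by (rule Fubini_integral[OF int, symmetric])
      finally have "?c * (\<integral>x. (\<integral>z. k (x + e *\<^sub>R z) \<partial>std_gauss) \<partial>M) = (\<integral>y. k y * (\<integral>x. ?w y x \<partial>M) \<partial>lborel)"
        by simp
      moreover have "X = 1 / c * Y" if "c * X = Y" "c > 0" for c X Y :: real
        using that by (auto simp: field_simps)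
      ultimately show ?thesis using c by blast
    qed
    have "(\<lambda>n. \<integral>y. k y * (\<integral>x. ?w y x \<partial>\<nu> n) \<partial>lborel) \<longlonglongrightarrow> (\<integral>y. k y * (\<integral>x. ?w y x \<partial>std_gauss) \<partial>lborel)"
    proof (rule integral_dominated_convergence[where w="\<lambda>y. \<bar>k y\<bar>"])
      fix n
      interpret N: prob_space "\<nu> n" by (rule \<nu>)
      show "(\<lambda>y. k y * (\<integral>x. ?w y x \<partial>\<nu> n)) \<in> borel_measurable lborel" by measurable
      have "\<bar>\<integral>x. ?w y x \<partial>\<nu> n\<bar> \<le> 1" for y
      proof -
        have "\<bar>\<integral>x. ?w y x \<partial>\<nu> n\<bar> \<le> (\<integral>x. 1 \<partial>\<nu> n)"
          by (rule integral_abs_bound_integral) (auto intro!: N.integrable_const_bound[where B=1])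
        then show ?thesis by (simp add: N.prob_space)
      qed
      then show "AE y in lborel. norm (k y * (\<integral>x. ?w y x \<partial>\<nu> n)) \<le> \<bar>k y\<bar>"
        by (intro AE_I2) (simp add: abs_mult mult_left_le)
    next
      show "AE y in lborel. (\<lambda>n. k y * (\<integral>x. ?w y x \<partial>\<nu> n)) \<longlonglongrightarrow> k y * (\<integral>x. ?w y x \<partial>std_gauss)"
        by (intro AE_I2 tendsto_intros A_conv)
    qed (use ki in \<open>simp_all\<close>)
    then show ?thesis
      unfolding swap[OF \<nu> sets_\<nu>] swap[OF prob_space_std_gauss sets_std_gauss] by (intro tendsto_intros)
  qed
  show ?thesis
  proof (rule LIMSEQ_I)
    fix \<eta> :: real assume \<eta>: "\<eta> > 0"
    obtain d where d: "d > 0" "\<And>x y. dist y x < d \<Longrightarrow> dist (k y) (k x) < \<eta> / 8"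
      using uc \<eta> unfolding uniformly_continuous_on_def by (metis UNIV_I zero_less_divide_iff zero_less_numeral)
    obtain T where T: "T > 0" "measure (std_gauss :: 'b measure) {x. T < norm x} < \<eta> / (16 * C)"
      using std_gauss_tail[of "\<eta> / (16 * C)"] \<eta> C_pos by auto
    \<comment> \<open>A displacement by e z with |z| at most \<open>T\<close> has length at most
      d/2, within the modulus of continuity. The mass beyond \<open>T\<close> was chosen small
      against 2 \<open>C\<close>, which bounds any change of \<open>k\<close>.\<close>
    define e where "e = d / (2 * T)"
    have e: "e > 0" using d T by (simp add: e_def)
    let ?K = "\<lambda>x. \<integral>z. k (x + e *\<^sub>R z) \<partial>std_gauss"
    have close: "\<bar>?K x - k x\<bar> \<le> \<eta> / 4" for x
    proof -
      have i1: "integrable std_gauss (\<lambda>z. k (x + e *\<^sub>R z))"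
        by (rule std_gauss.integrable_const_bound[where B=C]) (auto intro: C)
      have "\<bar>?K x - k x\<bar> = \<bar>\<integral>z. k (x + e *\<^sub>R z) - k x \<partial>std_gauss\<bar>"
        using i1 by (simp add: std_gauss.prob_space)
      also have "\<dots> \<le> (\<integral>z. \<eta> / 8 + 2 * C * indicator {z. T < norm z} (z::'b) \<partial>std_gauss)"
      proof (rule integral_abs_bound_integral)
        fix z :: 'b
        show "\<bar>k (x + e *\<^sub>R z) - k x\<bar> \<le> \<eta> / 8 + 2 * C * indicator {z. T < norm z} z"
        proof (cases "T < norm z")
          case True
          then show ?thesis using C[of x] C[of "x + e *\<^sub>R z"] \<eta> by auto
        next
          case False
          have "dist (x + e *\<^sub>R z) x = e * norm z" using e by (simp add: dist_norm)
          also have "\<dots> \<le> e * T" using False e by (intro mult_left_mono) auto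
          also have "\<dots> < d" using T d by (simp add: e_def)
          finally show ?thesis using d(2) False by (force simp: dist_real_def)
        qed
      qed (use i1 in \<open>simp_all add: std_gauss.emeasure_eq_measure\<close>)
      also have "\<dots> = \<eta> / 8 + 2 * C * measure (std_gauss :: 'b measure) {x. T < norm x}"
        by (simp add: std_gauss.emeasure_eq_measure)
      also have "\<dots> \<le> \<eta> / 4" using T C_pos by (simp add: field_simps)
      finally show ?thesis .
    qed
    have diff: "\<bar>(\<integral>x. ?K x \<partial>M) - (\<integral>x. k x \<partial>M)\<bar> \<le> \<eta> / 4" if M: "prob_space M" and [measurable_cong]: "sets M = sets borel" for M
    proof -
      interpret M: prob_space M by fact
      have "\<bar>?K x\<bar> \<le> C + \<eta> / 4" for x using close[of x] C[of x] by linarith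
      then have K: "integrable M ?K" by (intro M.integrable_const_bound[where B="C + \<eta> / 4"]) auto
      have kM: "integrable M k" by (rule kint) (auto simp: that(2) M.finite_measure_axioms)
      have "\<bar>(\<integral>x. ?K x \<partial>M) - (\<integral>x. k x \<partial>M)\<bar> = \<bar>\<integral>x. ?K x - k x \<partial>M\<bar>" using K kM by simp
      also have "\<dots> \<le> (\<integral>x. \<eta> / 4 \<partial>M)"
        by (rule integral_abs_bound_integral) (use K kM close in auto)
      finally show ?thesis by (simp add: M.prob_space)
    qed
    obtain N where N: "\<And>n. n \<ge> N \<Longrightarrow> \<bar>(\<integral>x. ?K x \<partial>\<nu> n) - (\<integral>x. ?K x \<partial>std_gauss)\<bar> < \<eta> / 4"
      using LIMSEQ_D[OF smooth_conv[OF e], of "\<eta> / 4"] \<eta> by auto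
    show "\<exists>N. \<forall>n\<ge>N. norm ((\<integral>x. k x \<partial>\<nu> n) - (\<integral>x. k x \<partial>std_gauss)) < \<eta>"
    proof (intro exI allI impI)
      fix n assume "n \<ge> N"
      then show "norm ((\<integral>x. k x \<partial>\<nu> n) - (\<integral>x. k x \<partial>std_gauss)) < \<eta>"
        using N[of n] diff[OF \<nu> sets_\<nu>, of n] diff[OF prob_space_std_gauss sets_std_gauss] \<eta>
        unfolding real_norm_def by linarith
    qed
  qed
qed

text \<open>Pulled back along \<open>V\<close>, the form of \<open>J\<close> becomes the Euclidean
  one, so substituting h + V x turns the exponent into -|x|^2/2. The Jacobian |det V| is exactly
  what the normalising constant requires, because the inverse of \<open>J\<close> has determinant
  (det V)^2.\<close>

lemma gauss_eq_distr:
  fixes J V :: "real^'m^'m"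
  assumes V: "\<And>x y. (V *v x) \<bullet> (J *v (V *v y)) = x \<bullet> y"
  shows "gauss h (matrix_inv J) = distr std_gauss borel (\<lambda>x. h + V *v x)"
proof (rule measure_eqI)
  note id = conjugate_basis_identities[OF V]
  have dV: "det V \<noteq> 0" using id(2) by (simp add: invertible_det_nz)
  have dJ: "det (matrix_inv J) = (det V)\<^sup>2"
  proof -
    have "det (matrix_inv J) * det J = 1"
      using det_mul[of "matrix_inv J" J] matrix_inv_inverse(2)[OF id(3)] by simp
    then show ?thesis using id(1) by (metis mult.assoc mult.commute mult_1_right)
  qed
  define \<phi> where "\<phi> x = exp (- (1/2) * ((x - h) \<bullet> (J *v (x - h)))) / sqrt ((2 * pi) ^ CARD('m) * (det V)\<^sup>2)" for x :: "real^'m"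
  have gauss: "gauss h (matrix_inv J) = density lborel (\<lambda>x. ennreal (\<phi> x))"
    unfolding gauss_def \<phi>_def matrix_inv_matrix_inv[OF id(3)] dJ ..
  have [measurable]: "\<phi> \<in> borel_measurable borel"
    unfolding \<phi>_def by measurable
  have Vphi: "\<bar>det V\<bar> * \<phi> (h + V *v x) = gdens x" for x
  proof -
    have "sqrt ((2 * pi) ^ CARD('m) * (det V)\<^sup>2) = sqrt ((2 * pi) ^ CARD('m)) * \<bar>det V\<bar>"
      by (simp only: real_sqrt_mult real_sqrt_abs)
    moreover have "exp (- (1/2) * ((h + V *v x - h) \<bullet> (J *v (h + V *v x - h)))) = exp (- (norm x)\<^sup>2 / 2)"
      by (simp add: V power2_norm_eq_inner)
    ultimately show ?thesis unfolding \<phi>_def gdens_def using dV by simp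
  qed
  show "sets (gauss h (matrix_inv J)) = sets (distr std_gauss borel (\<lambda>x. h + V *v x))"
    by (simp add: gauss)
  fix A assume "A \<in> sets (gauss h (matrix_inv J))"
  then have A [measurable]: "A \<in> sets borel" by (simp add: gauss)
  have "emeasure (gauss h (matrix_inv J)) A = (\<integral>\<^sup>+y. ennreal (\<phi> y) * indicator A y \<partial>lborel)"
    by (simp add: gauss emeasure_density)
  also have "\<dots> = (\<integral>\<^sup>+y. ennreal (\<phi> y) * indicator A y \<partial>distr lborel borel ((+) h))"
    by (simp add: lborel_distr_plus)
  also have "\<dots> = (\<integral>\<^sup>+y. ennreal (\<phi> (h + y)) * indicator A (h + y) \<partial>lborel)"
    by (subst nn_integral_distr) simp_all
  also have "\<dots> = ennreal \<bar>det V\<bar> * (\<integral>\<^sup>+x. ennreal (\<phi> (h + V *v x)) * indicator A (h + V *v x) \<partial>lborel)"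
    by (rule nn_integral_lborel_linear[OF _ dV]) measurable
  also have "\<dots> = (\<integral>\<^sup>+x. ennreal \<bar>det V\<bar> * (ennreal (\<phi> (h + V *v x)) * indicator A (h + V *v x)) \<partial>lborel)"
    by (rule nn_integral_cmult[symmetric]) measurable
  also have "\<dots> = (\<integral>\<^sup>+x. ennreal (gdens x) * indicator A (h + V *v x) \<partial>lborel)"
    by (simp only: mult.assoc[symmetric] ennreal_mult'[OF abs_ge_zero, symmetric] Vphi)
  also have "\<dots> = (\<integral>\<^sup>+x. indicator A (h + V *v x) \<partial>std_gauss)"
    by (subst nn_integral_std_gauss) simp_all
  also have "\<dots> = (\<integral>\<^sup>+x. indicator A x \<partial>distr std_gauss borel (\<lambda>x. h + V *v x))"
    by (subst nn_integral_distr) simp_all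
  also have "\<dots> = emeasure (distr std_gauss borel (\<lambda>x. h + V *v x)) A"
    by (rule nn_integral_indicator) simp
  finally show "emeasure (gauss h (matrix_inv J)) A = emeasure (distr std_gauss borel (\<lambda>x. h + V *v x)) A" .
qed

section \<open>Upper bound for the Gaussian constant\<close>

lemma tv_norm_commute: "sets M = sets N \<Longrightarrow> tv_norm M N = tv_norm N M"
  unfolding tv_norm_def by (simp add: abs_minus_commute)

text \<open>In dimension m, q times a standard Gaussian vector has density q^(-m) gdens(y/q); the
  comparison is stated after multiplying by q^m. The logarithm of the ratio is affine in |y|^2, so
  the order of the densities changes at most once, where |y|^2 (1 - 1/q^2) = 2 m ln q.\<close>

lemma Gaussian_scale_crossing:
  assumes q: "1 \<le> q"
  obtains c where "0 \<le> c"
    "\<And>y::'b::euclidean_space. norm y \<le> c \<Longrightarrow> gdens ((1 / q) *\<^sub>R y) \<le> q ^ DIM('b) * gdens y"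
    "\<And>y::'b. c < norm y \<Longrightarrow> q ^ DIM('b) * gdens y \<le> gdens ((1 / q) *\<^sub>R y)"
proof -
  let ?m = "real DIM('b)"
  have q0: "0 < q" using q by simp
  have key: "gdens ((1 / q) *\<^sub>R y) \<le> q ^ DIM('b) * gdens y \<longleftrightarrow> (norm y)\<^sup>2 * (1 - 1 / q\<^sup>2) \<le> 2 * ?m * ln q"
    "q ^ DIM('b) * gdens y \<le> gdens ((1 / q) *\<^sub>R y) \<longleftrightarrow> 2 * ?m * ln q \<le> (norm y)\<^sup>2 * (1 - 1 / q\<^sup>2)" for y :: 'b
  proof -
    have e: "q ^ DIM('b) = exp (?m * ln q)" using q0 by (simp add: exp_of_nat_mult)
    have 1: "q ^ DIM('b) * gdens y = exp (?m * ln q + - (norm y)\<^sup>2 / 2) / sqrt ((2 * pi) ^ DIM('b))"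
      unfolding e gdens_def exp_add by simp
    have 2: "gdens ((1 / q) *\<^sub>R y) = exp (- ((norm y)\<^sup>2 / q\<^sup>2) / 2) / sqrt ((2 * pi) ^ DIM('b))"
      using q0 by (simp add: gdens_def power_mult_distrib power_divide)
    have cancel: "a / sqrt ((2 * pi) ^ DIM('b)) \<le> b / sqrt ((2 * pi) ^ DIM('b)) \<longleftrightarrow> a \<le> b" for a b
    proof -
      have "a / S \<le> b / S \<longleftrightarrow> a \<le> b" if "0 < S" for S :: real using that by (simp add: divide_le_cancel)
      then show ?thesis by simp
    qed
    show "gdens ((1 / q) *\<^sub>R y) \<le> q ^ DIM('b) * gdens y \<longleftrightarrow> (norm y)\<^sup>2 * (1 - 1 / q\<^sup>2) \<le> 2 * ?m * ln q"
      unfolding 1 2 cancel exp_le_cancel_iff by (simp add: algebra_simps)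
    show "q ^ DIM('b) * gdens y \<le> gdens ((1 / q) *\<^sub>R y) \<longleftrightarrow> 2 * ?m * ln q \<le> (norm y)\<^sup>2 * (1 - 1 / q\<^sup>2)"
      unfolding 1 2 cancel exp_le_cancel_iff by (simp add: algebra_simps)
  qed
  show ?thesis
  proof (cases "q = 1")
    case True
    \<comment> \<open>For q = 1 the two densities coincide and any radius serves; the general
      formula would divide by zero.\<close>
    show ?thesis by (rule that[of 0]) (auto simp: key True)
  next
    case False
    then have d: "0 < 1 - 1 / q\<^sup>2" using q by (simp add: field_simps)
    define c where "c = sqrt (2 * ?m * ln q / (1 - 1 / q\<^sup>2))"
    have arg: "0 \<le> 2 * ?m * ln q / (1 - 1 / q\<^sup>2)" using d q by (intro divide_nonneg_pos) auto
    have c0: "0 \<le> c" using arg by (simp add: c_def)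
    have c2: "c\<^sup>2 * (1 - 1 / q\<^sup>2) = 2 * ?m * ln q"
    proof -
      have "X / D * D = X" if "0 < D" for X D :: real using that by simp
      from this[OF d] show ?thesis unfolding c_def real_sqrt_pow2[OF arg] .
    qed
    show ?thesis
    proof (rule that[OF c0])
      fix y :: 'b assume "norm y \<le> c"
      then have "(norm y)\<^sup>2 \<le> c\<^sup>2" by (intro power_mono) auto
      then show "gdens ((1 / q) *\<^sub>R y) \<le> q ^ DIM('b) * gdens y"
        unfolding key c2[symmetric] using d by (intro mult_right_mono) auto
    next
      fix y :: 'b assume "c < norm y"
      then have "c\<^sup>2 \<le> (norm y)\<^sup>2" using c0 by (intro power_mono) auto
      then show "q ^ DIM('b) * gdens y \<le> gdens ((1 / q) *\<^sub>R y)"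
        unfolding key c2[symmetric] using d by (intro mult_right_mono) auto
    qed
  qed
qed

lemma emeasure_std_gauss_scale:
  fixes C :: "'b::euclidean_space set"
  assumes q: "0 < q" and C [measurable]: "C \<in> sets borel"
  shows "ennreal (q ^ DIM('b)) * emeasure std_gauss ((\<lambda>x. q *\<^sub>R x) -` C) = (\<integral>\<^sup>+y. ennreal (gdens ((1 / q) *\<^sub>R y)) * indicator C y \<partial>lborel)"
proof -
  have "(\<integral>\<^sup>+y. ennreal (gdens ((1 / q) *\<^sub>R y)) * indicator C y \<partial>lborel) =
     (\<integral>\<^sup>+y. ennreal (gdens ((1 / q) *\<^sub>R y)) * indicator C y \<partial>density (distr lborel borel (\<lambda>x. 0 + q *\<^sub>R x)) (\<lambda>_. \<bar>q\<bar> ^ DIM('b)))"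
    using lborel_affine[of q "0::'b"] q by simp
  also have "\<dots> = (\<integral>\<^sup>+x. ennreal (q ^ DIM('b)) * (ennreal (gdens x) * indicator ((\<lambda>x. q *\<^sub>R x) -` C) x) \<partial>lborel)"
    using q by (subst nn_integral_density; (subst nn_integral_distr)?) (auto simp: indicator_def)
  also have "\<dots> = ennreal (q ^ DIM('b)) * (\<integral>\<^sup>+x. ennreal (gdens x) * indicator ((\<lambda>x. q *\<^sub>R x) -` C) x \<partial>lborel)"
    by (rule nn_integral_cmult) (use measurable_sets_borel[of "\<lambda>x. q *\<^sub>R x" borel C] in measurable)
  also have "(\<integral>\<^sup>+x. ennreal (gdens x) * indicator ((\<lambda>x. q *\<^sub>R x) -` C) x \<partial>lborel) = emeasure std_gauss ((\<lambda>x. q *\<^sub>R x) -` C)"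
    unfolding std_gauss_def by (subst emeasure_density) (use measurable_sets_borel[of "\<lambda>x. q *\<^sub>R x" borel C] in auto)
  finally show ?thesis ..
qed

text \<open>The scaling kernel sends the source to a Gaussian with the same centre as the target and
  r times its covariance. The two laws differ in spread only, so their distance does not depend on
  \<open>h\<close> and the supremum over \<open>h\<close> costs nothing.\<close>

lemma D_const_le:
  fixes J V :: "real^'m^'m"
  assumes V: "\<And>x y. (V *v x) \<bullet> (J *v (V *v y)) = x \<bullet> y" and r: "1 \<le> r"
  obtains c where "0 \<le> c" "D_const r (matrix_inv J) \<le>
    ereal (2 * (measure std_gauss (cball (0::real^'m) c) - measure std_gauss (cball (0::real^'m) (c / sqrt r))))"
proof -
  define q where "q = sqrt r"
  have q1: "1 \<le> q" using r by (simp add: q_def)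
  then have q0: "0 < q" by simp
  obtain c where c: "0 \<le> c"
    "\<And>y::real^'m. norm y \<le> c \<Longrightarrow> gdens ((1 / q) *\<^sub>R y) \<le> q ^ DIM(real^'m) * gdens y"
    "\<And>y::real^'m. c < norm y \<Longrightarrow> q ^ DIM(real^'m) * gdens y \<le> gdens ((1 / q) *\<^sub>R y)"
    using Gaussian_scale_crossing[OF q1] by metis
  have scale_le: "measure std_gauss ((\<lambda>x. q *\<^sub>R x) -` C) \<le> measure std_gauss C"
    if C [measurable]: "C \<in> sets borel" and sub: "C \<subseteq> cball 0 c" for C :: "(real^'m) set"
  proof -
    have "ennreal (q ^ DIM(real^'m)) * emeasure std_gauss ((\<lambda>x. q *\<^sub>R x) -` C)
       \<le> (\<integral>\<^sup>+y. ennreal (q ^ DIM(real^'m)) * (ennreal (gdens y) * indicator C y) \<partial>lborel)"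
      unfolding emeasure_std_gauss_scale[OF q0 C] using c(2) sub q0
      by (intro nn_integral_mono) (auto simp: indicator_def ennreal_mult'[symmetric] intro!: ennreal_leI)
    also have "\<dots> = ennreal (q ^ DIM(real^'m)) * emeasure std_gauss C"
      unfolding std_gauss_def by (simp add: nn_integral_cmult emeasure_density)
    finally have "ennreal (q ^ DIM(real^'m) * measure std_gauss ((\<lambda>x. q *\<^sub>R x) -` C)) \<le> ennreal (q ^ DIM(real^'m) * measure std_gauss C)"
      using q0 by (simp add: std_gauss.emeasure_eq_measure ennreal_mult')
    then show ?thesis using q0 by (simp add: ennreal_le_iff)
  qed
  have scale_ge: "measure std_gauss C \<le> measure std_gauss ((\<lambda>x. q *\<^sub>R x) -` C)"
    if C [measurable]: "C \<in> sets borel" and sub: "C \<inter> cball 0 c = {}" for C :: "(real^'m) set"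
  proof -
    have gt: "c < norm y" if "y \<in> C" for y using that sub by (force simp: disjoint_iff)
    have "ennreal (q ^ DIM(real^'m)) * emeasure std_gauss C = (\<integral>\<^sup>+y. ennreal (q ^ DIM(real^'m)) * (ennreal (gdens y) * indicator C y) \<partial>lborel)"
      unfolding std_gauss_def by (simp add: nn_integral_cmult emeasure_density)
    also have "\<dots> \<le> ennreal (q ^ DIM(real^'m)) * emeasure std_gauss ((\<lambda>x. q *\<^sub>R x) -` C)"
      unfolding emeasure_std_gauss_scale[OF q0 C] using c(3)[OF gt] q0
      by (intro nn_integral_mono) (auto simp: indicator_def ennreal_mult'[symmetric] intro!: ennreal_leI)
    finally have "ennreal (q ^ DIM(real^'m) * measure std_gauss C) \<le> ennreal (q ^ DIM(real^'m) * measure std_gauss ((\<lambda>x. q *\<^sub>R x) -` C))"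
      using q0 by (simp add: std_gauss.emeasure_eq_measure ennreal_mult')
    then show ?thesis using q0 by (simp add: ennreal_le_iff)
  qed
  let ?\<Lambda> = "\<lambda>x::real^'m. return borel (q *\<^sub>R x)"
  have \<Lambda>: "?\<Lambda> \<in> markov_kernels borel borel" unfolding markov_kernels_def by measurable
  have bound: "tv_norm (gauss h (matrix_inv J) \<bind> ?\<Lambda>) (gauss (sqrt r *\<^sub>R h) (matrix_inv J)) \<le>
     ereal (2 * (measure std_gauss (cball (0::real^'m) c) - measure std_gauss (cball (0::real^'m) (c / sqrt r))))" for h
  proof -
    define W where "W = matrix_inv V"
    define h' where "h' = q *\<^sub>R h"
    define S where "S = distr std_gauss borel (\<lambda>x. h' + V *v (q *\<^sub>R x))"
    define Tm where "Tm = distr std_gauss borel (\<lambda>x. h' + V *v x)"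
    have WV: "W *v (V *v x) = x" for x
      unfolding W_def by (simp only: matrix_vector_mul_assoc matrix_inv_inverse[OF conjugate_basis_identities(2)[OF V]] matrix_vector_mul_lid)
    have src: "gauss h (matrix_inv J) \<bind> ?\<Lambda> = S"
    proof -
      have "gauss h (matrix_inv J) \<bind> ?\<Lambda> = distr (gauss h (matrix_inv J)) borel (\<lambda>x. q *\<^sub>R x)"
        unfolding gauss_eq_distr[OF V] by (rule bind_return_distr') simp_all
      also have "\<dots> = S"
        unfolding gauss_eq_distr[OF V] S_def h'_def
        by (subst distr_distr) (auto simp: comp_def scaleR_right_distrib matrix_vector_mult_scaleR)
      finally show ?thesis .
    qed
    have tgt: "gauss (sqrt r *\<^sub>R h) (matrix_inv J) = Tm"
      unfolding gauss_eq_distr[OF V] Tm_def h'_def q_def ..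
    \<comment> \<open>The Hahn set: the crossing ball, carried to an ellipsoid about the common
      centre \<open>h'\<close>. Inside it the narrower law \<open>Tm\<close> has the larger
      density.\<close>
    let ?A = "{w. W *v (w - h') \<in> cball 0 c}"
    have Am: "?A \<in> sets borel"
      using measurable_sets_borel[of "\<lambda>w. W *v (w - h')" borel "cball 0 c"] by (simp add: vimage_def)
    have mS: "measure S B = measure std_gauss ((\<lambda>x. q *\<^sub>R x) -` ((\<lambda>x. h' + V *v x) -` B))" if "B \<in> sets borel" for B
      unfolding S_def using that by (subst measure_distr) (auto simp: vimage_def)
    have mT: "measure Tm B = measure std_gauss ((\<lambda>x. h' + V *v x) -` B)" if "B \<in> sets borel" for B
      unfolding Tm_def using that by (subst measure_distr) auto
    have vB: "(\<lambda>x. h' + V *v x) -` B \<in> sets borel" if "B \<in> sets borel" for B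
      using measurable_sets_borel[of "\<lambda>x. h' + V *v x" borel B] that by simp
    have "tv_norm Tm S \<le> ereal (2 * (measure Tm ?A - measure S ?A))"
    proof (rule tv_norm_le_Hahn)
      show "prob_space Tm" "prob_space S" unfolding Tm_def S_def by (auto intro!: std_gauss.prob_space_distr)
      show "sets Tm = sets S" "?A \<in> sets Tm" using Am by (simp_all add: Tm_def S_def)
      fix B assume "B \<in> sets Tm"
      then have B: "B \<in> sets borel" by (simp add: Tm_def)
      show "measure S B \<le> measure Tm B" if "B \<subseteq> ?A"
        unfolding mS[OF B] mT[OF B] using that by (intro scale_le vB B) (auto simp: WV)
      show "measure Tm B \<le> measure S B" if "B \<inter> ?A = {}"
        unfolding mS[OF B] mT[OF B] using that by (intro scale_ge vB B) (auto simp: WV disjoint_iff)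
    qed
    also have "measure Tm ?A = measure std_gauss (cball (0::real^'m) c)"
      unfolding mT[OF Am] by (intro arg_cong[where f="measure std_gauss"]) (auto simp: WV)
    also have "measure S ?A = measure std_gauss (cball (0::real^'m) (c / sqrt r))"
      unfolding mS[OF Am] q_def[symmetric] using q0
      by (intro arg_cong[where f="measure std_gauss"]) (auto simp: WV field_simps)
    finally show ?thesis unfolding src tgt by (subst tv_norm_commute) (simp_all add: S_def Tm_def)
  qed
  have "D_const r (matrix_inv J) \<le> ereal (2 * (measure std_gauss (cball (0::real^'m) c) - measure std_gauss (cball (0::real^'m) (c / sqrt r))))"
    unfolding D_const_def by (rule INF_lower2[OF \<Lambda>], rule SUP_least, rule bound)
  then show ?thesis using c(1) that by blast
qed

section \<open>Products of close measures\<close>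

lemma integrable_mult_squares:
  fixes f g :: "'a \<Rightarrow> real"
  assumes [measurable]: "f \<in> borel_measurable M" "g \<in> borel_measurable M"
    and int: "integrable M (\<lambda>x. (f x)\<^sup>2)" "integrable M (\<lambda>x. (g x)\<^sup>2)"
  shows "integrable M (\<lambda>x. f x * g x)"
proof (rule Bochner_Integration.integrable_bound)
  show "integrable M (\<lambda>x. (f x)\<^sup>2 + (g x)\<^sup>2)" using int by simp
  have "\<bar>a * b\<bar> \<le> a\<^sup>2 + b\<^sup>2" for a b :: real
  proof -
    have "2 * (\<bar>a\<bar> * \<bar>b\<bar>) \<le> a\<^sup>2 + b\<^sup>2" using zero_le_power2[of "\<bar>a\<bar> - \<bar>b\<bar>"] by (simp add: power2_diff)
    moreover have "0 \<le> \<bar>a\<bar> * \<bar>b\<bar>" by simp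
    ultimately show ?thesis unfolding abs_mult by linarith
  qed
  then show "AE x in M. norm (f x * g x) \<le> norm ((f x)\<^sup>2 + (g x)\<^sup>2)" by simp
qed measurable

lemma powM_density:
  assumes \<nu>: "sigma_finite_measure \<nu>" and f [measurable]: "f \<in> borel_measurable \<nu>"
    and P: "prob_space (density \<nu> f)"
  shows "powM (density \<nu> f) n = density (powM \<nu> n) (\<lambda>x. \<Prod>i<n. f (x i))"
proof -
  interpret N: product_sigma_finite "\<lambda>_::nat. \<nu>" using \<nu> by (simp add: product_sigma_finite_def)
  interpret P: product_sigma_finite "\<lambda>_::nat. density \<nu> f"
    using P by (simp add: product_sigma_finite_def prob_space_imp_sigma_finite)
  show ?thesis unfolding powM_def
  proof (rule P.PiM_eqI[symmetric])
    show "sets (density (Pi\<^sub>M {..<n} (\<lambda>_. \<nu>)) (\<lambda>x. \<Prod>i<n. f (x i))) = sets (Pi\<^sub>M {..<n} (\<lambda>_. density \<nu> f))"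
      by (simp cong: sets_PiM_cong)
    fix A assume A: "\<And>i. i \<in> {..<n} \<Longrightarrow> A i \<in> sets (density \<nu> f)"
    then have A' [measurable]: "i < n \<Longrightarrow> A i \<in> sets \<nu>" for i by auto
    have m: "Pi\<^sub>E {..<n} A \<in> sets (Pi\<^sub>M {..<n} (\<lambda>_. \<nu>))" using A by (intro sets_PiM_I_finite) auto
    have "emeasure (density (Pi\<^sub>M {..<n} (\<lambda>_. \<nu>)) (\<lambda>x. \<Prod>i<n. f (x i))) (Pi\<^sub>E {..<n} A)
       = (\<integral>\<^sup>+x. (\<Prod>i<n. f (x i)) * indicator (Pi\<^sub>E {..<n} A) x \<partial>(Pi\<^sub>M {..<n} (\<lambda>_. \<nu>)))"
      using m by (simp add: emeasure_density)
    also have "\<dots> = (\<integral>\<^sup>+x. (\<Prod>i<n. f (x i) * indicator (A i) (x i)) \<partial>(Pi\<^sub>M {..<n} (\<lambda>_. \<nu>)))"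
    proof (rule nn_integral_cong)
      fix x assume "x \<in> space (Pi\<^sub>M {..<n} (\<lambda>_. \<nu>))"
      then have "indicator (Pi\<^sub>E {..<n} A) x = (\<Prod>i<n. indicator (A i) (x i) :: ennreal)"
        by (auto simp: space_PiM PiE_iff indicator_def prod_zero_iff)
      then show "(\<Prod>i<n. f (x i)) * indicator (Pi\<^sub>E {..<n} A) x = (\<Prod>i<n. f (x i) * indicator (A i) (x i))"
        by (simp add: prod.distrib)
    qed
    also have "\<dots> = (\<Prod>i<n. \<integral>\<^sup>+x. f x * indicator (A i) x \<partial>\<nu>)"
      by (rule N.product_nn_integral_prod) auto
    also have "\<dots> = (\<Prod>i<n. emeasure (density \<nu> f) (A i))"
      by (intro prod.cong) (simp_all add: emeasure_density)
    finally show "emeasure (density (Pi\<^sub>M {..<n} (\<lambda>_. \<nu>)) (\<lambda>x. \<Prod>i<n. f (x i))) (Pi\<^sub>E {..<n} A) =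
        (\<Prod>i<n. emeasure (density \<nu> f) (A i))" .
  qed simp
qed

lemma sets_powM_cong: "sets M = sets N \<Longrightarrow> sets (powM M n) = sets (powM N n)"
  unfolding powM_def by (rule sets_PiM_cong) auto

lemma prob_space_powM: "prob_space M \<Longrightarrow> prob_space (powM M n)"
  unfolding powM_def by (rule prob_space_PiM) auto

text \<open>The affinity \<open>\<integral> \<surd>(p q)\<close> is multiplicative under products, so the squared Hellinger distance grows at most
  linearly in the number of factors.\<close>

lemma powM_Hellinger_bound:
  assumes p [measurable]: "p \<in> borel_measurable \<mu>" and q [measurable]: "q \<in> borel_measurable \<mu>"
    and p0: "\<And>x. 0 \<le> p x" and q0: "\<And>x. 0 \<le> q x"
    and P: "prob_space (density \<mu> (\<lambda>x. ennreal (p x)))" and Q: "prob_space (density \<mu> (\<lambda>x. ennreal (q x)))"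
    and F: "F \<in> borel_measurable (powM \<mu> n)" and F01: "\<And>x. x \<in> space (powM \<mu> n) \<Longrightarrow> 0 \<le> F x" "\<And>x. x \<in> space (powM \<mu> n) \<Longrightarrow> F x \<le> 1"
    and H: "(\<integral>\<^sup>+x. ennreal ((sqrt (p x) - sqrt (q x))\<^sup>2) \<partial>\<mu>) \<le> ennreal \<epsilon>" and \<epsilon>: "0 \<le> \<epsilon>"
    and \<delta>: "0 < \<delta>" "real n * \<epsilon> \<le> \<delta>\<^sup>2"
  shows "\<bar>(\<integral>x. F x \<partial>powM (density \<mu> (\<lambda>x. ennreal (p x))) n) - (\<integral>x. F x \<partial>powM (density \<mu> (\<lambda>x. ennreal (q x))) n)\<bar> \<le> 2 * \<delta>"
proof -
  \<comment> \<open>\<open>\<mu>\<close> is not assumed sigma-finite, so its product is not a usable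
    reference measure. Both laws are rewritten as densities with respect to the finite measure whose
    density is p + q.\<close>
  define w where "w x = p x + q x" for x
  have w0: "0 \<le> w x" for x using p0[of x] q0[of x] by (simp add: w_def)
  have [measurable]: "w \<in> borel_measurable \<mu>" unfolding w_def by measurable
  define \<nu> where "\<nu> = density \<mu> (\<lambda>x. ennreal (w x))"
  define a where "a x = p x / w x" for x
  define b where "b x = q x / w x" for x
  have [measurable]: "a \<in> borel_measurable \<mu>" "b \<in> borel_measurable \<mu>" unfolding a_def b_def by measurable
  have sets\<nu> [measurable_cong]: "sets \<nu> = sets \<mu>" by (simp add: \<nu>_def)
  have [measurable]: "a \<in> borel_measurable \<nu>" "b \<in> borel_measurable \<nu>"
    unfolding measurable_cong_sets[OF sets\<nu> refl] by measurable
  have a0: "0 \<le> a x" and b0: "0 \<le> b x" for x using p0 q0 w0 by (auto simp: a_def b_def)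
  \<comment> \<open>Where \<open>w\<close> vanishes, so do \<open>p\<close> and \<open>q\<close>;
    division by zero returns 0, so the identities hold there as well.\<close>
  have wa: "w x * a x = p x" and wb: "w x * b x = q x" for x
    using p0[of x] q0[of x] by (cases "w x = 0"; simp add: a_def b_def w_def)+
  have dP: "density \<mu> (\<lambda>x. ennreal (p x)) = density \<nu> (\<lambda>x. ennreal (a x))"
    unfolding \<nu>_def using w0 a0 by (subst density_density_eq) (simp_all add: ennreal_mult[symmetric] wa)
  have dQ: "density \<mu> (\<lambda>x. ennreal (q x)) = density \<nu> (\<lambda>x. ennreal (b x))"
    unfolding \<nu>_def using w0 b0 by (subst density_density_eq) (simp_all add: ennreal_mult[symmetric] wb)
  have ia: "(\<integral>\<^sup>+x. ennreal (a x) \<partial>\<nu>) = 1"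
    using prob_space.emeasure_space_1[OF P] unfolding dP by (simp add: emeasure_density)
  have ib: "(\<integral>\<^sup>+x. ennreal (b x) \<partial>\<nu>) = 1"
    using prob_space.emeasure_space_1[OF Q] unfolding dQ by (simp add: emeasure_density)
  have "finite_measure \<nu>"
  proof
    have "emeasure \<nu> (space \<nu>) = (\<integral>\<^sup>+x. ennreal (p x) + ennreal (q x) \<partial>\<mu>)"
      unfolding \<nu>_def w_def using p0 q0 by (simp add: emeasure_density ennreal_plus[symmetric] del: ennreal_plus)
    also have "\<dots> = (\<integral>\<^sup>+x. ennreal (p x) \<partial>\<mu>) + (\<integral>\<^sup>+x. ennreal (q x) \<partial>\<mu>)"
      by (rule nn_integral_add) simp_all
    also have "\<dots> = 1 + 1"
      using prob_space.emeasure_space_1[OF P] prob_space.emeasure_space_1[OF Q] by (simp add: emeasure_density)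
    finally show "emeasure \<nu> (space \<nu>) \<noteq> \<infinity>" by simp
  qed
  then interpret \<nu>: finite_measure \<nu> .
  interpret N: product_sigma_finite "\<lambda>_::nat. \<nu>" by standard
  let ?\<pi> = "powM \<nu> n"
  have sets\<pi> [measurable_cong]: "sets ?\<pi> = sets (powM \<mu> n)" by (rule sets_powM_cong[OF sets\<nu>])
  have Fm [measurable]: "F \<in> borel_measurable ?\<pi>" using F by (simp only: measurable_cong_sets[OF sets\<pi> refl])
  note F01 = F01[folded sets_eq_imp_space_eq[OF sets\<pi>]]
  define \<alpha> where "\<alpha> x = (\<Prod>i<n. a (x i))" for x
  define \<beta> where "\<beta> x = (\<Prod>i<n. b (x i))" for x
  define \<gamma> where "\<gamma> x = (\<Prod>i<n. sqrt (a (x i) * b (x i)))" for x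
  have [measurable]: "\<alpha> \<in> borel_measurable ?\<pi>" "\<beta> \<in> borel_measurable ?\<pi>" "\<gamma> \<in> borel_measurable ?\<pi>"
    unfolding \<alpha>_def \<beta>_def \<gamma>_def powM_def by measurable
  have \<alpha>0: "0 \<le> \<alpha> x" and \<beta>0: "0 \<le> \<beta> x" for x
    using a0 b0 by (auto simp: \<alpha>_def \<beta>_def intro!: prod_nonneg)
  have pP: "powM (density \<mu> (\<lambda>x. ennreal (p x))) n = density ?\<pi> (\<lambda>x. ennreal (\<alpha> x))"
    using P unfolding dP \<alpha>_def using a0
    by (subst powM_density) (auto simp: \<nu>.sigma_finite_measure_axioms prod_ennreal)
  have pQ: "powM (density \<mu> (\<lambda>x. ennreal (q x))) n = density ?\<pi> (\<lambda>x. ennreal (\<beta> x))"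
    using Q unfolding dQ \<beta>_def using b0
    by (subst powM_density) (auto simp: \<nu>.sigma_finite_measure_axioms prod_ennreal)
  have inta: "integrable \<nu> a" "integral\<^sup>L \<nu> a = 1"
    using ia a0 by (auto intro!: integrableI_nonneg simp: integral_eq_nn_integral)
  have intb: "integrable \<nu> b" "integral\<^sup>L \<nu> b = 1"
    using ib b0 by (auto intro!: integrableI_nonneg simp: integral_eq_nn_integral)
  have sq_le: "sqrt (s * t) \<le> s + t" if "0 \<le> s" "0 \<le> t" for s t :: real
    using that by (intro real_le_lsqrt) (auto simp: power2_eq_square algebra_simps)
  have intab: "integrable \<nu> (\<lambda>x. sqrt (a x * b x))"
    by (rule Bochner_Integration.integrable_bound[where f="\<lambda>x. a x + b x"])
       (use inta intb a0 b0 sq_le in auto)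
  define \<rho> where "\<rho> = (\<integral>x. sqrt (a x * b x) \<partial>\<nu>)"
  have int\<alpha>: "integrable ?\<pi> \<alpha>" "integral\<^sup>L ?\<pi> \<alpha> = 1"
    using N.product_integrable_prod[of "{..<n}" "\<lambda>_. a"] N.product_integral_prod[of "{..<n}" "\<lambda>_. a"] inta
    by (simp_all add: \<alpha>_def[abs_def] powM_def)
  have int\<beta>: "integrable ?\<pi> \<beta>" "integral\<^sup>L ?\<pi> \<beta> = 1"
    using N.product_integrable_prod[of "{..<n}" "\<lambda>_. b"] N.product_integral_prod[of "{..<n}" "\<lambda>_. b"] intb
    by (simp_all add: \<beta>_def[abs_def] powM_def)
  have int\<gamma>: "integrable ?\<pi> \<gamma>" "integral\<^sup>L ?\<pi> \<gamma> = \<rho> ^ n"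
    using N.product_integrable_prod[of "{..<n}" "\<lambda>_ x. sqrt (a x * b x)"]
      N.product_integral_prod[of "{..<n}" "\<lambda>_ x. sqrt (a x * b x)"] intab
    by (simp_all add: \<gamma>_def[abs_def] powM_def \<rho>_def)
  have sqrt_prod: "sqrt (\<Prod>i<j. f i) = (\<Prod>i<j. sqrt (f i))" for f :: "nat \<Rightarrow> real" and j
    by (induction j) (auto simp: real_sqrt_mult)
  have \<gamma>: "\<gamma> x = sqrt (\<alpha> x) * sqrt (\<beta> x)" for x
    by (simp add: \<gamma>_def \<alpha>_def \<beta>_def real_sqrt_mult prod.distrib sqrt_prod)
  have \<rho>0: "0 \<le> \<rho>" unfolding \<rho>_def using a0 b0 by (intro integral_nonneg_AE) auto
  have "2 - 2 * \<rho> = (\<integral>x. (sqrt (a x) - sqrt (b x))\<^sup>2 \<partial>\<nu>)"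
  proof -
    have "(\<lambda>x. (sqrt (a x) - sqrt (b x))\<^sup>2) = (\<lambda>x. a x + b x - 2 * sqrt (a x * b x))"
      using a0 b0 by (auto simp: power2_diff real_sqrt_mult)
    then show ?thesis using inta intb intab by (simp add: \<rho>_def)
  qed
  moreover have "ennreal (\<integral>x. (sqrt (a x) - sqrt (b x))\<^sup>2 \<partial>\<nu>) \<le> ennreal \<epsilon>"
  proof -
    have "integrable \<nu> (\<lambda>x. (sqrt (a x) - sqrt (b x))\<^sup>2)"
    proof -
      have "(\<lambda>x. (sqrt (a x) - sqrt (b x))\<^sup>2) = (\<lambda>x. a x + b x - 2 * sqrt (a x * b x))"
        using a0 b0 by (auto simp: power2_diff real_sqrt_mult)
      then show ?thesis using inta intb intab by simp
    qed
    then have "ennreal (\<integral>x. (sqrt (a x) - sqrt (b x))\<^sup>2 \<partial>\<nu>) = (\<integral>\<^sup>+x. ennreal ((sqrt (a x) - sqrt (b x))\<^sup>2) \<partial>\<nu>)"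
      by (intro nn_integral_eq_integral[symmetric]) auto
    also have "\<dots> = (\<integral>\<^sup>+x. ennreal (w x) * ennreal ((sqrt (a x) - sqrt (b x))\<^sup>2) \<partial>\<mu>)"
      unfolding \<nu>_def by (subst nn_integral_density) auto
    also have "\<dots> = (\<integral>\<^sup>+x. ennreal ((sqrt (p x) - sqrt (q x))\<^sup>2) \<partial>\<mu>)"
    proof (rule nn_integral_cong)
      fix x
      have "w x * (sqrt (a x) - sqrt (b x))\<^sup>2 = (sqrt (w x) * (sqrt (a x) - sqrt (b x)))\<^sup>2"
        using w0[of x] by (simp add: power_mult_distrib)
      also have "\<dots> = (sqrt (p x) - sqrt (q x))\<^sup>2"
        by (simp add: right_diff_distrib real_sqrt_mult[symmetric] wa wb)
      finally show "ennreal (w x) * ennreal ((sqrt (a x) - sqrt (b x))\<^sup>2) = ennreal ((sqrt (p x) - sqrt (q x))\<^sup>2)"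
        using w0[of x] by (simp add: ennreal_mult[symmetric])
    qed
    finally show ?thesis using H by simp
  qed
  ultimately have \<rho>_ge: "2 - 2 * \<rho> \<le> \<epsilon>" using \<epsilon> by (auto simp: ennreal_le_iff)
  have "1 - real n * (1 - \<rho>) \<le> \<rho> ^ n"
    using Bernoulli_inequality[of "\<rho> - 1" n] \<rho>0 by (simp add: algebra_simps)
  moreover have "real n * (2 - 2 * \<rho>) \<le> real n * \<epsilon>" using \<rho>_ge by (intro mult_left_mono) auto
  ultimately have aff: "2 - 2 * \<rho> ^ n \<le> \<delta>\<^sup>2" using \<delta>(2) by (simp add: algebra_simps)
  \<comment> \<open>The difference of the densities factors into the difference and the sum of their
    square roots. Splitting this product by the arithmetic-geometric mean inequality with weight
    \<open>\<delta>\<close> makes each term integrate to at most \<open>\<delta>\<close>: the first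
    carries a squared Hellinger distance of at most \<open>\<delta>\<^sup>2\<close>, the second a
    mass of 4 times \<open>\<delta> / 4\<close>.\<close>
  have pt: "\<bar>\<alpha> x * F x - \<beta> x * F x\<bar> \<le> (1 / \<delta>) * (\<alpha> x + \<beta> x - 2 * \<gamma> x) + (\<delta> / 4) * (2 * (\<alpha> x + \<beta> x))"
    if x: "x \<in> space ?\<pi>" for x
  proof -
    let ?s = "sqrt (\<alpha> x)" and ?t = "sqrt (\<beta> x)"
    have st: "\<alpha> x = ?s\<^sup>2" "\<beta> x = ?t\<^sup>2" "?s \<ge> 0" "?t \<ge> 0" using \<alpha>0 \<beta>0 by auto
    have "\<bar>\<alpha> x * F x - \<beta> x * F x\<bar> = \<bar>\<alpha> x - \<beta> x\<bar> * F x"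
      using F01(1)[OF x] by (simp add: left_diff_distrib[symmetric] abs_mult)
    also have "\<dots> \<le> \<bar>\<alpha> x - \<beta> x\<bar>" using F01[OF x] by (intro mult_left_le) auto
    also have "\<dots> = \<bar>?s - ?t\<bar> * (?s + ?t)"
    proof -
      have "\<alpha> x - \<beta> x = (?s - ?t) * (?s + ?t)" using st by (simp add: algebra_simps power2_eq_square)
      then show ?thesis using st by (simp add: abs_mult)
    qed
    also have "\<dots> \<le> (1 / \<delta>) * (?s - ?t)\<^sup>2 + (\<delta> / 4) * (?s + ?t)\<^sup>2"
    proof -
      have "0 \<le> (\<bar>?s - ?t\<bar> / sqrt \<delta> - sqrt \<delta> / 2 * (?s + ?t))\<^sup>2" by simp
      also have "\<dots> = (1 / \<delta>) * (?s - ?t)\<^sup>2 + (\<delta> / 4) * (?s + ?t)\<^sup>2 - \<bar>?s - ?t\<bar> * (?s + ?t)"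
        using \<delta>(1) by (simp add: power2_diff power_divide power_mult_distrib)
      finally show ?thesis by simp
    qed
    also have "(?s - ?t)\<^sup>2 = \<alpha> x + \<beta> x - 2 * \<gamma> x" using st by (simp add: power2_diff \<gamma>)
    also have "(?s + ?t)\<^sup>2 \<le> 2 * (\<alpha> x + \<beta> x)"
    proof -
      have "0 \<le> (?s - ?t)\<^sup>2" by simp
      then show ?thesis using st by (simp add: power2_diff power2_sum)
    qed
    finally show ?thesis using \<delta>(1) by (simp add: mult_left_mono)
  qed
  have iF: "integrable ?\<pi> (\<lambda>x. \<alpha> x * F x)" "integrable ?\<pi> (\<lambda>x. \<beta> x * F x)"
    by (rule Bochner_Integration.integrable_bound[OF int\<alpha>(1)];
        use \<alpha>0 F01 in \<open>auto simp: abs_mult intro!: mult_left_le\<close>)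
       (rule Bochner_Integration.integrable_bound[OF int\<beta>(1)];
        use \<beta>0 F01 in \<open>auto simp: abs_mult intro!: mult_left_le\<close>)
  have "\<bar>(\<integral>x. F x \<partial>powM (density \<mu> (\<lambda>x. ennreal (p x))) n) - (\<integral>x. F x \<partial>powM (density \<mu> (\<lambda>x. ennreal (q x))) n)\<bar>
     = \<bar>\<integral>x. \<alpha> x * F x - \<beta> x * F x \<partial>?\<pi>\<bar>"
    unfolding pP pQ using iF \<alpha>0 \<beta>0 by (simp add: integral_density)
  also have "\<dots> \<le> (\<integral>x. (1 / \<delta>) * (\<alpha> x + \<beta> x - 2 * \<gamma> x) + (\<delta> / 4) * (2 * (\<alpha> x + \<beta> x)) \<partial>?\<pi>)"
    by (rule order_trans[OF integral_abs_bound integral_mono]) (use iF int\<alpha> int\<beta> int\<gamma> pt in auto)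
  also have "\<dots> = (1 / \<delta>) * (2 - 2 * \<rho> ^ n) + \<delta>"
    using int\<alpha> int\<beta> int\<gamma> by simp
  also have "\<dots> \<le> (1 / \<delta>) * \<delta>\<^sup>2 + \<delta>" using aff \<delta>(1) by (intro add_right_mono mult_left_mono) auto
  also have "\<dots> = 2 * \<delta>" using \<delta>(1) by (simp add: power2_eq_square)
  finally show ?thesis .
qed

section \<open>Exponential tilting\<close>

text \<open>Powers of |s| in Taylor remainders are absorbed into exponential moments. The constant
  comes from cubing x/3 <= exp(x/3); the square is treated likewise.\<close>

lemma cube_le_exp: "x ^ 3 \<le> 27 * exp x" if "0 \<le> (x::real)"
proof -
  have "(x / 3) ^ 3 \<le> exp (x / 3) ^ 3"
  proof (rule power_mono)
    show "x / 3 \<le> exp (x / 3)" using exp_ge_add_one_self[of "x / 3"] by linarith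
  qed (use that in simp)
  also have "\<dots> = exp x" by (simp add: exp_of_nat_mult[symmetric])
  finally show ?thesis by (simp add: power_divide)
qed

lemma square_le_exp: "x ^ 2 \<le> 4 * exp x" if "0 \<le> (x::real)"
proof -
  have "(x / 2) ^ 2 \<le> exp (x / 2) ^ 2"
  proof (rule power_mono)
    show "x / 2 \<le> exp (x / 2)" using exp_ge_add_one_self[of "x / 2"] by linarith
  qed (use that in simp)
  also have "\<dots> = exp x" by (simp add: exp_of_nat_mult[symmetric])
  finally show ?thesis by (simp add: power_divide)
qed

locale exp_moments = prob_space P0 for P0 :: "'a measure" +
  fixes s :: "'a \<Rightarrow> 'b::euclidean_space"
  assumes s_meas [measurable]: "s \<in> borel_measurable P0"
    and exp_int: "\<And>h. integrable P0 (\<lambda>x. exp (h \<bullet> s x))"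
begin

text \<open>The hypothesis controls exponentials of linear forms only. Some coordinate of
  \<open>s x\<close> has modulus at least |s x| / m, where m is the dimension, so exp(R |s x|) is
  dominated by the finite sum of exponentials of the forms R m b and -R m b over the basis.\<close>

lemma exp_norm_int: 
  assumes "0 \<le> R"
  shows "integrable P0 (\<lambda>x. exp (R * norm (s x)))"
proof -
  let ?m = "real DIM('b)"
  let ?g = "\<lambda>x. \<Sum>b\<in>Basis. exp (((R * ?m) *\<^sub>R b) \<bullet> s x) + exp ((- (R * ?m) *\<^sub>R b) \<bullet> s x)"
  have le: "exp (R * norm (s x)) \<le> ?g x" for x
  proof -
    have "\<exists>b\<in>Basis. norm (s x) \<le> ?m * \<bar>s x \<bullet> b\<bar>"
    proof (rule ccontr)
      assume "\<not> ?thesis"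
      then have "\<And>b. b \<in> Basis \<Longrightarrow> \<bar>s x \<bullet> b\<bar> < norm (s x) / ?m" by (auto simp: not_le field_simps)
      then have "(\<Sum>b\<in>Basis. \<bar>s x \<bullet> b\<bar>) < (\<Sum>b\<in>(Basis::'b set). norm (s x) / ?m)"
        by (intro sum_strict_mono) auto
      then show False using norm_le_l1[of "s x"] by simp
    qed
    then obtain b where b: "b \<in> Basis" "norm (s x) \<le> ?m * \<bar>s x \<bullet> b\<bar>" by auto
    have "R * norm (s x) \<le> R * (?m * \<bar>s x \<bullet> b\<bar>)" using assms b by (intro mult_left_mono) auto
    then have "exp (R * norm (s x)) \<le> exp (R * (?m * \<bar>s x \<bullet> b\<bar>))" by simp
    also have "\<dots> \<le> exp (((R * ?m) *\<^sub>R b) \<bullet> s x) + exp ((- (R * ?m) *\<^sub>R b) \<bullet> s x)"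
      by (cases "s x \<bullet> b \<ge> 0") (auto simp: inner_commute mult.assoc)
    also have "\<dots> \<le> ?g x" by (rule member_le_sum[OF b(1)]) (auto intro: add_nonneg_nonneg)
    finally show ?thesis .
  qed
  have ig: "integrable P0 ?g" by (intro Bochner_Integration.integrable_sum Bochner_Integration.integrable_add exp_int)
  show ?thesis
  proof (rule Bochner_Integration.integrable_bound[OF ig])
    show "AE x in P0. norm (exp (R * norm (s x))) \<le> norm (?g x)"
      using order_trans[OF le abs_ge_self] by (intro AE_I2) simp
  qed measurable
qed

lemma inner_int: "integrable P0 (\<lambda>x. h \<bullet> s x)" and inner_sq_int: "integrable P0 (\<lambda>x. (h \<bullet> s x)\<^sup>2)"
proof -
  have i: "integrable P0 (\<lambda>x. 4 * exp ((norm h) * norm (s x)))"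
    by (intro integrable_mult_right exp_norm_int) auto
  have le: "\<bar>h \<bullet> s x\<bar> \<le> norm h * norm (s x)" for x by (rule Cauchy_Schwarz_ineq2)
  have sq: "(h \<bullet> s x)\<^sup>2 \<le> 4 * exp (norm h * norm (s x))" for x
  proof -
    have "(h \<bullet> s x)\<^sup>2 \<le> (norm h * norm (s x))\<^sup>2" using power_mono[OF le[of x], of 2] by simp
    also have "\<dots> \<le> 4 * exp (norm h * norm (s x))" by (intro square_le_exp) auto
    finally show ?thesis .
  qed
  have lin: "\<bar>h \<bullet> s x\<bar> \<le> 4 * exp (norm h * norm (s x))" for x
    using le[of x] exp_ge_add_one_self[of "norm h * norm (s x)"] exp_gt_zero[of "norm h * norm (s x)"] by linarith
  show "integrable P0 (\<lambda>x. h \<bullet> s x)"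
    by (rule Bochner_Integration.integrable_bound[OF i]) (use lin in auto)
  show "integrable P0 (\<lambda>x. (h \<bullet> s x)\<^sup>2)"
    by (rule Bochner_Integration.integrable_bound[OF i]) (use sq in auto)
qed

end

text \<open>The standardised score. Its two moment conditions fix the Taylor coefficients of first
  and second order of the transforms below.\<close>

locale exp_family = exp_moments P0 s for P0 :: "'a measure" and s :: "'a \<Rightarrow> 'b::euclidean_space" +
  assumes mean0: "\<And>h. expectation (\<lambda>x. h \<bullet> s x) = 0"
    and cov: "\<And>h. expectation (\<lambda>x. (h \<bullet> s x)\<^sup>2) = (norm h)\<^sup>2"
begin

text \<open>The complex factor \<open>c\<close> lets one expansion serve two purposes: c = 1 gives
  the moment generating function, hence the normaliser of the tilt, and c = i the characteristic
  function, hence the central limit theorem.\<close>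

definition F :: "complex \<Rightarrow> 'b \<Rightarrow> complex" where
  "F c h = (\<integral>x. exp (c * complex_of_real (h \<bullet> s x)) \<partial>P0)"

definition M :: "'b \<Rightarrow> real" where
  "M h = expectation (\<lambda>x. exp (h \<bullet> s x))"

lemma F_int:
  assumes "norm c = 1" shows "integrable P0 (\<lambda>x. exp (c * complex_of_real (h \<bullet> s x)))"
proof (rule Bochner_Integration.integrable_bound[OF exp_norm_int[of "norm h"]])
  have "norm (exp (c * complex_of_real (h \<bullet> s x))) \<le> exp (norm h * norm (s x))" for x
  proof -
    have "norm (exp (c * complex_of_real (h \<bullet> s x))) \<le> exp (norm (c * complex_of_real (h \<bullet> s x)))"
      by (rule norm_exp)
    also have "\<dots> \<le> exp (norm h * norm (s x))"
      using assms Cauchy_Schwarz_ineq2[of h "s x"] by (simp add: norm_mult)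
    finally show ?thesis .
  qed
  then show "AE x in P0. norm (exp (c * complex_of_real (h \<bullet> s x))) \<le> norm (exp (norm h * norm (s x)))" by simp
qed auto

text \<open>The remainder constant of \<open>F_expansion\<close>. The 27 comes from
  \<open>cube_le_exp\<close>, the 1/2 from the factorial in the Taylor bound, and the exponent 2 |s|
  from one exponential in that bound and a second one absorbing the cube.\<close>

definition C3 :: real where "C3 = 27 / 2 * expectation (\<lambda>x. exp (2 * norm (s x)))"

lemma C3_nonneg: "0 \<le> C3"
  by (simp add: C3_def)

lemma F_expansion:
  assumes c: "norm c = 1" and h: "norm h \<le> 1"
  shows "norm (F c h - (1 + c\<^sup>2 * complex_of_real ((norm h)\<^sup>2) / 2)) \<le> C3 * norm h ^ 3"
proof -
  let ?z = "\<lambda>x. c * complex_of_real (h \<bullet> s x)"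
  let ?T = "\<lambda>x. 1 + c * complex_of_real (h \<bullet> s x) + c\<^sup>2 / 2 * complex_of_real ((h \<bullet> s x)\<^sup>2)"
  have Ti: "integrable P0 ?T" using inner_int[of h] inner_sq_int[of h] by (intro Bochner_Integration.integrable_add integrable_mult_right integrable_of_real) auto
  have T: "(\<integral>x. ?T x \<partial>P0) = 1 + c\<^sup>2 * complex_of_real ((norm h)\<^sup>2) / 2"
  proof -
    have "(\<integral>x. ?T x \<partial>P0) = (\<integral>x. 1 + c * complex_of_real (h \<bullet> s x) \<partial>P0) + (\<integral>x. c\<^sup>2 / 2 * complex_of_real ((h \<bullet> s x)\<^sup>2) \<partial>P0)"
      using inner_int[of h] inner_sq_int[of h]
      by (intro Bochner_Integration.integral_add Bochner_Integration.integrable_add integrable_mult_right integrable_of_real) auto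
    also have "(\<integral>x. 1 + c * complex_of_real (h \<bullet> s x) \<partial>P0) = (\<integral>x. 1 \<partial>P0) + (\<integral>x. c * complex_of_real (h \<bullet> s x) \<partial>P0)"
      using inner_int[of h] by (intro Bochner_Integration.integral_add integrable_mult_right integrable_of_real) auto
    also have "(\<integral>x. c * complex_of_real (h \<bullet> s x) \<partial>P0) = 0"
      using mean0[of h] by (simp only: integral_mult_right_zero integral_complex_of_real) simp
    also have "(\<integral>x. c\<^sup>2 / 2 * complex_of_real ((h \<bullet> s x)\<^sup>2) \<partial>P0) = c\<^sup>2 / 2 * complex_of_real ((norm h)\<^sup>2)"
      using cov[of h] by (simp only: integral_mult_right_zero integral_complex_of_real)
    finally show ?thesis by (simp add: prob_space)
  qed
  have pt: "norm (exp (?z x) - ?T x) \<le> (27 / 2 * norm h ^ 3) * exp (2 * norm (s x))" for x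
  proof -
    have nz: "norm (?z x) \<le> norm h * norm (s x)"
      using c Cauchy_Schwarz_ineq2[of h "s x"] by (simp add: norm_mult)
    also have "\<dots> \<le> norm (s x)" using h by (simp add: mult_left_le_one_le)
    finally have nz2: "norm (?z x) \<le> norm (s x)" .
    have "?T x = (\<Sum>i\<le>2. ?z x ^ i / fact i)"
      by (simp add: eval_nat_numeral power_mult_distrib)
    then have "norm (exp (?z x) - ?T x) \<le> exp (norm (?z x)) * (norm (?z x) ^ Suc 2) / fact 2"
      using Taylor_exp_field[of "?z x" 2] by simp
    also have "\<dots> \<le> exp (norm (s x)) * (norm h * norm (s x)) ^ Suc 2 / fact 2"
      by (intro divide_right_mono mult_mono power_mono nz) (use nz2 in auto)
    also have "\<dots> = norm h ^ 3 / 2 * (exp (norm (s x)) * norm (s x) ^ 3)"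
      by (simp add: power_mult_distrib eval_nat_numeral)
    also have "\<dots> \<le> norm h ^ 3 / 2 * (exp (norm (s x)) * (27 * exp (norm (s x))))"
      by (intro mult_left_mono cube_le_exp) auto
    also have "\<dots> = (27 / 2 * norm h ^ 3) * exp (2 * norm (s x))"
      unfolding exp_double power2_eq_square by simp
    finally show ?thesis .
  qed
  have i2: "integrable P0 (\<lambda>x. (27 / 2 * norm h ^ 3) * exp (2 * norm (s x)))"
    by (intro integrable_mult_right exp_norm_int) auto
  have "norm (F c h - (1 + c\<^sup>2 * complex_of_real ((norm h)\<^sup>2) / 2)) = norm (\<integral>x. exp (?z x) - ?T x \<partial>P0)"
    unfolding F_def T[symmetric] using F_int[OF c, of h] Ti by simp
  also have "\<dots> \<le> (\<integral>x. norm (exp (?z x) - ?T x) \<partial>P0)" by (rule integral_norm_bound)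
  also have "\<dots> \<le> (\<integral>x. (27 / 2 * norm h ^ 3) * exp (2 * norm (s x)) \<partial>P0)"
    using F_int[OF c, of h] Ti i2 pt by (intro integral_mono) auto
  also have "\<dots> = C3 * norm h ^ 3" by (simp add: C3_def)
  finally show ?thesis .
qed

definition KR :: "real \<Rightarrow> real" where
  "KR R = exp ((C3 + 1) * R\<^sup>2) * (C3 + 1) * R ^ 3"

text \<open>A quantitative central limit theorem for the transforms, uniform over |g| <= R. One
  factor and exp(c^2 |h|^2 / 2) agree up to order |h|^3, and n such errors add up to order n^(-1/2).
  The condition R^2 <= n puts h = g / sqrt n into the unit ball, where the expansion is
  available.\<close>

lemma F_power:
  assumes c: "norm c = 1" and g: "norm g \<le> R" and n: "1 \<le> n" "R\<^sup>2 \<le> real n"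
  shows "norm (F c ((1 / sqrt (real n)) *\<^sub>R g) ^ n - exp (c\<^sup>2 * complex_of_real ((norm g)\<^sup>2) / 2)) \<le> KR R / sqrt (real n)"
proof -
  define h where "h = (1 / sqrt (real n)) *\<^sub>R g"
  have n0: "sqrt (real n) > 0" using n by simp
  have R0: "0 \<le> R" using g norm_ge_zero order_trans by blast
  have nh: "norm h = norm g / sqrt (real n)" using n0 by (simp add: h_def)
  have "R \<le> sqrt (real n)" using n R0 by (simp add: real_le_rsqrt)
  then have h1: "norm h \<le> 1" using g n0 by (simp add: nh)
  define t where "t = (norm h)\<^sup>2"
  have t: "0 \<le> t" "t \<le> 1" "real n * t = (norm g)\<^sup>2"
    using power_le_one[of "norm h" 2] h1 n by (auto simp: t_def) (auto simp: nh power_divide)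
  define w1 where "w1 = F c h"
  define w2 where "w2 = exp (c\<^sup>2 * complex_of_real t / 2)"
  define q where "q = c\<^sup>2 * complex_of_real t / 2"
  have nq: "norm q = t / 2" using c t by (simp add: q_def norm_mult norm_power norm_divide)
  have w2q: "w2 = exp q" by (simp add: w2_def q_def)
  have e2: "norm (w2 - (1 + q)) \<le> norm h ^ 3"
  proof -
    have "norm (exp q - (\<Sum>i\<le>1. q ^ i / fact i)) \<le> exp (norm q) * norm q ^ Suc 1 / fact 1" by (rule Taylor_exp_field)
    then have "norm (w2 - (1 + q)) \<le> exp (t / 2) * (t / 2)\<^sup>2"
      by (simp add: w2q nq power2_eq_square)
    also have "\<dots> \<le> 3 * (t\<^sup>2 / 4)"
    proof -
      have "exp (t / 2) \<le> exp 1" using t by simp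
      then have "exp (t / 2) \<le> 3" using exp_le by linarith
      then show ?thesis by (intro mult_mono) (auto simp: power_divide)
    qed
    also have "\<dots> \<le> t\<^sup>2" by simp
    also have "\<dots> = norm h ^ 3 * norm h" by (simp add: t_def eval_nat_numeral)
    also have "\<dots> \<le> norm h ^ 3" using h1 by (intro mult_left_le) auto
    finally show ?thesis .
  qed
  have e1: "norm (w1 - (1 + q)) \<le> C3 * norm h ^ 3"
    using F_expansion[OF c h1] by (simp add: w1_def q_def t_def)
  have e12: "norm (w1 - w2) \<le> (C3 + 1) * norm h ^ 3"
  proof -
    have "norm (w1 - w2) \<le> norm (w1 - (1 + q)) + norm (w2 - (1 + q))"
      using norm_triangle_ineq4[of "w1 - (1 + q)" "w2 - (1 + q)"] by simp
    then show ?thesis using e1 e2 by (simp add: algebra_simps)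
  qed
  \<comment> \<open>A common bound for both moduli. After division by it the numbers lie in the unit
    disc, where the difference of n-th powers is at most n times the difference. The factor b^n
    stays bounded because n t = |g|^2.\<close>
  define b where "b = exp ((C3 + 1) * t)"
  have b1: "1 \<le> b" using C3_nonneg t by (simp add: b_def)
  have w2b: "norm w2 \<le> b"
  proof -
    have "norm w2 \<le> exp (norm q)" unfolding w2q by (rule norm_exp)
    also have "\<dots> \<le> b" using nq t mult_nonneg_nonneg[OF C3_nonneg t(1)] by (simp add: b_def algebra_simps)
    finally show ?thesis .
  qed
  have w1b: "norm w1 \<le> b"
  proof -
    have "norm h ^ 3 = t * norm h" by (simp add: t_def eval_nat_numeral)
    also have "\<dots> \<le> t" using h1 t by (intro mult_left_le) auto
    finally have "C3 * norm h ^ 3 \<le> C3 * t" using C3_nonneg by (intro mult_left_mono)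
    moreover have "norm w1 \<le> norm (w1 - (1 + q)) + norm (1 + q)"
      using norm_triangle_sub[of w1 "1 + q"] by linarith
    moreover have "norm (1 + q) \<le> 1 + t / 2" using norm_triangle_ineq[of 1 q] nq by simp
    ultimately have "norm w1 \<le> 1 + (C3 + 1) * t" using e1 t by (simp add: algebra_simps)
    also have "\<dots> \<le> b" unfolding b_def by (rule exp_ge_add_one_self)
    finally show ?thesis .
  qed
  have "norm (w1 ^ n - w2 ^ n) = b ^ n * norm ((w1 / complex_of_real b) ^ n - (w2 / complex_of_real b) ^ n)"
    using b1 by (simp add: power_divide diff_divide_distrib[symmetric] norm_divide norm_power)
  also have "\<dots> \<le> b ^ n * (real n * norm (w1 / complex_of_real b - w2 / complex_of_real b))"
    using b1 w1b w2b by (intro mult_left_mono norm_power_diff) (auto simp: norm_divide)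
  also have "\<dots> = b ^ n * (real n * (norm (w1 - w2) / b))"
    using b1 by (simp add: diff_divide_distrib[symmetric] norm_divide)
  also have "\<dots> \<le> b ^ n * (real n * ((C3 + 1) * norm h ^ 3))"
  proof -
    have "norm (w1 - w2) / b \<le> norm (w1 - w2) / 1" using b1 by (intro divide_left_mono) auto
    then show ?thesis using e12 b1 by (intro mult_left_mono) auto
  qed
  also have "b ^ n = exp ((C3 + 1) * (norm g)\<^sup>2)"
    unfolding b_def t(3)[symmetric] by (simp add: exp_of_nat_mult[symmetric] mult_ac)
  also have "real n * ((C3 + 1) * norm h ^ 3) = (C3 + 1) * norm g ^ 3 / sqrt (real n)"
  proof -
    have "sqrt (real n) ^ 3 = real n * sqrt (real n)" using n by (simp add: eval_nat_numeral)
    then show ?thesis using n0 n by (simp add: nh power_divide field_simps)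
  qed
  also have "exp ((C3 + 1) * (norm g)\<^sup>2) * ((C3 + 1) * norm g ^ 3 / sqrt (real n)) \<le>
      exp ((C3 + 1) * R\<^sup>2) * ((C3 + 1) * R ^ 3 / sqrt (real n))"
    using C3_nonneg g n0 by (intro mult_mono divide_right_mono power_mono) (auto intro!: mult_left_mono power_mono)
  also have "\<dots> = KR R / sqrt (real n)" by (simp add: KR_def)
  finally have "norm (w1 ^ n - w2 ^ n) \<le> KR R / sqrt (real n)" .
  moreover have "w2 ^ n = exp (c\<^sup>2 * complex_of_real ((norm g)\<^sup>2) / 2)"
    unfolding w2_def t(3)[symmetric] by (simp add: exp_of_nat_mult[symmetric] mult_ac)
  ultimately show ?thesis by (simp add: w1_def h_def)
qed

lemma KR_nonneg: "0 \<le> R \<Longrightarrow> 0 \<le> KR R"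
  using C3_nonneg by (simp add: KR_def)

lemma F_one: "F 1 h = complex_of_real (M h)"
  unfolding F_def M_def by (simp only: mult_1 exp_of_real integral_complex_of_real)

lemma M_power:
  assumes g: "norm g \<le> R" and n: "1 \<le> n" "R\<^sup>2 \<le> real n"
  shows "\<bar>M ((1 / sqrt (real n)) *\<^sub>R g) ^ n - exp ((norm g)\<^sup>2 / 2)\<bar> \<le> KR R / sqrt (real n)"
proof -
  have "norm (complex_of_real (M ((1 / sqrt (real n)) *\<^sub>R g) ^ n - exp ((norm g)\<^sup>2 / 2))) \<le> KR R / sqrt (real n)"
    using F_power[of 1, OF _ g n] by (simp add: F_one exp_of_real[symmetric])
  then show ?thesis by (simp only: norm_of_real)
qed

lemma M_ge_1: "1 \<le> M h"
proof -
  have "expectation (\<lambda>x. 1 + h \<bullet> s x) \<le> M h"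
    unfolding M_def using inner_int exp_int by (intro integral_mono) auto
  then show ?thesis using inner_int[of h] mean0[of h] by (simp add: prob_space)
qed

section \<open>Asymptotic normality of the normalised sum\<close>

definition z :: "nat \<Rightarrow> (nat \<Rightarrow> 'a) \<Rightarrow> 'b" where
  "z n x = (1 / sqrt (real n)) *\<^sub>R (\<Sum>j<n. s (x j))"

lemma z_meas [measurable]: "z n \<in> borel_measurable (powM P0 n)"
  unfolding z_def powM_def by measurable

lemma inner_z: "u \<bullet> z n x = (\<Sum>j<n. ((1 / sqrt (real n)) *\<^sub>R u) \<bullet> s (x j))"
  by (simp add: z_def inner_sum_right sum_divide_distrib)

lemma char_z:
  assumes "norm c = 1"
  shows "(\<integral>x. exp (c * complex_of_real (u \<bullet> z n x)) \<partial>powM P0 n) = F c ((1 / sqrt (real n)) *\<^sub>R u) ^ n"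
proof -
  interpret N: product_sigma_finite "\<lambda>_::nat. P0" by standard
  have eq: "exp (c * complex_of_real (u \<bullet> z n x)) = (\<Prod>j<n. exp (c * complex_of_real (((1 / sqrt (real n)) *\<^sub>R u) \<bullet> s (x j))))" for x
    unfolding inner_z of_real_sum sum_distrib_left by (rule exp_sum) simp
  show ?thesis
    unfolding eq powM_def
    by (subst N.product_integral_prod) (simp, rule F_int[OF assms], simp only: F_def prod_constant card_lessThan)
qed

lemma exp_z_prod: "exp (u \<bullet> z n x) = (\<Prod>j<n. exp (((1 / sqrt (real n)) *\<^sub>R u) \<bullet> s (x j)))"
  unfolding inner_z by (rule exp_sum) simp

lemma mgf_z: "integrable (powM P0 n) (\<lambda>x. exp (u \<bullet> z n x))"
  "(\<integral>x. exp (u \<bullet> z n x) \<partial>powM P0 n) = M ((1 / sqrt (real n)) *\<^sub>R u) ^ n"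
proof -
  interpret N: product_sigma_finite "\<lambda>_::nat. P0" by standard
  show "integrable (powM P0 n) (\<lambda>x. exp (u \<bullet> z n x))"
    unfolding exp_z_prod powM_def by (rule N.product_integrable_prod) (simp, rule exp_int)
  show "(\<integral>x. exp (u \<bullet> z n x) \<partial>powM P0 n) = M ((1 / sqrt (real n)) *\<^sub>R u) ^ n"
    unfolding exp_z_prod powM_def
    by (subst N.product_integral_prod) (simp, rule exp_int, simp only: M_def prod_constant card_lessThan)
qed

lemma KR_lim: "(\<lambda>n. KR R / sqrt (real n)) \<longlonglongrightarrow> 0"
  by (intro tendsto_divide_0[OF tendsto_const] filterlim_at_top_imp_at_infinity
      filterlim_compose[OF sqrt_at_top filterlim_real_sequentially])

text \<open>The central limit theorem for z_n: at c = i, \<open>F_power\<close> gives convergence of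
  characteristic functions, which \<open>tendsto_std_gauss\<close> turns into convergence of
  integrals.\<close>

lemma tendsto_integral_z:
  fixes k :: "'b \<Rightarrow> real"
  assumes k: "continuous_on UNIV k" and supp: "\<And>x. B < norm x \<Longrightarrow> k x = 0"
  shows "(\<lambda>n. \<integral>x. k (z n x) \<partial>powM P0 n) \<longlonglongrightarrow> (\<integral>x. k x \<partial>std_gauss)"
proof -
  let ?\<nu> = "\<lambda>n. distr (powM P0 n) borel (z n)"
  have km [measurable]: "k \<in> borel_measurable borel" using k by (rule borel_measurable_continuous_onI)
  have "(\<lambda>n. \<integral>x. k x \<partial>?\<nu> n) \<longlonglongrightarrow> (\<integral>x. k x \<partial>std_gauss)"
  proof (rule tendsto_std_gauss[OF _ _ _ k supp])
    fix n
    interpret P: prob_space "powM P0 n" by (rule prob_space_powM[OF prob_space_axioms])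
    show "prob_space (?\<nu> n)" by (rule P.prob_space_distr) measurable
    show "sets (?\<nu> n) = sets borel" by simp
  next
    fix u :: 'b
    have "(\<lambda>n. F \<i> ((1 / sqrt (real n)) *\<^sub>R u) ^ n - exp (\<i>\<^sup>2 * complex_of_real ((norm u)\<^sup>2) / 2)) \<longlonglongrightarrow> 0"
    proof (rule Lim_null_comparison[OF _ KR_lim])
      have "\<forall>\<^sub>F n in sequentially. 1 \<le> n \<and> (norm u)\<^sup>2 \<le> real n"
        by (intro eventually_conj eventually_ge_at_top filterlim_real_sequentially[unfolded filterlim_at_top, rule_format])
      then show "\<forall>\<^sub>F n in sequentially. norm (F \<i> ((1 / sqrt (real n)) *\<^sub>R u) ^ n - exp (\<i>\<^sup>2 * complex_of_real ((norm u)\<^sup>2) / 2)) \<le> KR (norm u) / sqrt (real n)"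
        by eventually_elim (intro F_power, auto)
    qed
    then have "(\<lambda>n. F \<i> ((1 / sqrt (real n)) *\<^sub>R u) ^ n) \<longlonglongrightarrow> exp (\<i>\<^sup>2 * complex_of_real ((norm u)\<^sup>2) / 2)"
      by (rule LIM_zero_cancel)
    moreover have "exp (\<i>\<^sup>2 * complex_of_real ((norm u)\<^sup>2) / 2) = complex_of_real (exp (- (norm u)\<^sup>2 / 2))"
      by (simp add: exp_of_real[symmetric])
    moreover have "(\<integral>x. iexp (u \<bullet> x) \<partial>?\<nu> n) = F \<i> ((1 / sqrt (real n)) *\<^sub>R u) ^ n" for n
      by (subst integral_distr) (simp_all add: char_z)
    ultimately show "(\<lambda>n. \<integral>x. iexp (u \<bullet> x) \<partial>?\<nu> n) \<longlonglongrightarrow> complex_of_real (exp (- (norm u)\<^sup>2 / 2))"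
      by simp
  qed
  moreover have "(\<integral>x. k x \<partial>?\<nu> n) = (\<integral>x. k (z n x) \<partial>powM P0 n)" for n
    by (subst integral_distr) simp_all
  ultimately show ?thesis by simp
qed

definition Q :: "'b \<Rightarrow> 'a measure" where
  "Q h = density P0 (\<lambda>x. ennreal (exp (h \<bullet> s x) / M h))"

text \<open>The expectation of \<open>f\<close> under the n-fold product of \<open>Q\<close> at g /
  sqrt n, as \<open>integral_powM_Q\<close> shows. Written against the fixed product of
  \<open>P0\<close>, it depends on \<open>g\<close> only through the integrand and the normaliser,
  which gives direct access to measurability and limits in \<open>g\<close>.\<close>

definition tilt :: "nat \<Rightarrow> 'b \<Rightarrow> ((nat \<Rightarrow> 'a) \<Rightarrow> real) \<Rightarrow> real" where
  "tilt n g f = (\<integral>x. exp (g \<bullet> z n x) * f x \<partial>powM P0 n) / M ((1 / sqrt (real n)) *\<^sub>R g) ^ n"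

lemma M_pos: "0 < M h" using M_ge_1[of h] by simp

lemma prob_space_Q: "prob_space (Q h)"
proof
  have "emeasure (Q h) (space (Q h)) = (\<integral>\<^sup>+x. ennreal (exp (h \<bullet> s x) / M h) \<partial>P0)"
    by (simp add: Q_def emeasure_density)
  also have "\<dots> = ennreal (\<integral>x. exp (h \<bullet> s x) / M h \<partial>P0)"
    using exp_int[of h] M_pos[of h] by (intro nn_integral_eq_integral) auto
  also have "(\<integral>x. exp (h \<bullet> s x) / M h \<partial>P0) = 1" using M_pos[of h] by (simp add: M_def[symmetric])
  finally show "emeasure (Q h) (space (Q h)) = 1" by simp
qed

lemma integral_powM_Q:
  assumes [measurable]: "f \<in> borel_measurable (powM P0 n)"
  shows "(\<integral>x. f x \<partial>powM (Q ((1 / sqrt (real n)) *\<^sub>R g)) n) = tilt n g f"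
proof -
  define h where "h = (1 / sqrt (real n)) *\<^sub>R g"
  have pr: "(\<Prod>j<n. ennreal (exp (h \<bullet> s (x j)) / M h)) = ennreal (exp (g \<bullet> z n x) / M h ^ n)" for x
    using M_pos[of h] by (simp add: prod_ennreal exp_z_prod prod_dividef h_def[symmetric])
  have "powM (Q h) n = density (powM P0 n) (\<lambda>x. ennreal (exp (g \<bullet> z n x) / M h ^ n))"
    unfolding Q_def using prob_space_Q[of h]
    by (subst powM_density) (simp_all add: Q_def pr sigma_finite_measure_axioms)
  then have "(\<integral>x. f x \<partial>powM (Q h) n) = (\<integral>x. exp (g \<bullet> z n x) / M h ^ n * f x \<partial>powM P0 n)"
    using M_pos[of h] by (simp add: integral_density)
  also have "\<dots> = (\<integral>x. (exp (g \<bullet> z n x) * f x) / M h ^ n \<partial>powM P0 n)" by simp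
  also have "\<dots> = tilt n g f" unfolding tilt_def h_def by (rule integral_divide_zero)
  finally show ?thesis unfolding h_def .
qed

lemma tendsto_M_power:
  assumes N: "filterlim N at_top sequentially" and u: "u \<longlonglongrightarrow> u0"
  shows "(\<lambda>j. M ((1 / sqrt (real (N j))) *\<^sub>R u j) ^ N j) \<longlonglongrightarrow> exp ((norm u0)\<^sup>2 / 2)"
proof -
  define U where "U = norm u0 + 1"
  have evU: "\<forall>\<^sub>F j in sequentially. norm (u j) \<le> U"
    using order_tendstoD(2)[OF tendsto_norm[OF u], of U] by (auto simp: U_def elim: eventually_mono)
  have "(\<lambda>j. M ((1 / sqrt (real (N j))) *\<^sub>R u j) ^ N j - exp ((norm (u j))\<^sup>2 / 2)) \<longlonglongrightarrow> 0"
  proof (rule Lim_null_comparison[OF _ filterlim_compose[OF KR_lim N]])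
    have "\<forall>\<^sub>F j in sequentially. 1 \<le> N j \<and> U\<^sup>2 \<le> real (N j)"
      using N filterlim_compose[OF filterlim_real_sequentially N] unfolding filterlim_at_top by (intro eventually_conj) auto
    then show "\<forall>\<^sub>F j in sequentially. norm (M ((1 / sqrt (real (N j))) *\<^sub>R u j) ^ N j - exp ((norm (u j))\<^sup>2 / 2)) \<le> KR U / sqrt (real (N j))"
      using evU by eventually_elim (auto intro!: M_power)
  qed
  moreover have "(\<lambda>j. exp ((norm (u j))\<^sup>2 / 2)) \<longlonglongrightarrow> exp ((norm u0)\<^sup>2 / 2)" by (intro tendsto_intros u) simp
  ultimately show ?thesis using tendsto_add[of _ 0 sequentially "\<lambda>j. exp ((norm (u j))\<^sup>2 / 2)"] by fastforce
qed

text \<open>Sample size and local parameter both move with \<open>j\<close>, since the target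
  experiment has floor(r n) observations and a rescaled parameter. Uniform continuity of exp(v . y)
  f(y - v) in the pair (v, y) on a compact set allows \<open>u j\<close> to be replaced by its
  limit; for the fixed parameter the central limit theorem applies, and the Gaussian translation
  formula evaluates the result.\<close>

lemma tendsto_tilt:
  fixes f :: "'b \<Rightarrow> real"
  assumes f: "continuous_on UNIV f" and supp: "\<And>x. B < norm x \<Longrightarrow> f x = 0"
    and N: "filterlim N at_top sequentially" and u: "u \<longlonglongrightarrow> u0"
  shows "(\<lambda>j. tilt (N j) (u j) (\<lambda>x. f (z (N j) x - u j))) \<longlonglongrightarrow> (\<integral>y. f y \<partial>std_gauss)"
proof -
  have fm [measurable]: "f \<in> borel_measurable borel" using f by (rule borel_measurable_continuous_onI)
  define k where "k v y = exp (v \<bullet> y) * f (y - v)" for v y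
  have kc: "continuous_on UNIV (k v)" for v
    unfolding k_def by (intro continuous_intros continuous_on_compose2[OF f]) auto
  have [measurable]: "k v \<in> borel_measurable borel" for v using kc by (rule borel_measurable_continuous_onI)
  \<comment> \<open>Eventually all \<open>u j\<close> lie in the ball of this radius, so every
    \<open>k (u j)\<close> vanishes beyond \<open>U + B\<close> and only a compact set of pairs
    matters.\<close>
  define U where "U = norm u0 + 1"
  have ksupp: "k v y = 0" if "norm v \<le> U" "U + B < norm y" for v y
  proof -
    have "norm y \<le> norm (y - v) + norm v" by (metis norm_triangle_sub add.commute)
    then show ?thesis using that supp[of "y - v"] by (simp add: k_def)
  qed
  have ku_supp: "k u0 y = 0" if "U + B < norm y" for y using ksupp[OF _ that] by (simp add: U_def)
  have evU: "\<forall>\<^sub>F j in sequentially. norm (u j) \<le> U"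
    using order_tendstoD(2)[OF tendsto_norm[OF u], of U] by (auto simp: U_def elim: eventually_mono)
  have uc: "uniformly_continuous_on (cball 0 U \<times> cball 0 (U + B)) (\<lambda>(v, y). k v y)"
  proof (rule compact_uniformly_continuous)
    have "continuous_on UNIV (\<lambda>p. k (fst p) (snd p))"
      unfolding k_def by (intro continuous_intros continuous_on_compose2[OF f]) auto
    then show "continuous_on (cball 0 U \<times> cball 0 (U + B)) (\<lambda>(v, y). k v y)"
      by (auto simp: case_prod_beta' intro: continuous_on_subset)
  qed (intro compact_Times compact_cball)
  have main: "(\<lambda>j. \<integral>x. k u0 (z (N j) x) \<partial>powM P0 (N j)) \<longlonglongrightarrow> (\<integral>y. k u0 y \<partial>std_gauss)"
    by (rule filterlim_compose[OF tendsto_integral_z[OF kc ku_supp] N])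
  have "(\<lambda>j. (\<integral>x. k (u j) (z (N j) x) \<partial>powM P0 (N j)) - (\<integral>x. k u0 (z (N j) x) \<partial>powM P0 (N j))) \<longlonglongrightarrow> 0"
  proof (rule tendstoI)
    fix e :: real assume e: "e > 0"
    obtain d where d: "d > 0" "\<And>p p'. p \<in> cball 0 U \<times> cball 0 (U + B) \<Longrightarrow> p' \<in> cball 0 U \<times> cball 0 (U + B) \<Longrightarrow>
        dist p' p < d \<Longrightarrow> dist ((\<lambda>(v, y). k v y) p') ((\<lambda>(v, y). k v y) p) < e / 2"
      using uc e unfolding uniformly_continuous_on_def by (metis half_gt_zero)
    have "\<forall>\<^sub>F j in sequentially. dist (u j) u0 < d" using u d(1) by (rule tendstoD)
    then show "\<forall>\<^sub>F j in sequentially. dist ((\<integral>x. k (u j) (z (N j) x) \<partial>powM P0 (N j)) - (\<integral>x. k u0 (z (N j) x) \<partial>powM P0 (N j))) 0 < e"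
      using evU
    proof eventually_elim
      case (elim j)
      interpret P: prob_space "powM P0 (N j)" by (rule prob_space_powM[OF prob_space_axioms])
      have close: "\<bar>k (u j) y - k u0 y\<bar> \<le> e / 2" for y
      proof (cases "norm y \<le> U + B")
        case True
        have "dist (u j, y) (u0, y) < d" using elim by (simp add: dist_Pair_Pair)
        then show ?thesis using d(2)[of "(u0, y)" "(u j, y)"] True elim by (auto simp: dist_real_def U_def)
      next
        case False
        then show ?thesis using ksupp[of "u j" y] ku_supp[of y] elim e by auto
      qed
      obtain C where C: "\<And>y. \<bar>k u0 y\<bar> \<le> C"
      proof -
        have "compact (k u0 ` cball 0 (U + B))"
          by (intro compact_continuous_image continuous_on_subset[OF kc]) auto
        then have "bounded (k u0 ` cball 0 (U + B))" by (rule compact_imp_bounded)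
        then obtain C0 where C0: "\<And>y. y \<in> cball 0 (U + B) \<Longrightarrow> \<bar>k u0 y\<bar> \<le> C0"
          unfolding bounded_iff by (metis imageI real_norm_def)
        show ?thesis
        proof (rule that[of "max C0 0"])
          fix y show "\<bar>k u0 y\<bar> \<le> max C0 0"
            using C0[of y] ku_supp[of y] by (cases "norm y \<le> U + B") auto
        qed
      qed
      have i1: "integrable (powM P0 (N j)) (\<lambda>x. k u0 (z (N j) x))"
        by (rule P.integrable_const_bound[where B=C]) (use C in auto)
      have "\<bar>k (u j) y\<bar> \<le> C + e / 2" for y using close[of y] C[of y] by linarith
      then have i2: "integrable (powM P0 (N j)) (\<lambda>x. k (u j) (z (N j) x))"
        by (intro P.integrable_const_bound[where B="C + e / 2"]) auto
      have "\<bar>(\<integral>x. k (u j) (z (N j) x) \<partial>powM P0 (N j)) - (\<integral>x. k u0 (z (N j) x) \<partial>powM P0 (N j))\<bar>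
         = \<bar>\<integral>x. k (u j) (z (N j) x) - k u0 (z (N j) x) \<partial>powM P0 (N j)\<bar>" using i1 i2 by simp
      also have "\<dots> \<le> (\<integral>x. e / 2 \<partial>powM P0 (N j))"
        by (rule order_trans[OF integral_abs_bound integral_mono]) (use i1 i2 close in auto)
      also have "\<dots> < e" using e by (simp add: P.prob_space)
      finally show ?case by simp
    qed
  qed
  from tendsto_add[OF this main]
  have num: "(\<lambda>j. \<integral>x. k (u j) (z (N j) x) \<partial>powM P0 (N j)) \<longlonglongrightarrow> (\<integral>y. k u0 y \<partial>std_gauss)" by simp
  have "(\<lambda>j. tilt (N j) (u j) (\<lambda>x. f (z (N j) x - u j))) \<longlonglongrightarrow> (\<integral>y. k u0 y \<partial>std_gauss) / exp ((norm u0)\<^sup>2 / 2)"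
    unfolding tilt_def using num by (intro tendsto_divide tendsto_M_power[OF N u]) (simp_all add: k_def)
  also have "(\<integral>y. k u0 y \<partial>std_gauss) / exp ((norm u0)\<^sup>2 / 2) = (\<integral>y. exp (u0 \<bullet> y - (norm u0)\<^sup>2 / 2) * f (y - u0) \<partial>std_gauss)"
    by (subst integral_divide_zero[symmetric]) (simp add: k_def exp_diff)
  also have "\<dots> = (\<integral>y. f (u0 + y - u0) \<partial>std_gauss)" by (rule std_gauss_translate) measurable
  finally show ?thesis by simp
qed

definition C4 :: real where "C4 = (C3 + 2)\<^sup>2 * expectation (\<lambda>x. exp (4 * norm (s x)))"

text \<open>The tilted family is itself differentiable in quadratic mean at 0 with score
  \<open>s\<close>, and with a rate: the square root of its density has a pointwise error of second
  order in \<open>h\<close>, whose square is of fourth order.\<close>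

lemma sqrt_tilt_expansion:
  assumes h: "norm h \<le> 1"
  shows "integrable P0 (\<lambda>x. (exp (h \<bullet> s x / 2) / sqrt (M h) - 1 - h \<bullet> s x / 2)\<^sup>2)" (is "integrable P0 ?f")
    and "expectation (\<lambda>x. (exp (h \<bullet> s x / 2) / sqrt (M h) - 1 - h \<bullet> s x / 2)\<^sup>2) \<le> C4 * norm h ^ 4"
proof -
  have M1: "1 \<le> M h" by (rule M_ge_1)
  have Mle: "M h - 1 \<le> (C3 + 1) * (norm h)\<^sup>2"
  proof -
    have "norm (complex_of_real (M h - (1 + (norm h)\<^sup>2 / 2))) \<le> C3 * norm h ^ 3"
      using F_expansion[of 1 h] h by (simp add: F_one)
    then have "\<bar>M h - (1 + (norm h)\<^sup>2 / 2)\<bar> \<le> C3 * norm h ^ 3" by (simp only: norm_of_real)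
    moreover have "norm h ^ 3 \<le> (norm h)\<^sup>2" using h by (intro power_decreasing) auto
    then have "C3 * norm h ^ 3 \<le> C3 * (norm h)\<^sup>2" using C3_nonneg by (intro mult_left_mono)
    moreover have "(C3 + 1) * (norm h)\<^sup>2 = C3 * (norm h)\<^sup>2 + (norm h)\<^sup>2" by (simp add: algebra_simps)
    ultimately show ?thesis using zero_le_power2[of "norm h"] by linarith
  qed
  \<comment> \<open>This isolates the effect of the normaliser, which differs from 1 by order |h|^2.
    A number at least 1 has its inverse square root no further from 1 than itself.\<close>
  have inv: "\<bar>1 / sqrt (M h) - 1\<bar> \<le> M h - 1"
  proof -
    have "sqrt (M h) \<le> M h" using M1 by (simp add: real_le_lsqrt power2_eq_square)
    moreover have s1: "1 \<le> sqrt (M h)" using M1 by simp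
    moreover have "1 - 1 / sqrt (M h) \<le> sqrt (M h) - 1"
    proof -
      have "(sqrt (M h) - 1) * (1 / sqrt (M h)) \<le> sqrt (M h) - 1" using s1 by (intro mult_left_le) auto
      then show ?thesis using s1 by (simp add: field_simps)
    qed
    moreover have "1 / sqrt (M h) \<le> 1" using s1 by simp
    ultimately show ?thesis by linarith
  qed
  have pt: "?f x \<le> (C3 + 2)\<^sup>2 * norm h ^ 4 * exp (4 * norm (s x))" for x
  proof -
    let ?y = "h \<bullet> s x / 2" and ?E = "exp (2 * norm (s x))"
    have ny: "\<bar>?y\<bar> \<le> norm h * norm (s x) / 2" using Cauchy_Schwarz_ineq2[of h "s x"] by simp
    have ny2: "\<bar>?y\<bar> \<le> norm (s x)"
    proof -
      have "norm h * norm (s x) \<le> norm (s x)" using h by (simp add: mult_left_le_one_le)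
      then show ?thesis using ny norm_ge_zero[of "s x"] by linarith
    qed
    have "norm (exp ?y - (\<Sum>i\<le>1. ?y ^ i / fact i)) \<le> exp (norm ?y) * norm ?y ^ Suc 1 / fact 1" by (rule Taylor_exp_field)
    then have "\<bar>exp ?y - 1 - ?y\<bar> \<le> exp \<bar>?y\<bar> * \<bar>?y\<bar>\<^sup>2" by (simp add: power2_eq_square algebra_simps)
    also have "\<dots> \<le> exp (norm (s x)) * (norm h * norm (s x) / 2)\<^sup>2"
      using ny ny2 by (intro mult_mono power_mono) auto
    also have "\<dots> = (norm h)\<^sup>2 / 4 * (exp (norm (s x)) * (norm (s x))\<^sup>2)" by (simp add: power_divide power_mult_distrib)
    also have "\<dots> \<le> (norm h)\<^sup>2 / 4 * (exp (norm (s x)) * (4 * exp (norm (s x))))"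
      by (intro mult_left_mono square_le_exp) auto
    also have "\<dots> = (norm h)\<^sup>2 * ?E" unfolding exp_double power2_eq_square by simp
    finally have a: "\<bar>exp ?y - 1 - ?y\<bar> \<le> (norm h)\<^sup>2 * ?E" .
    have "\<bar>exp ?y * (1 / sqrt (M h) - 1)\<bar> \<le> ?E * ((C3 + 1) * (norm h)\<^sup>2)"
    proof -
      have "?y \<le> 2 * norm (s x)" using ny2 norm_ge_zero[of "s x"] by linarith
      then have "\<bar>exp ?y\<bar> \<le> ?E" by simp
      then show ?thesis unfolding abs_mult using inv Mle by (intro mult_mono) auto
    qed
    moreover have "exp ?y / sqrt (M h) - 1 - ?y = (exp ?y - 1 - ?y) + exp ?y * (1 / sqrt (M h) - 1)"
      by (simp add: algebra_simps)
    ultimately have "\<bar>exp ?y / sqrt (M h) - 1 - ?y\<bar> \<le> (norm h)\<^sup>2 * ?E + ?E * ((C3 + 1) * (norm h)\<^sup>2)"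
      using a by linarith
    also have "\<dots> = (C3 + 2) * (norm h)\<^sup>2 * ?E" by (simp add: algebra_simps)
    finally have "\<bar>exp ?y / sqrt (M h) - 1 - ?y\<bar>\<^sup>2 \<le> ((C3 + 2) * (norm h)\<^sup>2 * ?E)\<^sup>2" by (intro power_mono) auto
    also have "\<dots> = (C3 + 2)\<^sup>2 * norm h ^ 4 * exp (4 * norm (s x))"
    proof -
      have "?E\<^sup>2 = exp (4 * norm (s x))" by (simp flip: exp_double)
      moreover have "((norm h)\<^sup>2)\<^sup>2 = norm h ^ 4" by (simp flip: power_mult)
      ultimately show ?thesis by (simp only: power_mult_distrib)
    qed
    finally show ?thesis by simp
  qed
  have i: "integrable P0 (\<lambda>x. (C3 + 2)\<^sup>2 * norm h ^ 4 * exp (4 * norm (s x)))"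
    by (intro integrable_mult_right exp_norm_int) auto
  show fi: "integrable P0 ?f"
    by (rule Bochner_Integration.integrable_bound[OF i]) (use pt in auto)
  have "expectation ?f \<le> expectation (\<lambda>x. (C3 + 2)\<^sup>2 * norm h ^ 4 * exp (4 * norm (s x)))"
    using fi i pt by (intro integral_mono) auto
  then show "expectation ?f \<le> C4 * norm h ^ 4" by (simp add: C4_def mult_ac)
qed

end

section \<open>Bayes bound for the tilted family\<close>

text \<open>A continuous substitute for the indicator of a ball when a < b: it is 1 up to radius
  \<open>a\<close>, 0 from \<open>b\<close> on and linear in the norm between. Convergence of z_n is
  available only for continuous functions of bounded support.\<close>

definition cutoff :: "real \<Rightarrow> real \<Rightarrow> 'b::real_normed_vector \<Rightarrow> real" where
  "cutoff a b x = max 0 (min 1 ((b - norm x) / (b - a)))"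

lemma cutoff_bounds: "0 \<le> cutoff a b x" "cutoff a b x \<le> 1"
  by (auto simp: cutoff_def)

lemma cutoff_eq_1: "a < b \<Longrightarrow> norm x \<le> a \<Longrightarrow> cutoff a b x = 1"
  by (auto simp: cutoff_def min_def field_simps)

lemma cutoff_eq_0: "a < b \<Longrightarrow> b \<le> norm x \<Longrightarrow> cutoff a b x = 0"
  by (auto simp: cutoff_def max_def min_def field_simps divide_nonpos_pos)

lemma continuous_on_cutoff: "a < b \<Longrightarrow> continuous_on A (cutoff a b)"
  unfolding cutoff_def by (intro continuous_intros) auto

context exp_family
begin

section \<open>Tilted expectations of tests with values in [0, 1]\<close>

lemma M_measurable [measurable]: "M \<in> borel_measurable borel"
  unfolding M_def by measurable

lemma sigma_finite_powM: "sigma_finite_measure (powM P0 n)"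
  by (intro prob_space_imp_sigma_finite prob_space_powM prob_space_axioms)

lemma tilt_measurable:
  assumes [measurable]: "(\<lambda>(g, x). f g x) \<in> borel_measurable (borel \<Otimes>\<^sub>M powM P0 n)"
  shows "(\<lambda>g. tilt n g (f g)) \<in> borel_measurable borel"
proof -
  interpret sigma_finite_measure "powM P0 n" by (rule sigma_finite_powM)
  show ?thesis unfolding tilt_def by measurable
qed

lemma tilt_bounds:
  assumes [measurable]: "f \<in> borel_measurable (powM P0 n)" and f: "\<And>x. x \<in> space (powM P0 n) \<Longrightarrow> 0 \<le> f x" "\<And>x. x \<in> space (powM P0 n) \<Longrightarrow> f x \<le> 1"
  shows "0 \<le> tilt n g f" "tilt n g f \<le> 1"
proof -
  let ?Q = "powM (Q ((1 / sqrt (real n)) *\<^sub>R g)) n"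
  interpret Q: prob_space ?Q by (intro prob_space_powM prob_space_Q)
  have "sets (Q ((1 / sqrt (real n)) *\<^sub>R g)) = sets P0" by (simp add: Q_def)
  then have se: "sets ?Q = sets (powM P0 n)" by (rule sets_powM_cong)
  have fm: "f \<in> borel_measurable ?Q" using assms(1) by (simp only: measurable_cong_sets[OF se refl])
  have i: "integrable ?Q f"
    by (rule Q.integrable_const_bound[where B=1]) (use f fm in \<open>auto simp: sets_eq_imp_space_eq[OF se]\<close>)
  have sp: "space ?Q = space (powM P0 n)" using se by (rule sets_eq_imp_space_eq)
  show "0 \<le> tilt n g f" unfolding integral_powM_Q[OF assms(1), symmetric]
    using f by (intro integral_nonneg_AE AE_I2) (simp add: sp)
  have "(\<integral>x. f x \<partial>?Q) \<le> (\<integral>x. 1 \<partial>?Q)" using i f by (intro integral_mono) (auto simp: sp)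
  then show "tilt n g f \<le> 1" unfolding integral_powM_Q[OF assms(1), symmetric] by (simp add: Q.prob_space)
qed

lemma tilt_integrable:
  assumes [measurable]: "f \<in> borel_measurable (powM P0 n)" and f: "\<And>x. x \<in> space (powM P0 n) \<Longrightarrow> 0 \<le> f x" "\<And>x. x \<in> space (powM P0 n) \<Longrightarrow> f x \<le> 1"
  shows "integrable (powM P0 n) (\<lambda>x. exp (g \<bullet> z n x) * f x)"
  by (rule Bochner_Integration.integrable_bound[OF mgf_z(1)[of n g]]) (use f in \<open>auto simp: abs_mult mult_left_le\<close>)

lemma tilt_add:
  assumes "f \<in> borel_measurable (powM P0 n)" "\<And>x. x \<in> space (powM P0 n) \<Longrightarrow> 0 \<le> f x" "\<And>x. x \<in> space (powM P0 n) \<Longrightarrow> f x \<le> 1"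
    and "f' \<in> borel_measurable (powM P0 n)" "\<And>x. x \<in> space (powM P0 n) \<Longrightarrow> 0 \<le> f' x" "\<And>x. x \<in> space (powM P0 n) \<Longrightarrow> f' x \<le> 1"
  shows "tilt n g (\<lambda>x. f x + f' x) = tilt n g f + tilt n g f'"
  unfolding tilt_def using tilt_integrable[OF assms(1-3), of g] tilt_integrable[OF assms(4-6), of g]
  by (simp add: distrib_left add_divide_distrib)

lemma tilt_one: "tilt n g (\<lambda>_. 1) = 1"
  unfolding tilt_def using mgf_z(2)[where u=g and n=n] M_pos[of "(1 / sqrt (real n)) *\<^sub>R g"] by simp

lemma tilt_mono:
  assumes "f \<in> borel_measurable (powM P0 n)" "\<And>x. x \<in> space (powM P0 n) \<Longrightarrow> 0 \<le> f x" "\<And>x. x \<in> space (powM P0 n) \<Longrightarrow> f x \<le> 1"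
    and "f' \<in> borel_measurable (powM P0 n)" "\<And>x. x \<in> space (powM P0 n) \<Longrightarrow> 0 \<le> f' x" "\<And>x. x \<in> space (powM P0 n) \<Longrightarrow> f' x \<le> 1"
    and "\<And>x. x \<in> space (powM P0 n) \<Longrightarrow> f x \<le> f' x"
  shows "tilt n g f \<le> tilt n g f'"
  unfolding tilt_def using tilt_integrable[OF assms(1-3), of g] tilt_integrable[OF assms(4-6), of g] assms(7) M_pos
  by (intro divide_right_mono integral_mono) (auto intro: zero_le_power less_imp_le)

text \<open>Completing the square turns the integral into the Gaussian measure of a ball, which is largest when the ball
  is centred.\<close>

lemma posterior_ball_le:
  fixes y v :: 'b
  assumes \<rho>: "0 < \<rho>"
  shows "(\<integral>\<^sup>+g. ennreal (exp (g \<bullet> y - (norm g)\<^sup>2 / 2)) * indicator {g. norm (v - \<rho> *\<^sub>R g) \<le> b} g \<partial>lborel)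
    \<le> ennreal (exp ((norm y)\<^sup>2 / 2) * sqrt ((2 * pi) ^ DIM('b)) * measure std_gauss (cball (0::'b) (b / \<rho>)))"
proof -
  let ?c = "sqrt ((2 * pi) ^ DIM('b))"
  have c: "?c > 0" by simp
  have e: "exp (g \<bullet> y - (norm g)\<^sup>2 / 2) = exp ((norm y)\<^sup>2 / 2) * ?c * gdens (g - y)" for g
  proof -
    have "g \<bullet> y - (norm g)\<^sup>2 / 2 = (norm y)\<^sup>2 / 2 + (- (norm (g - y))\<^sup>2 / 2)"
      by (simp add: power2_norm_eq_inner inner_diff_left inner_diff_right inner_commute field_simps)
    then have "exp (g \<bullet> y - (norm g)\<^sup>2 / 2) = exp ((norm y)\<^sup>2 / 2) * exp (- (norm (g - y))\<^sup>2 / 2)"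
      by (simp only: exp_add)
    moreover have "?c * gdens (g - y) = exp (- (norm (g - y))\<^sup>2 / 2)" unfolding gdens_def using c by simp
    ultimately show ?thesis by (simp only: mult.assoc)
  qed
  have S: "{g. norm (v - \<rho> *\<^sub>R g) \<le> b} = cball ((1 / \<rho>) *\<^sub>R v) (b / \<rho>)"
  proof -
    have "norm (v - \<rho> *\<^sub>R g) = \<rho> * norm ((1 / \<rho>) *\<^sub>R v - g)" for g
    proof -
      have "v - \<rho> *\<^sub>R g = \<rho> *\<^sub>R ((1 / \<rho>) *\<^sub>R v - g)" using \<rho> by (simp add: scaleR_right_diff_distrib)
      then show ?thesis using \<rho> by simp
    qed
    then show ?thesis using \<rho> by (auto simp: dist_norm field_simps)
  qed
  let ?B = "cball ((1 / \<rho>) *\<^sub>R v) (b / \<rho>)"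
  have [measurable]: "?B \<in> sets borel" by simp
  have "(\<integral>\<^sup>+g. ennreal (gdens (g - y)) * indicator ?B g \<partial>lborel) =
      (\<integral>\<^sup>+g. ennreal (gdens (g - y)) * indicator ?B g \<partial>distr lborel borel ((+) y))"
    by (simp add: lborel_distr_plus)
  also have "\<dots> = (\<integral>\<^sup>+g. ennreal (gdens g) * indicator ?B (y + g) \<partial>lborel)"
    by (subst nn_integral_distr) simp_all
  also have "\<dots> = (\<integral>\<^sup>+g. ennreal (gdens g) * indicator (cball ((1 / \<rho>) *\<^sub>R v - y) (b / \<rho>)) g \<partial>lborel)"
    by (intro nn_integral_cong) (auto simp: indicator_def dist_norm algebra_simps)
  also have "\<dots> = emeasure std_gauss (cball ((1 / \<rho>) *\<^sub>R v - y) (b / \<rho>))"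
    unfolding std_gauss_def by (simp add: emeasure_density)
  also have "\<dots> \<le> ennreal (measure std_gauss (cball (0::'b) (b / \<rho>)))"
    using std_gauss_cball_le[of "(1 / \<rho>) *\<^sub>R v - y" "b / \<rho>"] by (simp add: std_gauss.emeasure_eq_measure)
  finally have i: "(\<integral>\<^sup>+g. ennreal (gdens (g - y)) * indicator ?B g \<partial>lborel) \<le> ennreal (measure std_gauss (cball (0::'b) (b / \<rho>)))" .
  have "(\<integral>\<^sup>+g. ennreal (exp (g \<bullet> y - (norm g)\<^sup>2 / 2)) * indicator {g. norm (v - \<rho> *\<^sub>R g) \<le> b} g \<partial>lborel)
     = (\<integral>\<^sup>+g. ennreal (exp ((norm y)\<^sup>2 / 2) * ?c) * (ennreal (gdens (g - y)) * indicator ?B g) \<partial>lborel)"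
    unfolding e S by (simp add: ennreal_mult' mult.assoc)
  also have "\<dots> = ennreal (exp ((norm y)\<^sup>2 / 2) * ?c) * (\<integral>\<^sup>+g. ennreal (gdens (g - y)) * indicator ?B g \<partial>lborel)"
    by (rule nn_integral_cmult) measurable
  also have "\<dots> \<le> ennreal (exp ((norm y)\<^sup>2 / 2) * ?c) * ennreal (measure std_gauss (cball (0::'b) (b / \<rho>)))"
    using i by (intro mult_left_mono) auto
  also have "\<dots> = ennreal (exp ((norm y)\<^sup>2 / 2) * ?c * measure std_gauss (cball (0::'b) (b / \<rho>)))"
    using c by (simp add: ennreal_mult')
  finally show ?thesis .
qed

text \<open>The Bayes inequality for one kernel at fixed \<open>n\<close>. The weight
  \<open>\<psi>\<close> truncates z_n, and what it discards is the first term of the bound. On the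
  rest, the normaliser is exchanged for exp(|g|^2/2) at the price of the factor 1 / (1 - KR R / sqrt
  n). Fubini then fixes the data and the output of the kernel and integrates over \<open>g\<close>
  first, where \<open>posterior_ball_le\<close> applies whatever the output is.\<close>

lemma posterior_bound:
  fixes \<psi> :: "'b \<Rightarrow> real" and t :: "'y \<Rightarrow> 'b" and b :: real
  assumes \<Lambda>: "\<Lambda> \<in> powM P0 n \<rightarrow>\<^sub>M prob_algebra Y" and t [measurable]: "t \<in> borel_measurable Y"
    and \<psi> [measurable]: "\<psi> \<in> borel_measurable borel" and \<psi>01: "\<And>y. 0 \<le> \<psi> y" "\<And>y. \<psi> y \<le> 1"
    and supp: "\<And>y. B < norm y \<Longrightarrow> \<psi> y = 0"
    and R: "0 < R" and \<rho>: "0 < \<rho>" and n: "1 \<le> n" "R\<^sup>2 \<le> real n" and K: "KR R / sqrt (real n) < 1"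
  defines "A \<equiv> \<lambda>g. {y \<in> space Y. norm (t y - \<rho> *\<^sub>R g) \<le> b}"
    and "\<pi> \<equiv> uniform_measure lborel (cball (0::'b) R)"
  shows "(\<integral>g. tilt n g (\<lambda>x. measure (\<Lambda> x) (A g)) \<partial>\<pi>) \<le> (\<integral>g. 1 - tilt n g (\<lambda>x. \<psi> (z n x)) \<partial>\<pi>)
     + (1 / (1 - KR R / sqrt (real n))) * (sqrt ((2 * pi) ^ DIM('b)) * measure std_gauss (cball (0::'b) (b / \<rho>))
         * (\<integral>x. \<psi> (z n x) * exp ((norm (z n x))\<^sup>2 / 2) \<partial>powM P0 n)) / measure lborel (cball (0::'b) R)" (is ?bound)
    and "(\<lambda>g. tilt n g (\<lambda>x. measure (\<Lambda> x) (A g))) \<in> borel_measurable borel"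
proof -
  interpret P: prob_space "powM P0 n" by (rule prob_space_powM[OF prob_space_axioms])
  interpret L: pair_sigma_finite "lborel :: 'b measure" "powM P0 n" ..
  have \<Lambda>s [measurable]: "\<Lambda> \<in> powM P0 n \<rightarrow>\<^sub>M subprob_algebra Y" using \<Lambda> by (rule measurable_prob_algebraD)
  have \<Lambda>x: "prob_space (\<Lambda> x)" "sets (\<Lambda> x) = sets Y" if "x \<in> space (powM P0 n)" for x
    using measurable_space[OF \<Lambda> that] by (auto simp: space_prob_algebra)
  define vol where "vol = measure lborel (cball (0::'b) R)"
  have vol: "vol > 0" "emeasure lborel (cball (0::'b) R) = ennreal vol"
    using content_cball_pos[OF R, of "0::'b"] emeasure_lborel_cball_finite[of "0::'b" R] unfolding vol_def
    by (simp, intro emeasure_eq_ennreal_measure, simp)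
  interpret \<pi>: prob_space \<pi>
    unfolding \<pi>_def by (rule prob_space_uniform_measure) (use vol in auto)
  have sets\<pi> [measurable_cong]: "sets \<pi> = sets borel" by (simp add: \<pi>_def)
  have AY [measurable]: "A g \<in> sets Y" for g unfolding A_def by measurable
  \<comment> \<open>Joint measurability in parameter and data holds because the events
    \<open>A g\<close> are sections of a single measurable set of parameters, data and
    outputs.\<close>
  have Fm [measurable]: "(\<lambda>(g, x). measure (\<Lambda> x) (A g)) \<in> borel_measurable (borel \<Otimes>\<^sub>M powM P0 n)"
  proof -
    have "(SIGMA p:space (borel \<Otimes>\<^sub>M powM P0 n). A (fst p)) =
       {q \<in> space ((borel \<Otimes>\<^sub>M powM P0 n) \<Otimes>\<^sub>M Y). norm (t (snd q) - \<rho> *\<^sub>R fst (fst q)) \<le> b}"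
      by (auto simp: A_def space_pair_measure)
    also have "\<dots> \<in> sets ((borel \<Otimes>\<^sub>M powM P0 n) \<Otimes>\<^sub>M Y)" by measurable
    finally have "(\<lambda>p. measure (\<Lambda> (snd p)) (A (fst p))) \<in> borel_measurable (borel \<Otimes>\<^sub>M powM P0 n)"
      by (rule measure_measurable_subprob_algebra2) measurable
    then show ?thesis by (simp add: case_prod_beta')
  qed
  have Fm' [measurable]: "(\<lambda>x. measure (\<Lambda> x) (A g)) \<in> borel_measurable (powM P0 n)" for g by measurable
  have F01: "0 \<le> measure (\<Lambda> x) (A g)" "measure (\<Lambda> x) (A g) \<le> 1" if "x \<in> space (powM P0 n)" for x g
    using \<Lambda>x[OF that] by (auto intro: prob_space.prob_le_1)
  show tm: "(\<lambda>g. tilt n g (\<lambda>x. measure (\<Lambda> x) (A g))) \<in> borel_measurable borel"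
    by (rule tilt_measurable) measurable
  show ?bound
  proof -
    let ?F = "\<lambda>g x. measure (\<Lambda> x) (A g)" and ?c = "sqrt ((2 * pi) ^ DIM('b))"
      and ?G = "measure std_gauss (cball (0::'b) (b / \<rho>))" and ?\<kappa> = "1 / (1 - KR R / sqrt (real n))"
      and ?l = "\<lambda>g x. exp (g \<bullet> z n x - (norm g)\<^sup>2 / 2) * \<psi> (z n x)"
      and ?I = "\<integral>x. \<psi> (z n x) * exp ((norm (z n x))\<^sup>2 / 2) \<partial>powM P0 n" and ?P = "powM P0 n"
    let ?k = "\<lambda>g x. ennreal (?l g x) * emeasure (\<Lambda> x) (A g)"
    define Y1 where "Y1 g = tilt n g (\<lambda>x. \<psi> (z n x) * ?F g x)" for g
    have psiF: "0 \<le> \<psi> (z n x) * ?F g x" "\<psi> (z n x) * ?F g x \<le> 1" if "x \<in> space ?P" for x g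
      using F01[OF that] \<psi>01 by (auto intro: mult_le_one)
    have Y1m [measurable]: "Y1 \<in> borel_measurable borel"
      unfolding Y1_def by (rule tilt_measurable) measurable
    have Y1b: "0 \<le> Y1 g" "Y1 g \<le> 1" for g
      unfolding Y1_def by (intro tilt_bounds psiF; measurable)+
    have X1m [measurable]: "(\<lambda>g. tilt n g (\<lambda>x. \<psi> (z n x))) \<in> borel_measurable borel"
      by (rule tilt_measurable) measurable
    have X1b: "0 \<le> tilt n g (\<lambda>x. \<psi> (z n x))" "tilt n g (\<lambda>x. \<psi> (z n x)) \<le> 1" for g
      by (intro tilt_bounds \<psi>01; measurable)+
    have split: "tilt n g (?F g) \<le> (1 - tilt n g (\<lambda>x. \<psi> (z n x))) + Y1 g" for g
    proof -
      have "tilt n g (\<lambda>x. \<psi> (z n x)) + tilt n g (\<lambda>x. 1 - \<psi> (z n x)) = tilt n g (\<lambda>x. \<psi> (z n x) + (1 - \<psi> (z n x)))"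
        using \<psi>01 by (intro tilt_add[symmetric]) auto
      then have a: "tilt n g (\<lambda>x. 1 - \<psi> (z n x)) = 1 - tilt n g (\<lambda>x. \<psi> (z n x))" by (simp add: tilt_one)
      have b: "tilt n g (\<lambda>x. \<psi> (z n x) * ?F g x + (1 - \<psi> (z n x))) = Y1 g + tilt n g (\<lambda>x. 1 - \<psi> (z n x))"
        unfolding Y1_def using \<psi>01 psiF by (intro tilt_add) auto
      have le: "\<psi> (z n x) * ?F g x \<le> \<psi> (z n x)" if "x \<in> space ?P" for x
        using F01[OF that] \<psi>01 by (intro mult_left_le) auto
      have le': "?F g x \<le> \<psi> (z n x) * ?F g x + (1 - \<psi> (z n x))" if "x \<in> space ?P" for x
      proof -
        have "0 \<le> (1 - \<psi> (z n x)) * (1 - ?F g x)" using F01[OF that] \<psi>01 by (intro mult_nonneg_nonneg) auto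
        then show ?thesis by (simp add: algebra_simps)
      qed
      have r01: "0 \<le> \<psi> (z n x) * ?F g x + (1 - \<psi> (z n x))" "\<psi> (z n x) * ?F g x + (1 - \<psi> (z n x)) \<le> 1"
        if "x \<in> space ?P" for x
        using psiF(1)[OF that, of g] \<psi>01(2)[of "z n x"] le[OF that] by linarith+
      have "tilt n g (?F g) \<le> tilt n g (\<lambda>x. \<psi> (z n x) * ?F g x + (1 - \<psi> (z n x)))"
        by (rule tilt_mono[OF Fm' F01 _ r01 le']) measurable
      then show ?thesis using a b by simp
    qed
    have \<kappa>: "0 < ?\<kappa>" using K by simp
    have Y1_le: "ennreal (Y1 g) \<le> ennreal ?\<kappa> *
        (\<integral>\<^sup>+x. ?k g x \<partial>?P)"
      if g: "g \<in> cball 0 R" for g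
    proof -
      let ?T = "\<integral>x. exp (g \<bullet> z n x) * (\<psi> (z n x) * ?F g x) \<partial>?P"
      let ?Mn = "M ((1 / sqrt (real n)) *\<^sub>R g) ^ n"
      \<comment> \<open>The additive error of \<open>M_power\<close> becomes a relative one, using
        that exp(|g|^2/2) is at least 1.\<close>
      have Mn: "exp ((norm g)\<^sup>2 / 2) \<le> ?\<kappa> * ?Mn"
      proof -
        have "exp ((norm g)\<^sup>2 / 2) - KR R / sqrt (real n) \<le> ?Mn"
          using M_power[of g R n] g n by (simp add: abs_le_iff)
        moreover have "KR R / sqrt (real n) * 1 \<le> KR R / sqrt (real n) * exp ((norm g)\<^sup>2 / 2)"
          using KR_nonneg[of R] R by (intro mult_left_mono) auto
        ultimately have "exp ((norm g)\<^sup>2 / 2) * (1 - KR R / sqrt (real n)) \<le> ?Mn" by (simp add: algebra_simps)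
        then show ?thesis using K by (simp add: pos_le_divide_eq)
      qed
      have Mn0: "0 < ?Mn" using M_pos by simp
      have ee: "(\<lambda>x. exp (- (norm g)\<^sup>2 / 2) * (exp (g \<bullet> z n x) * (\<psi> (z n x) * ?F g x))) =
          (\<lambda>x. ?l g x * ?F g x)"
      proof
        fix x
        have "exp (g \<bullet> z n x - (norm g)\<^sup>2 / 2) = exp (- (norm g)\<^sup>2 / 2) * exp (g \<bullet> z n x)"
          by (simp add: mult_exp_exp)
        then show "exp (- (norm g)\<^sup>2 / 2) * (exp (g \<bullet> z n x) * (\<psi> (z n x) * ?F g x)) =
          ?l g x * ?F g x" by (simp only: mult.assoc)
      qed
      have int: "integrable (?P) (\<lambda>x. exp (g \<bullet> z n x) * (\<psi> (z n x) * ?F g x))"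
        by (rule tilt_integrable) (use psiF in auto)
      have "Y1 g \<le> ?\<kappa> * exp (- (norm g)\<^sup>2 / 2) * ?T"
      proof -
        have i0: "0 \<le> ?T"
          using psiF by (intro integral_nonneg_AE AE_I2) auto
        have "1 / ?Mn \<le> ?\<kappa> * exp (- (norm g)\<^sup>2 / 2)"
        proof -
          have "1 / m \<le> k * inverse e" if "e \<le> k * m" "0 < m" "0 < e" for e k m :: real
            using that by (auto simp: field_simps)
          from this[OF Mn Mn0] have "1 / ?Mn \<le> ?\<kappa> * inverse (exp ((norm g)\<^sup>2 / 2))" by simp
          then show ?thesis by (simp add: exp_minus[symmetric])
        qed
        then show ?thesis unfolding Y1_def tilt_def using mult_right_mono[OF _ i0] by fastforce
      qed
      also have "\<dots> = ?\<kappa> * (\<integral>x. exp (- (norm g)\<^sup>2 / 2) * (exp (g \<bullet> z n x) * (\<psi> (z n x) * ?F g x)) \<partial>?P)"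
        by (simp only: integral_mult_right_zero mult.assoc)
      also have "(\<lambda>x. exp (- (norm g)\<^sup>2 / 2) * (exp (g \<bullet> z n x) * (\<psi> (z n x) * ?F g x))) =
          (\<lambda>x. ?l g x * ?F g x)"
        by (rule ee)
      finally have "ennreal (Y1 g) \<le> ennreal ?\<kappa> * ennreal (\<integral>x. ?l g x * ?F g x \<partial>?P)"
        using \<kappa> by (subst ennreal_mult'[symmetric]) (auto intro: ennreal_leI)
      also have "ennreal (\<integral>x. ?l g x * ?F g x \<partial>?P)
         = (\<integral>\<^sup>+x. ennreal (?l g x * ?F g x) \<partial>?P)"
      proof (rule nn_integral_eq_integral[symmetric])
        have "integrable (?P) (\<lambda>x. exp (- (norm g)\<^sup>2 / 2) * (exp (g \<bullet> z n x) * (\<psi> (z n x) * ?F g x)))"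
          by (rule integrable_mult_right[OF int])
        also have "(\<lambda>x. exp (- (norm g)\<^sup>2 / 2) * (exp (g \<bullet> z n x) * (\<psi> (z n x) * ?F g x))) =
          (\<lambda>x. ?l g x * ?F g x)"
          by (rule ee)
        finally show "integrable (?P) (\<lambda>x. ?l g x * ?F g x)" .
      qed (use \<psi>01 in auto)
      also have "\<dots> = (\<integral>\<^sup>+x. ?k g x \<partial>?P)"
      proof (rule nn_integral_cong)
        fix x assume x: "x \<in> space ?P"
        interpret Lx: prob_space "\<Lambda> x" by (rule \<Lambda>x(1)[OF x])
        show "ennreal (?l g x * ?F g x) =
           ?k g x"
          using \<psi>01 by (simp add: Lx.emeasure_eq_measure ennreal_mult')
      qed
      finally show ?thesis .
    qed
    have em [measurable]: "(\<lambda>(g, x). emeasure (\<Lambda> x) (A g)) \<in> borel_measurable (borel \<Otimes>\<^sub>M ?P)"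
    proof -
      have "(\<lambda>(g, x). ennreal (?F g x)) \<in> borel_measurable (borel \<Otimes>\<^sub>M ?P)" by measurable
      also have "?this \<longleftrightarrow> ?thesis"
      proof (rule measurable_cong)
        fix p :: "'b \<times> (nat \<Rightarrow> 'a)" assume "p \<in> space (borel \<Otimes>\<^sub>M ?P)"
        then obtain g x where p: "p = (g, x)" and x: "x \<in> space ?P" by (auto simp: space_pair_measure)
        interpret Lx: prob_space "\<Lambda> x" by (rule \<Lambda>x(1)[OF x])
        show "(\<lambda>(g, x). ennreal (?F g x)) p = (\<lambda>(g, x). emeasure (\<Lambda> x) (A g)) p"
          by (simp add: p Lx.emeasure_eq_measure)
      qed
      finally show ?thesis .
    qed
    \<comment> \<open>On the support of \<open>\<psi>\<close> the exponent is at most B^2/2; here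
      the truncation does its work.\<close>
    have psi_e: "integrable (?P) (\<lambda>x. \<psi> (z n x) * exp ((norm (z n x))\<^sup>2 / 2))"
    proof (rule P.integrable_const_bound[where B="exp (B\<^sup>2 / 2)"])
      have "\<psi> y * exp ((norm y)\<^sup>2 / 2) \<le> exp (B\<^sup>2 / 2)" for y
      proof (cases "B < norm y")
        case False
        then have "(norm y)\<^sup>2 \<le> B\<^sup>2" by (intro power_mono) auto
        then have "exp ((norm y)\<^sup>2 / 2) \<le> exp (B\<^sup>2 / 2)" by simp
        then show ?thesis using \<psi>01 mult_mono[of "\<psi> y" 1 "exp ((norm y)\<^sup>2 / 2)" "exp (B\<^sup>2 / 2)"] by simp
      qed (simp add: supp)
      then show "AE x in ?P. norm (\<psi> (z n x) * exp ((norm (z n x))\<^sup>2 / 2)) \<le> exp (B\<^sup>2 / 2)"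
        using \<psi>01 by (intro AE_I2) (simp add: abs_mult)
    qed measurable
    \<comment> \<open>Parameter and data are exchanged, and then, for fixed data, parameter and
      output of the kernel. The innermost integral is the unnormalised posterior mass of a ball
      about t y / \<open>\<rho>\<close>.\<close>
    have swapped: "(\<integral>\<^sup>+g. (\<integral>\<^sup>+x. ?k g x \<partial>?P) \<partial>lborel)
        \<le> ennreal (?c * ?G * ?I)"
    proof -
      have "(\<integral>\<^sup>+g. (\<integral>\<^sup>+x. ?k g x \<partial>?P) \<partial>lborel)
         = (\<integral>\<^sup>+x. (\<integral>\<^sup>+g. ?k g x \<partial>lborel) \<partial>?P)"
        by (rule L.Fubini'[symmetric]) measurable
      also have "\<dots> \<le> (\<integral>\<^sup>+x. ennreal (?c * ?G * (\<psi> (z n x) * exp ((norm (z n x))\<^sup>2 / 2))) \<partial>?P)"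
      proof (rule nn_integral_mono)
        fix x assume x: "x \<in> space ?P"
        interpret Lx: prob_space "\<Lambda> x" by (rule \<Lambda>x(1)[OF x])
        have sL [measurable_cong]: "sets (\<Lambda> x) = sets Y" by (rule \<Lambda>x(2)[OF x])
        have spL: "space (\<Lambda> x) = space Y" using sL by (rule sets_eq_imp_space_eq)
        interpret LL: pair_sigma_finite "lborel :: 'b measure" "\<Lambda> x" ..
        let ?e = "\<lambda>g. ennreal (exp (g \<bullet> z n x - (norm g)\<^sup>2 / 2))"
        let ?J = "\<integral>\<^sup>+g. (\<integral>\<^sup>+y. ?e g * indicator {g. norm (t y - \<rho> *\<^sub>R g) \<le> b} g \<partial>\<Lambda> x) \<partial>lborel"
        have hm [measurable]: "(\<lambda>(g, y). ?e g * indicator {g. norm (t y - \<rho> *\<^sub>R g) \<le> b} g) \<in> borel_measurable (lborel \<Otimes>\<^sub>M \<Lambda> x)"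
        proof -
          define zz where "zz = z n x"
          have se: "sets (lborel \<Otimes>\<^sub>M \<Lambda> x) = sets (borel \<Otimes>\<^sub>M Y)"
            by (intro sets_pair_measure_cong sL) simp
          let ?S = "{p \<in> space (borel \<Otimes>\<^sub>M Y). norm (t (snd p) - \<rho> *\<^sub>R fst p) \<le> b}"
          have "(\<lambda>p::'b \<times> 'y. ennreal (exp (fst p \<bullet> zz - (norm (fst p))\<^sup>2 / 2)) * indicator ?S p) \<in> borel_measurable (borel \<Otimes>\<^sub>M Y)"
            by measurable
          also have "?this \<longleftrightarrow> (\<lambda>(g, y). ?e g * indicator {g. norm (t y - \<rho> *\<^sub>R g) \<le> b} g) \<in> borel_measurable (borel \<Otimes>\<^sub>M Y)"
            by (rule measurable_cong) (auto simp: zz_def indicator_def split: prod.splits)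
          finally show ?thesis by (simp only: measurable_cong_sets[OF se refl])
        qed
        have "(\<integral>\<^sup>+g. ?k g x \<partial>lborel)
           = (\<integral>\<^sup>+g. ennreal (\<psi> (z n x)) * (\<integral>\<^sup>+y. ?e g * indicator {g. norm (t y - \<rho> *\<^sub>R g) \<le> b} g \<partial>\<Lambda> x) \<partial>lborel)"
        proof (rule nn_integral_cong)
          fix g :: 'b
          have "(\<integral>\<^sup>+y. ?e g * indicator {g. norm (t y - \<rho> *\<^sub>R g) \<le> b} g \<partial>\<Lambda> x) = (\<integral>\<^sup>+y. ?e g * indicator (A g) y \<partial>\<Lambda> x)"
            by (intro nn_integral_cong) (auto simp: indicator_def A_def spL)
          also have "\<dots> = ?e g * emeasure (\<Lambda> x) (A g)"
            by (rule nn_integral_cmult_indicator) (simp add: sL)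
          finally show "?k g x =
             ennreal (\<psi> (z n x)) * (\<integral>\<^sup>+y. ?e g * indicator {g. norm (t y - \<rho> *\<^sub>R g) \<le> b} g \<partial>\<Lambda> x)"
            using \<psi>01 by (simp add: ennreal_mult' mult_ac)
        qed
        also have "\<dots> = ennreal (\<psi> (z n x)) * ?J"
          by (rule nn_integral_cmult) measurable
        finally have eq1: "(\<integral>\<^sup>+g. ?k g x \<partial>lborel)
           = ennreal (\<psi> (z n x)) * ?J" .
        have "?J
            = (\<integral>\<^sup>+y. (\<integral>\<^sup>+g. ?e g * indicator {g. norm (t y - \<rho> *\<^sub>R g) \<le> b} g \<partial>lborel) \<partial>\<Lambda> x)"
          by (rule LL.Fubini'[symmetric, OF hm])
        also have "\<dots> \<le> (\<integral>\<^sup>+y. ennreal (exp ((norm (z n x))\<^sup>2 / 2) * ?c * ?G) \<partial>\<Lambda> x)"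
          by (intro nn_integral_mono posterior_ball_le \<rho>)
        also have "\<dots> = ennreal (exp ((norm (z n x))\<^sup>2 / 2) * ?c * ?G)" by (simp add: Lx.emeasure_space_1)
        finally have "ennreal (\<psi> (z n x)) * ?J
            \<le> ennreal (\<psi> (z n x)) * ennreal (exp ((norm (z n x))\<^sup>2 / 2) * ?c * ?G)"
          by (rule mult_left_mono) simp
        also have "\<dots> = ennreal (?c * ?G * (\<psi> (z n x) * exp ((norm (z n x))\<^sup>2 / 2)))"
          using \<psi>01 by (simp add: ennreal_mult'[symmetric] mult_ac)
        finally show "(\<integral>\<^sup>+g. ?k g x \<partial>lborel)
          \<le> ennreal (?c * ?G * (\<psi> (z n x) * exp ((norm (z n x))\<^sup>2 / 2)))"
          unfolding eq1 .
      qed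
      also have "\<dots> = ennreal (\<integral>x. ?c * ?G * (\<psi> (z n x) * exp ((norm (z n x))\<^sup>2 / 2)) \<partial>?P)"
        using psi_e \<psi>01 by (intro nn_integral_eq_integral integrable_mult_right) auto
      finally show ?thesis by (simp only: integral_mult_right_zero)
    qed
    have I0: "0 \<le> ?I"
      using \<psi>01 by simp
    have Y1i: "integrable \<pi> Y1"
      by (rule \<pi>.integrable_const_bound[where B=1]) (use Y1b in auto)
    have "ennreal (\<integral>g. Y1 g \<partial>\<pi>) = (\<integral>\<^sup>+g. ennreal (Y1 g) \<partial>\<pi>)"
      using Y1i Y1b by (intro nn_integral_eq_integral[symmetric]) auto
    also have "\<dots> = (\<integral>\<^sup>+g. ennreal (Y1 g) * indicator (cball 0 R) g \<partial>lborel) / ennreal vol"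
      unfolding \<pi>_def by (subst nn_integral_uniform_measure) (simp_all add: vol)
    \<comment> \<open>The restriction to the prior ball is dropped by nonnegativity, because the
      comparison with the centred ball concerns integrals over the whole space.\<close>
    also have "\<dots> \<le> (\<integral>\<^sup>+g. ennreal ?\<kappa> * (\<integral>\<^sup>+x. ?k g x \<partial>?P) \<partial>lborel) / ennreal vol"
      using Y1_le by (intro divide_right_mono_ennreal nn_integral_mono) (auto simp: indicator_def)
    also have "\<dots> \<le> ennreal ?\<kappa> * ennreal (?c * ?G * ?I) / ennreal vol"
    proof -
      have "(\<integral>\<^sup>+g. ennreal ?\<kappa> * (\<integral>\<^sup>+x. ?k g x \<partial>?P) \<partial>lborel)
         = ennreal ?\<kappa> * (\<integral>\<^sup>+g. (\<integral>\<^sup>+x. ?k g x \<partial>?P) \<partial>lborel)"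
        by (rule nn_integral_cmult) measurable
      then show ?thesis using swapped by (intro divide_right_mono_ennreal) (simp add: mult_left_mono)
    qed
    also have "\<dots> = ennreal (?\<kappa> * (?c * ?G * ?I) / vol)"
      using \<kappa> vol I0 by (subst ennreal_mult'[symmetric]) (simp_all add: divide_ennreal)
    finally have Y1_int: "(\<integral>g. Y1 g \<partial>\<pi>) \<le> ?\<kappa> * (?c * ?G * ?I) / vol"
      using \<kappa> vol I0 by (subst (asm) ennreal_le_iff) (auto intro!: divide_nonneg_pos mult_nonneg_nonneg)
    have X1i: "integrable \<pi> (\<lambda>g. 1 - tilt n g (\<lambda>x. \<psi> (z n x)))"
      by (rule \<pi>.integrable_const_bound[where B=1]) (use X1b in auto)
    have Ti: "integrable \<pi> (\<lambda>g. tilt n g (?F g))"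
    proof (rule \<pi>.integrable_const_bound[where B=1])
      show "AE g in \<pi>. norm (tilt n g (?F g)) \<le> 1"
        using tilt_bounds[OF Fm' F01] by (intro AE_I2) simp
    qed (use tm in measurable)
    have "(\<integral>g. tilt n g (?F g) \<partial>\<pi>) \<le> (\<integral>g. (1 - tilt n g (\<lambda>x. \<psi> (z n x))) + Y1 g \<partial>\<pi>)"
      using Ti X1i Y1i split by (intro integral_mono) auto
    also have "\<dots> = (\<integral>g. 1 - tilt n g (\<lambda>x. \<psi> (z n x)) \<partial>\<pi>) + (\<integral>g. Y1 g \<partial>\<pi>)"
      by (rule Bochner_Integration.integral_add[OF X1i Y1i])
    finally show ?thesis using Y1_int unfolding vol_def by linarith
  qed
qed

end

context exp_family
begin

text \<open>\<open>t0\<close> is any common bound for the advantage of the test, and the kernel is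
  quantified inside the eventuality, so one threshold in \<open>n\<close> serves all kernels. In the
  conclusion the volume ratio compares the truncation radius R + 2 T with the prior radius R, the
  tail beyond \<open>T\<close> is the truncation loss, and \<open>\<epsilon>\<close> pays for the
  limits. The step from \<open>\<delta>\<close> to \<open>2 * \<delta>\<close> leaves room for the
  difference between \<open>\<rho> n\<close> and its limit \<open>q\<close>.\<close>

lemma eventually_gap:
  fixes N :: "nat \<Rightarrow> nat" and \<rho> :: "nat \<Rightarrow> real"
  assumes N: "filterlim N at_top sequentially" and \<rho>: "\<rho> \<longlonglongrightarrow> q" and q: "0 < q"
    and c: "0 \<le> c" and \<delta>: "0 < \<delta>" and R: "0 < R" and T: "0 < T" and \<epsilon>: "0 < \<epsilon>"
  defines "A \<equiv> \<lambda>n g. {y \<in> space (powM P0 (N n)). norm (z (N n) y - \<rho> n *\<^sub>R g) \<le> c + \<delta>}"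
  shows "\<forall>\<^sub>F n in sequentially. \<forall>\<Lambda> \<in> powM P0 n \<rightarrow>\<^sub>M prob_algebra (powM P0 (N n)). \<forall>t0.
      (\<forall>g\<in>cball 0 R. tilt (N n) (\<rho> n *\<^sub>R g) (indicator (A n g)) - tilt n g (\<lambda>x. measure (\<Lambda> x) (A n g)) \<le> t0) \<longrightarrow>
      measure std_gauss (cball (0::'b) c) - measure std_gauss (cball (0::'b) ((c + 2 * \<delta>) / q)) * ((R + 2 * T) / R) ^ DIM('b)
        - measure std_gauss {y::'b. T < norm y} - \<epsilon> \<le> t0"
proof -
  \<comment> \<open>\<open>f\<close> is 1 on the ball of radius \<open>c\<close> and lies below the
    indicator of radius \<open>c + \<delta>\<close>, the radius of the event. The truncation
    \<open>\<psi>\<close> is 1 up to R + T, because a parameter of norm at most \<open>R\<close>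
    plus Gaussian noise of norm at most \<open>T\<close> stays within that radius.\<close>
  define f :: "'b \<Rightarrow> real" where "f = cutoff c (c + \<delta>)"
  define \<psi> :: "'b \<Rightarrow> real" where "\<psi> = cutoff (R + T) (R + 2 * T)"
  define \<pi> where "\<pi> = uniform_measure lborel (cball (0::'b) R)"
  define vol where "vol r = measure lborel (cball (0::'b) r)" for r
  define G where "G = measure std_gauss (cball (0::'b) ((c + 2 * \<delta>) / q))"
  let ?c = "sqrt ((2 * pi) ^ DIM('b))"
  have fc: "continuous_on UNIV f" unfolding f_def using \<delta> by (intro continuous_on_cutoff) simp
  have psic: "continuous_on UNIV \<psi>" unfolding \<psi>_def using T by (intro continuous_on_cutoff) simp
  have [measurable]: "f \<in> borel_measurable borel" "\<psi> \<in> borel_measurable borel"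
    using fc psic by (auto intro: borel_measurable_continuous_onI)
  have f01: "0 \<le> f y" "f y \<le> 1" and psi01: "0 \<le> \<psi> y" "\<psi> y \<le> 1" for y
    unfolding f_def \<psi>_def by (auto intro: cutoff_bounds)
  have f0: "f y = 0" if "c + \<delta> < norm y" for y using that \<delta> unfolding f_def by (intro cutoff_eq_0) auto
  have psi0: "\<psi> y = 0" if "R + 2 * T < norm y" for y using that T unfolding \<psi>_def by (intro cutoff_eq_0) auto
  have psi1: "\<psi> y = 1" if "norm y \<le> R + T" for y using that T unfolding \<psi>_def by (intro cutoff_eq_1) auto
  have f1: "f y = 1" if "norm y \<le> c" for y using that \<delta> unfolding f_def by (intro cutoff_eq_1) auto
  have vol_eq: "vol r = unit_ball_vol (real DIM('b)) * r ^ DIM('b)" if "0 \<le> r" for r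
    unfolding vol_def using content_cball[OF that, of "0::'b"] by simp
  have vol_pos: "0 < vol r" if "0 < r" for r unfolding vol_def using content_cball_pos[OF that, of "0::'b"] by simp
  have emvol: "emeasure lborel (cball (0::'b) r) = ennreal (vol r)" for r
    using emeasure_lborel_cball_finite[of "0::'b" r] unfolding vol_def by (intro emeasure_eq_ennreal_measure) simp
  interpret \<pi>: prob_space \<pi>
    unfolding \<pi>_def using vol_pos[OF R] by (intro prob_space_uniform_measure) (simp_all add: emvol)
  have sets\<pi> [measurable_cong]: "sets \<pi> = sets borel" by (simp add: \<pi>_def)
  have AE\<pi>: "AE g in \<pi>. g \<in> cball 0 R" unfolding \<pi>_def by (rule AE_uniform_measureI) auto
  define T' where "T' n g = tilt (N n) (\<rho> n *\<^sub>R g) (\<lambda>x. f (z (N n) x - \<rho> n *\<^sub>R g))" for n g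
  have T'm [measurable]: "T' n \<in> borel_measurable borel" for n
  proof -
    have [measurable]: "(\<lambda>u. tilt (N n) u (\<lambda>x. f (z (N n) x - u))) \<in> borel_measurable borel"
      by (rule tilt_measurable) measurable
    show ?thesis unfolding T'_def by measurable
  qed
  have T'b: "0 \<le> T' n g" "T' n g \<le> 1" for n g
    unfolding T'_def by (intro tilt_bounds f01; measurable)+
  define X where "X n g = 1 - tilt n g (\<lambda>x. \<psi> (z n x))" for n g
  have Xm [measurable]: "X n \<in> borel_measurable borel" for n
  proof -
    have [measurable]: "(\<lambda>g. tilt n g (\<lambda>x. \<psi> (z n x))) \<in> borel_measurable borel"
      by (rule tilt_measurable) measurable
    show ?thesis unfolding X_def by measurable
  qed
  have Xb: "0 \<le> X n g" "X n g \<le> 1" for n g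
    unfolding X_def using tilt_bounds[of "\<lambda>x. \<psi> (z n x)" n g] psi01 by auto
  have a_lim: "(\<lambda>n. \<integral>g. T' n g \<partial>\<pi>) \<longlonglongrightarrow> (\<integral>g. (\<integral>y. f y \<partial>std_gauss) \<partial>\<pi>)"
  proof (rule integral_dominated_convergence[where w="\<lambda>_. 1"])
    show "AE g in \<pi>. (\<lambda>n. T' n g) \<longlonglongrightarrow> (\<integral>y. f y \<partial>std_gauss)"
      unfolding T'_def by (rule AE_I2, rule tendsto_tilt[OF fc f0 N tendsto_scaleR[OF \<rho> tendsto_const]])
    show "AE g in \<pi>. norm (T' n g) \<le> 1" for n using T'b by simp
  qed auto
  \<comment> \<open>Under the tilt by \<open>g\<close>, z_n behaves like y + g with y standard
    Gaussian; this is the limiting truncation loss averaged over the prior.\<close>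
  define b_lim_val where "b_lim_val = (\<integral>g. 1 - (\<integral>y. \<psi> (y + g) \<partial>std_gauss) \<partial>\<pi>)"
  have b_lim: "(\<lambda>n. \<integral>g. X n g \<partial>\<pi>) \<longlonglongrightarrow> b_lim_val"
    unfolding b_lim_val_def
  proof (rule integral_dominated_convergence[where w="\<lambda>_. 1"])
    show "AE g in \<pi>. (\<lambda>n. X n g) \<longlonglongrightarrow> 1 - (\<integral>y. \<psi> (y + g) \<partial>std_gauss)"
    proof (rule AE_I2)
      fix g
      have "(\<lambda>n. tilt n g (\<lambda>x. \<psi> ((z n x - g) + g))) \<longlonglongrightarrow> (\<integral>y. \<psi> (y + g) \<partial>std_gauss)"
      proof (rule tendsto_tilt[where B="R + 2 * T + norm g" and f="\<lambda>y. \<psi> (y + g)" and N="\<lambda>n. n" and u="\<lambda>_. g" and ?u0.0=g])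
        show "continuous_on UNIV (\<lambda>y. \<psi> (y + g))"
          by (intro continuous_on_compose2[OF psic] continuous_intros) auto
        show "\<psi> (y + g) = 0" if "R + 2 * T + norm g < norm y" for y
        proof (rule psi0)
          have "norm y \<le> norm (y + g) + norm g" using norm_triangle_ineq4[of "y + g" g] by simp
          then show "R + 2 * T < norm (y + g)" using that by simp
        qed
      qed (simp_all add: filterlim_ident)
      then show "(\<lambda>n. X n g) \<longlonglongrightarrow> 1 - (\<integral>y. \<psi> (y + g) \<partial>std_gauss)"
        unfolding X_def by (intro tendsto_diff tendsto_const) simp
    qed
    show "AE g in \<pi>. norm (X n g) \<le> 1" for n using Xb by simp
  qed (auto)
  have b_lim_val_le: "b_lim_val \<le> measure std_gauss {y::'b. T < norm y}"
  proof -
    have i: "integrable std_gauss (\<lambda>y. \<psi> (y + g))" for g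
      by (rule std_gauss.integrable_const_bound[where B=1]) (use psi01 in auto)
    have pt: "1 - (\<integral>y. \<psi> (y + g) \<partial>std_gauss) \<le> measure std_gauss {y::'b. T < norm y}" if g: "g \<in> cball 0 R" for g
    proof -
      have "1 - (\<integral>y. \<psi> (y + g) \<partial>std_gauss) = (\<integral>y. 1 - \<psi> (y + g) \<partial>std_gauss)" using i by simp
      also have "\<dots> \<le> (\<integral>y. indicator {y::'b. T < norm y} y \<partial>std_gauss)"
      proof (rule integral_mono)
        fix y :: 'b
        show "1 - \<psi> (y + g) \<le> indicator {y. T < norm y} y"
          using psi1[of "y + g"] psi01[of "y + g"] norm_triangle_ineq[of y g] g by (auto simp: indicator_def)
      qed (use i in \<open>auto simp: std_gauss.emeasure_eq_measure\<close>)
      finally show ?thesis by simp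
    qed
    have psi_int01: "0 \<le> (\<integral>y. \<psi> (y + g) \<partial>std_gauss)" "(\<integral>y. \<psi> (y + g) \<partial>std_gauss) \<le> 1" for g
    proof -
      show "0 \<le> (\<integral>y. \<psi> (y + g) \<partial>std_gauss)" using psi01 by simp
      have "(\<integral>y. \<psi> (y + g) \<partial>std_gauss) \<le> (\<integral>y. 1 \<partial>(std_gauss :: 'b measure))"
        using i psi01 by (intro integral_mono) auto
      then show "(\<integral>y. \<psi> (y + g) \<partial>std_gauss) \<le> 1" by simp
    qed
    have "b_lim_val \<le> (\<integral>g. measure std_gauss {y::'b. T < norm y} \<partial>\<pi>)"
      unfolding b_lim_val_def
    proof (rule integral_mono_AE)
      show "integrable \<pi> (\<lambda>g. 1 - (\<integral>y. \<psi> (y + g) \<partial>std_gauss))"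
        by (rule \<pi>.integrable_const_bound[where B=1]) (use psi_int01 in auto)
      show "AE g in \<pi>. 1 - (\<integral>y. \<psi> (y + g) \<partial>std_gauss) \<le> measure std_gauss {y::'b. T < norm y}"
        using AE\<pi> by eventually_elim (rule pt)
    qed simp
    then show ?thesis by (simp add: \<pi>.prob_space)
  qed
  define k where "k y = \<psi> y * exp ((norm y)\<^sup>2 / 2)" for y
  have km: "continuous_on UNIV k" unfolding k_def by (intro continuous_intros psic) simp
  have k_lim: "(\<lambda>n. \<integral>x. k (z n x) \<partial>powM P0 n) \<longlonglongrightarrow> (\<integral>y. k y \<partial>std_gauss)"
    by (rule tendsto_integral_z[OF km, of "R + 2 * T"]) (simp add: k_def psi0)
  \<comment> \<open>The factor exp(|y|^2/2) cancels the Gaussian density up to its constant. What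
    remains is the Lebesgue integral of \<open>\<psi>\<close>, which is at most the volume of the
    truncation ball.\<close>
  have k_int: "?c * (\<integral>y. k y \<partial>std_gauss) \<le> vol (R + 2 * T)"
  proof -
    have [measurable]: "k \<in> borel_measurable borel" using km by (rule borel_measurable_continuous_onI)
    have "?c * (\<integral>y. k y \<partial>std_gauss) = (\<integral>y. ?c * (gdens y * k y) \<partial>lborel)"
      by (subst integral_std_gauss) simp_all
    also have "(\<lambda>y. ?c * (gdens y * k y)) = \<psi>"
    proof
      fix y :: 'b
      have "exp (- (norm y)\<^sup>2 / 2) * exp ((norm y)\<^sup>2 / 2) = 1" by (simp add: mult_exp_exp)
      moreover have "?c * gdens y = exp (- (norm y)\<^sup>2 / 2)" unfolding gdens_def by simp
      ultimately show "?c * (gdens y * k y) = \<psi> y"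
        unfolding k_def by (metis mult.assoc mult.commute mult.right_neutral)
    qed
    also have "(\<integral>y. \<psi> y \<partial>lborel) \<le> (\<integral>y. indicator (cball (0::'b) (R + 2 * T)) y \<partial>lborel)"
    proof (rule integral_mono)
      show i2: "integrable lborel (indicator (cball (0::'b) (R + 2 * T)) :: 'b \<Rightarrow> real)"
        by (simp add: emvol)
      have pt: "\<psi> y \<le> indicator (cball 0 (R + 2 * T)) y" for y
        using psi0[of y] psi01[of y] by (auto simp: indicator_def not_le)
      then show "\<psi> y \<le> indicator (cball 0 (R + 2 * T)) y" for y .
      show "integrable lborel \<psi>"
        by (rule Bochner_Integration.integrable_bound[OF i2]) (use pt psi01 in auto)
    qed
    also have "\<dots> = vol (R + 2 * T)" by (simp add: vol_def)
    finally show ?thesis .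
  qed
  define cn where "cn n = (1 / (1 - KR R / sqrt (real n))) * (?c * G * (\<integral>x. k (z n x) \<partial>powM P0 n)) / vol R" for n
  have cn_lim: "cn \<longlonglongrightarrow> (1 / (1 - 0)) * (?c * G * (\<integral>y. k y \<partial>std_gauss)) / vol R"
    unfolding cn_def by (intro tendsto_divide tendsto_mult tendsto_diff tendsto_const KR_lim k_lim) (use vol_pos[OF R] in auto)
  have c_lim_le: "(1 / (1 - 0)) * (?c * G * (\<integral>y. k y \<partial>std_gauss)) / vol R \<le> G * ((R + 2 * T) / R) ^ DIM('b)"
  proof -
    have "?c * G * (\<integral>y. k y \<partial>std_gauss) \<le> G * vol (R + 2 * T)"
      using mult_left_mono[OF k_int, of G] by (simp add: G_def mult_ac)
    then have "?c * G * (\<integral>y. k y \<partial>std_gauss) / vol R \<le> G * vol (R + 2 * T) / vol R"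
      using vol_pos[OF R] by (intro divide_right_mono) auto
    also have "\<dots> = G * ((R + 2 * T) / R) ^ DIM('b)"
    proof -
      have "unit_ball_vol (real DIM('b)) \<noteq> 0"
        by (rule less_imp_neq[symmetric], rule unit_ball_vol_pos) simp
      then show ?thesis using R T by (simp add: vol_eq power_divide)
    qed
    finally show ?thesis by simp
  qed
  have a_lim_ge: "measure std_gauss (cball (0::'b) c) \<le> (\<integral>g. (\<integral>y. f y \<partial>std_gauss) \<partial>\<pi>)"
  proof -
    have "(\<integral>y. indicator (cball (0::'b) c) y \<partial>std_gauss) \<le> (\<integral>y. f y \<partial>std_gauss)"
    proof (rule integral_mono)
      show "integrable std_gauss f" by (rule std_gauss.integrable_const_bound[where B=1]) (use f01 in auto)
      show "indicator (cball 0 c) y \<le> f y" for y using f1[of y] f01[of y] by (auto simp: indicator_def)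
    qed (simp add: std_gauss.emeasure_eq_measure)
    then show ?thesis by (simp add: \<pi>.prob_space)
  qed
  let ?goal = "measure std_gauss (cball (0::'b) c) - G * ((R + 2 * T) / R) ^ DIM('b) - measure std_gauss {y::'b. T < norm y} - \<epsilon>"
  have "(\<lambda>n. (\<integral>g. T' n g \<partial>\<pi>) - (\<integral>g. X n g \<partial>\<pi>) - cn n) \<longlonglongrightarrow>
      (\<integral>g. (\<integral>y. f y \<partial>std_gauss) \<partial>\<pi>) - b_lim_val - (1 / (1 - 0)) * (?c * G * (\<integral>y. k y \<partial>std_gauss)) / vol R"
    by (intro tendsto_diff a_lim b_lim cn_lim)
  moreover have "?goal < (\<integral>g. (\<integral>y. f y \<partial>std_gauss) \<partial>\<pi>) - b_lim_val - (1 / (1 - 0)) * (?c * G * (\<integral>y. k y \<partial>std_gauss)) / vol R"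
    using a_lim_ge b_lim_val_le c_lim_le \<epsilon> by linarith
  ultimately have ev1: "\<forall>\<^sub>F n in sequentially. ?goal < (\<integral>g. T' n g \<partial>\<pi>) - (\<integral>g. X n g \<partial>\<pi>) - cn n"
    by (rule order_tendstoD)
  have ev2: "\<forall>\<^sub>F n in sequentially. 1 \<le> n \<and> R\<^sup>2 \<le> real n"
    by (intro eventually_conj eventually_ge_at_top filterlim_real_sequentially[unfolded filterlim_at_top, rule_format])
  have ev3: "\<forall>\<^sub>F n in sequentially. KR R / sqrt (real n) < 1"
    by (rule order_tendstoD[OF KR_lim]) simp
  have ev4: "\<forall>\<^sub>F n in sequentially. 0 < \<rho> n" using \<rho> q by (rule order_tendstoD)
  have ev5: "\<forall>\<^sub>F n in sequentially. (c + \<delta>) / \<rho> n < (c + 2 * \<delta>) / q"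
  proof (rule order_tendstoD)
    show "(\<lambda>n. (c + \<delta>) / \<rho> n) \<longlonglongrightarrow> (c + \<delta>) / q" using q by (intro tendsto_intros \<rho>) auto
    show "(c + \<delta>) / q < (c + 2 * \<delta>) / q" using q \<delta> by (intro divide_strict_right_mono) auto
  qed
  show ?thesis using ev1 ev2 ev3 ev4 ev5
  proof eventually_elim
    case (elim n)
    show ?case
    proof (intro ballI allI impI)
      fix \<Lambda> t0
      assume \<Lambda>: "\<Lambda> \<in> powM P0 n \<rightarrow>\<^sub>M prob_algebra (powM P0 (N n))"
        and t0: "\<forall>g\<in>cball 0 R. tilt (N n) (\<rho> n *\<^sub>R g) (indicator (A n g)) - tilt n g (\<lambda>x. measure (\<Lambda> x) (A n g)) \<le> t0"
      let ?S = "\<lambda>g. tilt n g (\<lambda>x. measure (\<Lambda> x) (A n g))"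
      have A_eq: "{y \<in> space (powM P0 (N n)). norm (z (N n) y - \<rho> n *\<^sub>R g) \<le> c + \<delta>} = A n g" for g
        by (simp add: A_def)
      note pb = posterior_bound[where \<rho>="\<rho> n" and b="c + \<delta>", OF \<Lambda> z_meas \<open>\<psi> \<in> borel_measurable borel\<close> psi01 psi0 R, unfolded A_eq]
      have Sm [measurable]: "?S \<in> borel_measurable borel"
        by (rule pb(2)) (use elim in auto)
      have Am [measurable]: "A n g \<in> sets (powM P0 (N n))" for g unfolding A_def by measurable
      have Sb: "0 \<le> ?S g" "?S g \<le> 1" for g
      proof -
        have \<Lambda>x: "prob_space (\<Lambda> x)" if "x \<in> space (powM P0 n)" for x
          using measurable_space[OF \<Lambda> that] by (auto simp: space_prob_algebra)
        have [measurable]: "\<Lambda> \<in> powM P0 n \<rightarrow>\<^sub>M subprob_algebra (powM P0 (N n))" using \<Lambda> by (rule measurable_prob_algebraD)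
        have m: "(\<lambda>x. measure (\<Lambda> x) (A n g)) \<in> borel_measurable (powM P0 n)" by measurable
        show "0 \<le> ?S g" "?S g \<le> 1"
          by (rule tilt_bounds[OF m]; simp add: prob_space.prob_le_1[OF \<Lambda>x])+
      qed
      have T'_le: "T' n g \<le> tilt (N n) (\<rho> n *\<^sub>R g) (indicator (A n g))" for g
        unfolding T'_def
      proof (rule tilt_mono)
        show "f (z (N n) x - \<rho> n *\<^sub>R g) \<le> indicator (A n g) x" if "x \<in> space (powM P0 (N n))" for x
          using f01[of "z (N n) x - \<rho> n *\<^sub>R g"] f0[of "z (N n) x - \<rho> n *\<^sub>R g"] that by (auto simp: A_def indicator_def not_le)
      qed (auto simp: f01)
      have "(\<integral>g. T' n g \<partial>\<pi>) \<le> (\<integral>g. t0 + ?S g \<partial>\<pi>)"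
      proof (rule integral_mono_AE)
        show "integrable \<pi> (T' n)" by (rule \<pi>.integrable_const_bound[where B=1]) (use T'b in auto)
        have "integrable \<pi> ?S" by (rule \<pi>.integrable_const_bound[where B=1]) (use Sb in auto)
        then show "integrable \<pi> (\<lambda>g. t0 + ?S g)" by simp
        show "AE g in \<pi>. T' n g \<le> t0 + ?S g"
          using AE\<pi>
        proof eventually_elim
          case (elim g)
          then show ?case using t0[rule_format, of g] T'_le[of g] by linarith
        qed
      qed
      also have "\<dots> = t0 + (\<integral>g. ?S g \<partial>\<pi>)"
      proof -
        have "integrable \<pi> ?S" by (rule \<pi>.integrable_const_bound[where B=1]) (use Sb in auto)
        then show ?thesis by (simp add: \<pi>.prob_space)
      qed
      also have "(\<integral>g. ?S g \<partial>\<pi>) \<le> (\<integral>g. X n g \<partial>\<pi>) + (1 / (1 - KR R / sqrt (real n))) * (?c * measure std_gauss (cball (0::'b) ((c + \<delta>) / \<rho> n))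
         * (\<integral>x. k (z n x) \<partial>powM P0 n)) / vol R"
        using pb(1) elim unfolding X_def k_def vol_def \<pi>_def by simp
      also have "(1 / (1 - KR R / sqrt (real n))) * (?c * measure std_gauss (cball (0::'b) ((c + \<delta>) / \<rho> n))
         * (\<integral>x. k (z n x) \<partial>powM P0 n)) / vol R \<le> cn n"
      proof -
        have "measure std_gauss (cball (0::'b) ((c + \<delta>) / \<rho> n)) \<le> G"
          unfolding G_def using elim by (intro std_gauss.finite_measure_mono) auto
        moreover have "0 \<le> (\<integral>x. k (z n x) \<partial>powM P0 n)" using psi01 by (simp add: k_def)
        ultimately show ?thesis unfolding cn_def using elim vol_pos[OF R]
          by (intro divide_right_mono mult_left_mono mult_right_mono) auto
      qed
      finally show "measure std_gauss (cball (0::'b) c) - measure std_gauss (cball (0::'b) ((c + 2 * \<delta>) / q)) * ((R + 2 * T) / R) ^ DIM('b)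
        - measure std_gauss {y::'b. T < norm y} - \<epsilon> \<le> t0"
        using elim(1) unfolding G_def by simp
    qed
  qed
qed

end

section \<open>Consequences of differentiability in quadratic mean\<close>

text \<open>Both square roots are unit vectors, so the derivative of \<open>t \<mapsto> \<surd>p\<^sub>t\<close> in \<open>L\<^sup>2\<close> is orthogonal to \<open>\<surd>p\<^sub>0\<close>.\<close>

lemma DQM_mean_zero:
  fixes \<mu> :: "'a measure" and p0 d :: "'a \<Rightarrow> real" and pt :: "real \<Rightarrow> 'a \<Rightarrow> real"
  assumes p0 [measurable]: "p0 \<in> borel_measurable \<mu>" "\<And>x. 0 \<le> p0 x" and P0: "prob_space (density \<mu> (\<lambda>x. ennreal (p0 x)))"
    and d [measurable]: "d \<in> borel_measurable \<mu>" and d2: "integrable \<mu> (\<lambda>x. (d x)\<^sup>2 * p0 x)"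
    and pt: "\<forall>\<^sub>F t in at_right 0. pt t \<in> borel_measurable \<mu> \<and> (\<forall>x. 0 \<le> pt t x) \<and> prob_space (density \<mu> (\<lambda>x. ennreal (pt t x)))"
    and DQM: "\<And>\<epsilon>. 0 < \<epsilon> \<Longrightarrow> \<forall>\<^sub>F t in at_right 0.
       (\<integral>\<^sup>+x. ennreal ((sqrt (pt t x) - sqrt (p0 x) - t / 2 * d x * sqrt (p0 x))\<^sup>2) \<partial>\<mu>) \<le> ennreal (\<epsilon> * t\<^sup>2)"
  shows "(\<integral>x. d x * p0 x \<partial>\<mu>) = 0"
proof -
  have prob_int: "integrable \<mu> p" "integral\<^sup>L \<mu> p = 1"
    if [measurable]: "p \<in> borel_measurable \<mu>" and p: "\<And>x. 0 \<le> p x" and P: "prob_space (density \<mu> (\<lambda>x. ennreal (p x)))" for p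
  proof -
    have "(\<integral>\<^sup>+x. ennreal (p x) \<partial>\<mu>) = 1"
      using prob_space.emeasure_space_1[OF P] by (simp add: emeasure_density)
    then show "integrable \<mu> p" "integral\<^sup>L \<mu> p = 1"
      using p by (auto intro!: integrableI_nonneg simp: integral_eq_nn_integral)
  qed
  note i0 = prob_int[OF p0 P0]
  \<comment> \<open>The derivative in \<open>L\<^sup>2\<close> of the square root of the density at
    t = 0; \<open>rm\<close> below is the remainder of first order.\<close>
  define D where "D x = d x * sqrt (p0 x) / 2" for x
  have [measurable]: "D \<in> borel_measurable \<mu>" unfolding D_def by measurable
  have D2: "(D x)\<^sup>2 = (d x)\<^sup>2 * p0 x / 4" for x using p0(2)[of x] by (simp add: D_def power_mult_distrib power_divide)
  have D2i: "integrable \<mu> (\<lambda>x. (D x)\<^sup>2)" unfolding D2 using d2 by simp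
  define C where "C = (\<integral>x. (D x)\<^sup>2 \<partial>\<mu>)"
  have C0: "0 \<le> C" by (simp add: C_def)
  have Db: "D x * sqrt (p0 x) = d x * p0 x / 2" for x using p0(2)[of x] by (simp add: D_def)
  let ?b = "\<lambda>x. sqrt (p0 x)"
  have b2i: "integrable \<mu> (\<lambda>x. (?b x)\<^sup>2)" using i0(1) p0(2) by simp
  have Dbi: "integrable \<mu> (\<lambda>x. D x * ?b x)" using D2i b2i by (intro integrable_mult_squares) auto
  have bound: "\<bar>\<integral>x. D x * ?b x \<partial>\<mu>\<bar> \<le> (\<epsilon>\<^sup>2 + C) * t + \<epsilon>"
    if \<epsilon>: "0 < \<epsilon>" and t: "0 < t" and p [measurable]: "p \<in> borel_measurable \<mu>" and pnn: "\<And>x. 0 \<le> p x"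
      and P: "prob_space (density \<mu> (\<lambda>x. ennreal (p x)))"
      and le: "(\<integral>\<^sup>+x. ennreal ((sqrt (p x) - ?b x - t / 2 * d x * ?b x)\<^sup>2) \<partial>\<mu>) \<le> ennreal (\<epsilon>\<^sup>2 * t\<^sup>2)" for \<epsilon> t p
  proof -
    note ip = prob_int[OF p pnn P]
    let ?a = "\<lambda>x. sqrt (p x)"
    define rm where "rm x = ?a x - ?b x - t * D x" for x
    have [measurable]: "rm \<in> borel_measurable \<mu>" unfolding rm_def by measurable
    have rm_eq: "sqrt (p x) - ?b x - t / 2 * d x * ?b x = rm x" for x by (simp add: rm_def D_def)
    have rmi: "integrable \<mu> (\<lambda>x. (rm x)\<^sup>2)"
      using le unfolding rm_eq by (intro integrableI_nonneg) (auto simp: le_less_trans)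
    have rm_le: "(\<integral>x. (rm x)\<^sup>2 \<partial>\<mu>) \<le> \<epsilon>\<^sup>2 * t\<^sup>2"
    proof -
      have "ennreal (\<integral>x. (rm x)\<^sup>2 \<partial>\<mu>) = (\<integral>\<^sup>+x. ennreal ((rm x)\<^sup>2) \<partial>\<mu>)"
        using rmi by (intro nn_integral_eq_integral[symmetric]) auto
      then have "ennreal (\<integral>x. (rm x)\<^sup>2 \<partial>\<mu>) \<le> ennreal (\<epsilon>\<^sup>2 * t\<^sup>2)" using le unfolding rm_eq by simp
      then show ?thesis by (subst (asm) ennreal_le_iff) auto
    qed
    have a2i: "integrable \<mu> (\<lambda>x. (?a x)\<^sup>2)" using ip(1) pnn by simp
    have abi: "integrable \<mu> (\<lambda>x. ?a x * ?b x)" using a2i b2i by (intro integrable_mult_squares) auto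
    have ab2: "(\<lambda>x. (?a x - ?b x)\<^sup>2) = (\<lambda>x. p x + p0 x - 2 * (?a x * ?b x))"
      using pnn p0(2) by (auto simp: power2_diff)
    have ab2i: "integrable \<mu> (\<lambda>x. (?a x - ?b x)\<^sup>2)" unfolding ab2 using ip i0 abi by simp
    have ab2v: "(\<integral>x. (?a x - ?b x)\<^sup>2 \<partial>\<mu>) = 2 - 2 * (\<integral>x. ?a x * ?b x \<partial>\<mu>)"
      unfolding ab2 using ip i0 abi by simp
    have ab2_le: "(\<integral>x. (?a x - ?b x)\<^sup>2 \<partial>\<mu>) \<le> 2 * \<epsilon>\<^sup>2 * t\<^sup>2 + 2 * t\<^sup>2 * C"
    proof -
      have "(?a x - ?b x)\<^sup>2 \<le> 2 * (rm x)\<^sup>2 + 2 * t\<^sup>2 * (D x)\<^sup>2" for x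
      proof -
        have "?a x - ?b x = rm x + t * D x" by (simp add: rm_def)
        moreover have "(u + v)\<^sup>2 \<le> 2 * u\<^sup>2 + 2 * v\<^sup>2" for u v :: real
          using zero_le_power2[of "u - v"] by (simp add: power2_diff power2_sum)
        from this[of "rm x" "t * D x"] have "(rm x + t * D x)\<^sup>2 \<le> 2 * (rm x)\<^sup>2 + 2 * t\<^sup>2 * (D x)\<^sup>2"
          by (simp add: power_mult_distrib)
        ultimately show ?thesis by simp
      qed
      then have "(\<integral>x. (?a x - ?b x)\<^sup>2 \<partial>\<mu>) \<le> (\<integral>x. 2 * (rm x)\<^sup>2 + 2 * t\<^sup>2 * (D x)\<^sup>2 \<partial>\<mu>)"
        using ab2i rmi D2i by (intro integral_mono) auto
      also have "\<dots> = 2 * (\<integral>x. (rm x)\<^sup>2 \<partial>\<mu>) + 2 * t\<^sup>2 * C" using rmi D2i by (simp add: C_def)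
      finally show ?thesis using rm_le by simp
    qed
    have rbi: "integrable \<mu> (\<lambda>x. rm x * ?b x)" using rmi b2i by (intro integrable_mult_squares) auto
    have rb_le: "\<bar>\<integral>x. rm x * ?b x \<partial>\<mu>\<bar> \<le> \<epsilon> * t"
    proof -
      have et: "0 < \<epsilon> * t" using \<epsilon> t by simp
      \<comment> \<open>The weight \<epsilon> t balances the two terms: each integrates to at most
        \<epsilon> t / 2.\<close>
      have "\<bar>rm x * ?b x\<bar> \<le> (1 / (2 * (\<epsilon> * t))) * (rm x)\<^sup>2 + (\<epsilon> * t / 2) * (?b x)\<^sup>2" for x
      proof -
        have "2 * (u * v) \<le> (1 / w) * u\<^sup>2 + w * v\<^sup>2" if "0 < w" for u v w :: real
        proof -
          have "0 \<le> (u - w * v)\<^sup>2 / w" using that by simp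
          also have "\<dots> = (1 / w) * u\<^sup>2 + w * v\<^sup>2 - 2 * (u * v)"
            using that by (simp add: power2_diff power_mult_distrib field_simps power2_eq_square)
          finally show ?thesis by simp
        qed
        from this[OF et, of "\<bar>rm x\<bar>" "\<bar>?b x\<bar>"] show ?thesis by (simp add: abs_mult)
      qed
      then have "\<bar>\<integral>x. rm x * ?b x \<partial>\<mu>\<bar> \<le> (\<integral>x. (1 / (2 * (\<epsilon> * t))) * (rm x)\<^sup>2 + (\<epsilon> * t / 2) * (?b x)\<^sup>2 \<partial>\<mu>)"
        using rbi rmi b2i by (intro order_trans[OF integral_abs_bound integral_mono]) auto
      also have "\<dots> = (1 / (2 * (\<epsilon> * t))) * (\<integral>x. (rm x)\<^sup>2 \<partial>\<mu>) + (\<epsilon> * t / 2) * (\<integral>x. (?b x)\<^sup>2 \<partial>\<mu>)"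
        using rmi b2i by (simp only: Bochner_Integration.integral_add integrable_mult_right integral_mult_right_zero)
      also have "(\<integral>x. (?b x)\<^sup>2 \<partial>\<mu>) = 1" using i0 p0(2) by simp
      also have "(1 / (2 * (\<epsilon> * t))) * (\<integral>x. (rm x)\<^sup>2 \<partial>\<mu>) \<le> (1 / (2 * (\<epsilon> * t))) * (\<epsilon>\<^sup>2 * t\<^sup>2)"
        using rm_le et by (intro mult_left_mono) auto
      also have "(1 / (2 * (\<epsilon> * t))) * (\<epsilon>\<^sup>2 * t\<^sup>2) = \<epsilon> * t / 2"
        using \<epsilon> t by (simp add: power2_eq_square)
      finally show ?thesis by simp
    qed
    \<comment> \<open>For unit vectors a and b, the inner product is 1 - |a - b|^2 / 2. Hence t
      times the inner product of \<open>D\<close> with the square root of \<open>p0\<close> consists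
      of a term of order t^2 and one of size at most \<epsilon> t; only \<epsilon> survives division
      by t.\<close>
    have "(\<integral>x. rm x * ?b x \<partial>\<mu>) = (\<integral>x. ?a x * ?b x - p0 x - t * (D x * ?b x) \<partial>\<mu>)"
      using p0(2) by (intro Bochner_Integration.integral_cong) (auto simp: rm_def algebra_simps power2_eq_square[symmetric])
    also have "\<dots> = (\<integral>x. ?a x * ?b x \<partial>\<mu>) - 1 - t * (\<integral>x. D x * ?b x \<partial>\<mu>)"
      using abi i0 Dbi by simp
    finally have "t * (\<integral>x. D x * ?b x \<partial>\<mu>) = - (\<integral>x. (?a x - ?b x)\<^sup>2 \<partial>\<mu>) / 2 - (\<integral>x. rm x * ?b x \<partial>\<mu>)"
      using ab2v by linarith
    moreover have "0 \<le> (\<integral>x. (?a x - ?b x)\<^sup>2 \<partial>\<mu>)" by simp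
    ultimately have "\<bar>t * (\<integral>x. D x * ?b x \<partial>\<mu>)\<bar> \<le> \<epsilon>\<^sup>2 * t\<^sup>2 + t\<^sup>2 * C + \<epsilon> * t"
      using ab2_le rb_le by linarith
    also have "\<dots> = t * ((\<epsilon>\<^sup>2 + C) * t + \<epsilon>)" by (simp add: algebra_simps power2_eq_square)
    finally show ?thesis using t by (simp add: abs_mult)
  qed
  have "\<bar>\<integral>x. D x * ?b x \<partial>\<mu>\<bar> \<le> 0"
  proof (rule field_le_epsilon)
    fix e :: real assume e: "0 < e"
    define \<epsilon> where "\<epsilon> = e / 2"
    have \<epsilon>: "0 < \<epsilon>" using e by (simp add: \<epsilon>_def)
    have "((\<lambda>t. (\<epsilon>\<^sup>2 + C) * t + \<epsilon>) \<longlongrightarrow> (\<epsilon>\<^sup>2 + C) * 0 + \<epsilon>) (at_right 0)" by (intro tendsto_intros)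
    then have "\<forall>\<^sub>F t in at_right 0. (\<epsilon>\<^sup>2 + C) * t + \<epsilon> < e"
      by (rule order_tendstoD) (use e in \<open>simp add: \<epsilon>_def\<close>)
    moreover have "\<forall>\<^sub>F t::real in at_right 0. 0 < t" by (auto simp: eventually_at_filter)
    moreover have "\<forall>\<^sub>F t in at_right 0.
       (\<integral>\<^sup>+x. ennreal ((sqrt (pt t x) - sqrt (p0 x) - t / 2 * d x * sqrt (p0 x))\<^sup>2) \<partial>\<mu>) \<le> ennreal (\<epsilon>\<^sup>2 * t\<^sup>2)"
      by (rule DQM) (use \<epsilon> in simp)
    ultimately have "\<forall>\<^sub>F t::real in at_right 0. \<bar>\<integral>x. D x * ?b x \<partial>\<mu>\<bar> < e"
      using pt
    proof eventually_elim
      case (elim t)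
      then have "\<bar>\<integral>x. D x * ?b x \<partial>\<mu>\<bar> \<le> (\<epsilon>\<^sup>2 + C) * t + \<epsilon>"
        by (intro bound[OF \<epsilon>, of t "pt t"]) auto
      then show ?case using elim by simp
    qed
    then show "\<bar>\<integral>x. D x * ?b x \<partial>\<mu>\<bar> \<le> 0 + e"
      using eventually_happens'[of "at_right (0::real)"] trivial_limit_at_right_real by fastforce
  qed
  then show ?thesis unfolding Db by simp
qed

text \<open>Symmetry, semidefiniteness, null vectors and the normalisation by \<open>V\<close> are
  read off from this integral form instead of the matrix entries.\<close>

lemma second_moment_matrix:
  fixes s :: "'a \<Rightarrow> real^'m"
  assumes "exp_moments P0 s"
  shows "x \<bullet> ((\<chi> i j. \<integral>w. s w $ i * s w $ j \<partial>P0) *v y) = (\<integral>w. (x \<bullet> s w) * (y \<bullet> s w) \<partial>P0)"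
    and "integrable P0 (\<lambda>w. (x \<bullet> s w) * (y \<bullet> s w))"
proof -
  interpret exp_moments P0 s by fact
  have prodi: "integrable P0 (\<lambda>w. (u \<bullet> s w) * (v \<bullet> s w))" for u v
    by (rule integrable_mult_squares[OF _ _ inner_sq_int inner_sq_int]) measurable
  then show "integrable P0 (\<lambda>w. (x \<bullet> s w) * (y \<bullet> s w))" .
  have sij: "integrable P0 (\<lambda>w. s w $ i * s w $ j)" for i j
    using prodi[of "axis i 1" "axis j 1"] by (simp add: inner_axis')
  have "(\<integral>w. (x \<bullet> s w) * (y \<bullet> s w) \<partial>P0) = (\<integral>w. (\<Sum>i\<in>UNIV. \<Sum>j\<in>UNIV. x $ i * y $ j * (s w $ i * s w $ j)) \<partial>P0)"
    by (intro Bochner_Integration.integral_cong refl) (simp add: inner_vec_def sum_product mult_ac)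
  also have "\<dots> = (\<Sum>i\<in>UNIV. \<Sum>j\<in>UNIV. x $ i * y $ j * (\<integral>w. s w $ i * s w $ j \<partial>P0))"
    using sij by simp
  also have "\<dots> = x \<bullet> ((\<chi> i j. \<integral>w. s w $ i * s w $ j \<partial>P0) *v y)"
    by (simp add: inner_vec_def matrix_vector_mult_def sum_distrib_left mult_ac)
  finally show "x \<bullet> ((\<chi> i j. \<integral>w. s w $ i * s w $ j \<partial>P0) *v y) = (\<integral>w. (x \<bullet> s w) * (y \<bullet> s w) \<partial>P0)" ..
qed

text \<open>No spectral theorem is needed: even if some \<open>eigenvalues (J t)\<close> were empty, the infimum of the empty set of reals is
  a fixed number, so the family of smallest eigenvalues is bounded below.\<close>

lemma posdef_of_Inf_min_eigenvalue:
  fixes J :: "'t \<Rightarrow> real^'m^'m"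
  assumes psd: "\<And>t x. t \<in> \<Theta> \<Longrightarrow> 0 \<le> x \<bullet> (J t *v x)"
    and null: "\<And>t x. t \<in> \<Theta> \<Longrightarrow> x \<bullet> (J t *v x) = 0 \<Longrightarrow> J t *v x = 0"
    and pos: "0 < Inf (min_eigenvalue ` J ` \<Theta>)" and t: "t \<in> \<Theta>" and x: "x \<noteq> 0"
  shows "0 < x \<bullet> (J t *v x)"
proof -
  have ev0: "0 \<le> c" if u: "u \<in> \<Theta>" and c: "c \<in> eigenvalues (J u)" for u c
  proof -
    obtain v where v: "v \<noteq> 0" "J u *v v = c *\<^sub>R v" using c by (auto simp: eigenvalues_def)
    have "0 \<le> c * (v \<bullet> v)" using psd[OF u, of v] v by simp
    moreover have "0 < v \<bullet> v" using v(1) by simp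
    ultimately show ?thesis by (metis mult.commute zero_le_mult_iff not_le)
  qed
  have "min 0 (Inf {}) \<le> min_eigenvalue (J u)" if "u \<in> \<Theta>" for u
  proof (cases "eigenvalues (J u) = {}")
    case False
    then have "0 \<le> Inf (eigenvalues (J u))" using ev0[OF that] by (intro cInf_greatest) auto
    then show ?thesis by (simp add: min_eigenvalue_def min_le_iff_disj)
  qed (simp add: min_eigenvalue_def)
  then have "bdd_below (min_eigenvalue ` J ` \<Theta>)" by (intro bdd_belowI[of _ "min 0 (Inf {})"]) auto
  then have "Inf (min_eigenvalue ` J ` \<Theta>) \<le> min_eigenvalue (J t)" using t by (intro cInf_lower) auto
  then have gt: "0 < min_eigenvalue (J t)" using pos by simp
  show ?thesis
  proof (rule ccontr)
    assume "\<not> ?thesis"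
    then have "x \<bullet> (J t *v x) = 0" using psd[OF t, of x] by simp
    \<comment> \<open>A null vector of the form would be an eigenvector for 0 and push the infimum
      of the nonnegative eigenvalues down to 0.\<close>
    then have "0 \<in> eigenvalues (J t)" using null[OF t] x by (auto simp: eigenvalues_def)
    then have "Inf (eigenvalues (J t)) \<le> 0"
      by (rule cInf_lower) (rule bdd_belowI[of _ 0], rule ev0[OF t])
    then show False using gt by (simp add: min_eigenvalue_def)
  qed
qed

text \<open>Both square roots of densities are compared with the same linear approximation, sqrt p
  times 1 + h . s / 2: the model by differentiability in quadratic mean, the tilt by
  \<open>sqrt_tilt_expansion\<close>. The factors 2 come from the square of a difference.\<close>

lemma (in exp_family) Hellinger_tilt:
  assumes P0_eq: "P0 = density \<mu> (\<lambda>x. ennreal (p x))" and p [measurable]: "p \<in> borel_measurable \<mu>" and p0: "\<And>x. 0 \<le> p x"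
    and p' [measurable]: "p' \<in> borel_measurable \<mu>"
    and h: "norm h \<le> 1"
    and DQM: "(\<integral>\<^sup>+x. ennreal ((sqrt (p' x) - sqrt (p x) - (1/2) * (h \<bullet> s x) * sqrt (p x))\<^sup>2) \<partial>\<mu>) \<le> ennreal e" and e: "0 \<le> e"
  shows "(\<integral>\<^sup>+x. ennreal ((sqrt (p' x) - sqrt (p x * (exp (h \<bullet> s x) / M h)))\<^sup>2) \<partial>\<mu>) \<le> ennreal (2 * e + 2 * C4 * norm h ^ 4)"
proof -
  have sets: "sets P0 = sets \<mu>" by (simp add: P0_eq)
  have sm [measurable]: "s \<in> borel_measurable \<mu>" using s_meas by (simp only: measurable_cong_sets[OF sets refl])
  let ?u = "\<lambda>x. sqrt (p' x) - sqrt (p x) - (1/2) * (h \<bullet> s x) * sqrt (p x)"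
  let ?v = "\<lambda>x. exp (h \<bullet> s x / 2) / sqrt (M h) - 1 - h \<bullet> s x / 2"
  have sq: "sqrt (p x * (exp (h \<bullet> s x) / M h)) = sqrt (p x) * (exp (h \<bullet> s x / 2) / sqrt (M h))" for x
  proof -
    have "sqrt (exp (h \<bullet> s x)) = exp (h \<bullet> s x / 2)"
      by (rule real_sqrt_unique) (simp_all add: power2_eq_square mult_exp_exp)
    then show ?thesis by (simp add: real_sqrt_mult real_sqrt_divide)
  qed
  have pt: "(sqrt (p' x) - sqrt (p x * (exp (h \<bullet> s x) / M h)))\<^sup>2 \<le> 2 * (?u x)\<^sup>2 + 2 * (p x * (?v x)\<^sup>2)" for x
  proof -
    have "sqrt (p' x) - sqrt (p x * (exp (h \<bullet> s x) / M h)) = ?u x - sqrt (p x) * ?v x"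
      unfolding sq by (simp add: algebra_simps)
    moreover have "(a - b)\<^sup>2 \<le> 2 * a\<^sup>2 + 2 * b\<^sup>2" for a b :: real
      using zero_le_power2[of "a + b"] by (simp add: power2_diff power2_sum)
    moreover have "(sqrt (p x) * ?v x)\<^sup>2 = p x * (?v x)\<^sup>2" using p0[of x] by (simp add: power_mult_distrib)
    ultimately show ?thesis by metis
  qed
  have v_le: "(\<integral>\<^sup>+x. ennreal (p x * (?v x)\<^sup>2) \<partial>\<mu>) \<le> ennreal (C4 * norm h ^ 4)"
  proof -
    have "(\<integral>\<^sup>+x. ennreal (p x * (?v x)\<^sup>2) \<partial>\<mu>) = (\<integral>\<^sup>+x. ennreal ((?v x)\<^sup>2) \<partial>P0)"
      unfolding P0_eq using p0 by (subst nn_integral_density) (simp_all add: ennreal_mult')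
    also have "\<dots> = ennreal (\<integral>x. (?v x)\<^sup>2 \<partial>P0)"
      using sqrt_tilt_expansion(1)[OF h] by (intro nn_integral_eq_integral) auto
    finally show ?thesis using sqrt_tilt_expansion(2)[OF h] by (simp add: ennreal_leI)
  qed
  have "(\<integral>\<^sup>+x. ennreal ((sqrt (p' x) - sqrt (p x * (exp (h \<bullet> s x) / M h)))\<^sup>2) \<partial>\<mu>) \<le>
      (\<integral>\<^sup>+x. ennreal 2 * ennreal ((?u x)\<^sup>2) + ennreal 2 * ennreal (p x * (?v x)\<^sup>2) \<partial>\<mu>)"
  proof (rule nn_integral_mono)
    fix x
    have "ennreal ((sqrt (p' x) - sqrt (p x * (exp (h \<bullet> s x) / M h)))\<^sup>2) \<le> ennreal (2 * (?u x)\<^sup>2 + 2 * (p x * (?v x)\<^sup>2))"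
      by (rule ennreal_leI[OF pt])
    also have "\<dots> = ennreal 2 * ennreal ((?u x)\<^sup>2) + ennreal 2 * ennreal (p x * (?v x)\<^sup>2)"
      using p0[of x] by (simp only: ennreal_plus ennreal_mult' zero_le_power2 mult_nonneg_nonneg zero_le_numeral)
    finally show "ennreal ((sqrt (p' x) - sqrt (p x * (exp (h \<bullet> s x) / M h)))\<^sup>2) \<le>
       ennreal 2 * ennreal ((?u x)\<^sup>2) + ennreal 2 * ennreal (p x * (?v x)\<^sup>2)" .
  qed
  also have "\<dots> = ennreal 2 * (\<integral>\<^sup>+x. ennreal ((?u x)\<^sup>2) \<partial>\<mu>) + ennreal 2 * (\<integral>\<^sup>+x. ennreal (p x * (?v x)\<^sup>2) \<partial>\<mu>)"
    by (simp add: nn_integral_add nn_integral_cmult)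
  also have "\<dots> \<le> ennreal 2 * ennreal e + ennreal 2 * ennreal (C4 * norm h ^ 4)"
    by (intro add_mono mult_left_mono DQM v_le) auto
  also have "\<dots> = ennreal (2 * e + 2 * C4 * norm h ^ 4)"
  proof -
    have "0 \<le> C4 * norm h ^ 4" by (simp add: C4_def)
    then show ?thesis using e
      by (simp only: mult.assoc ennreal_plus ennreal_mult' mult_nonneg_nonneg zero_le_numeral)
  qed
  finally show ?thesis .
qed

theorem theorem4:
  fixes \<Theta> :: "(real^'m) set"
    and \<mu> :: "'a::polish_space measure"
    and p :: "real^'m \<Rightarrow> 'a \<Rightarrow> real"
    and score :: "real^'m \<Rightarrow> 'a \<Rightarrow> real^'m"
    and P :: "real^'m \<Rightarrow> 'a measure"
    and J :: "real^'m \<Rightarrow> real^'m^'m"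
    and r :: real
    and rn :: "nat \<Rightarrow> nat"
  assumes open_Theta: "open \<Theta>"
    and sets_mu: "sets \<mu> = sets borel"
    and p_meas: "\<And>\<theta>. \<theta> \<in> \<Theta> \<Longrightarrow> p \<theta> \<in> borel_measurable \<mu>"
    and p_nonneg: "\<And>\<theta> x. \<theta> \<in> \<Theta> \<Longrightarrow> 0 \<le> p \<theta> x"
    and P_def: "\<And>\<theta>. P \<theta> = density \<mu> (\<lambda>x. ennreal (p \<theta> x))"
    and P_prob: "\<And>\<theta>. \<theta> \<in> \<Theta> \<Longrightarrow> prob_space (P \<theta>)"
    and l_meas: "\<And>\<theta>. \<theta> \<in> \<Theta> \<Longrightarrow> score \<theta> \<in> borel_measurable \<mu>"
    and DQM: "\<And>\<theta>. \<theta> \<in> \<Theta> \<Longrightarrow>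
       ((\<lambda>h. (\<integral>\<^sup>+ x. ennreal ((sqrt (p (\<theta> + h) x) - sqrt (p \<theta> x)
              - (1/2) * (h \<bullet> score \<theta> x) * sqrt (p \<theta> x))\<^sup>2) \<partial>\<mu>) / ennreal ((norm h)\<^sup>2))
        \<longlongrightarrow> 0) (at 0)"
    and J_def: "\<And>\<theta>. J \<theta> = (\<chi> i j. \<integral> x. score \<theta> x $ i * score \<theta> x $ j \<partial>P \<theta>)"
    and exp_moment: "\<And>K h. compact K \<Longrightarrow> K \<subseteq> \<Theta> \<Longrightarrow>
       (SUP \<theta> \<in> K. \<integral>\<^sup>+ x. ennreal (exp (h \<bullet> score \<theta> x)) \<partial>P \<theta>) < \<infinity>"
    and eig_pos: "Inf (min_eigenvalue ` J ` \<Theta>) > 0"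
    and r_ge: "r \<ge> 1"
    and rn_def: "\<And>n. rn n = nat \<lfloor>r * real n\<rfloor>"
    and theta: "\<theta> \<in> \<Theta>"
  shows "(SUP a \<in> {0::real..}. liminf (\<lambda>n.
            INF \<Lambda> \<in> markov_kernels (powM \<mu> n) (powM \<mu> (rn n)).
              SUP \<theta>' \<in> \<Theta> \<inter> cball \<theta> (a / sqrt (real n)).
                tv_norm (powM (P \<theta>') n \<bind> \<Lambda>) (powM (P \<theta>') (rn n))))
         \<ge> D_const r (matrix_inv (J \<theta>))"
proof -

  \<comment> \<open>The standardised score and its exponential family\<close>
  define q where "q = sqrt r"
  have q1: "1 \<le> q" and q0: "0 < q" using r_ge by (auto simp: q_def)
  have sets_P: "sets (P t) = sets \<mu>" for t by (simp add: P_def)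
  have moments: "exp_moments (P t) (score t)" if t: "t \<in> \<Theta>" for t
  proof (rule exp_moments.intro)
    show "prob_space (P t)" by (rule P_prob[OF t])
    show "exp_moments_axioms (P t) (score t)"
    proof
      show m [measurable]: "score t \<in> borel_measurable (P t)"
        using l_meas[OF t] by (simp only: measurable_cong_sets[OF sets_P refl])
      fix h
      have "(\<integral>\<^sup>+x. ennreal (exp (h \<bullet> score t x)) \<partial>P t) < \<infinity>"
        using exp_moment[of "{t}" h] t by simp
      then show "integrable (P t) (\<lambda>x. exp (h \<bullet> score t x))" by (intro integrableI_nonneg) auto
    qed
  qed
  have J_inner: "x \<bullet> (J t *v y) = (\<integral>w. (x \<bullet> score t w) * (y \<bullet> score t w) \<partial>P t)" if "t \<in> \<Theta>" for t x y
    unfolding J_def by (rule second_moment_matrix[OF moments[OF that]])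
  have J_pd: "0 < x \<bullet> (J \<theta> *v x)" if "x \<noteq> 0" for x
  proof (rule posdef_of_Inf_min_eigenvalue[OF _ _ eig_pos theta that])
    show "0 \<le> x \<bullet> (J t *v x)" if "t \<in> \<Theta>" for t x
      unfolding J_inner[OF that] by simp
    \<comment> \<open>x . J x is the second moment of x . score, so its vanishing makes x . score
      zero almost everywhere, and with it every mixed moment.\<close>
    show "J t *v x = 0" if t: "t \<in> \<Theta>" and z: "x \<bullet> (J t *v x) = 0" for t x
    proof -
      have i: "integrable (P t) (\<lambda>w. (x \<bullet> score t w) * (x \<bullet> score t w))"
        by (rule second_moment_matrix[OF moments[OF t]])
      have "AE w in P t. (x \<bullet> score t w) * (x \<bullet> score t w) = 0"
        using z i unfolding J_inner[OF t] by (subst (asm) integral_nonneg_eq_0_iff_AE) auto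
      then have "AE w in P t. x \<bullet> score t w = 0" by simp
      then have "(\<integral>w. (y \<bullet> score t w) * (x \<bullet> score t w) \<partial>P t) = 0" for y
        by (intro integral_eq_zero_AE) auto
      then have "y \<bullet> (J t *v x) = 0" for y by (simp add: J_inner[OF t])
      from this[of "J t *v x"] show ?thesis by simp
    qed
  qed
  have J_sym: "x \<bullet> (J \<theta> *v y) = y \<bullet> (J \<theta> *v x)" for x y
    unfolding J_inner[OF theta] by (simp add: mult.commute)
  obtain V :: "real^'m^'m" where V: "\<And>x y. (V *v x) \<bullet> (J \<theta> *v (V *v y)) = x \<bullet> y"
  proof (rule ex_conjugate_basis[OF J_sym J_pd])
    fix V :: "real^'m^'m" assume a: "\<And>x y. (V *v x) \<bullet> (J \<theta> *v (V *v y)) = x \<bullet> y"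
    show thesis by (rule that[OF a])
  qed
  obtain c where c: "0 \<le> c" and D_le: "D_const r (matrix_inv (J \<theta>)) \<le>
      ereal (2 * (measure std_gauss (cball (0::real^'m) c) - measure std_gauss (cball (0::real^'m) (c / q))))"
  proof (rule D_const_le[OF V r_ge])
    fix c assume "0 \<le> c" "D_const r (matrix_inv (J \<theta>)) \<le>
      ereal (2 * (measure std_gauss (cball (0::real^'m) c) - measure std_gauss (cball (0::real^'m) (c / sqrt r))))"
    then show thesis unfolding q_def[symmetric] by (rule that)
  qed
  define s where "s x = transpose V *v score \<theta> x" for x
  have hs: "h \<bullet> s x = (V *v h) \<bullet> score \<theta> x" for h x
    unfolding s_def by (simp only: dot_lmul_matrix[symmetric] vector_transpose_matrix)
  interpret S: exp_moments "P \<theta>" "score \<theta>" by (rule moments[OF theta])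
  obtain Bv where Bv: "0 < Bv" "\<And>h. norm (V *v h) \<le> norm h * Bv"
    using bounded_linear.pos_bounded[OF matrix_vector_mul_bounded_linear[of V]] by blast
  let ?I = "\<lambda>k. \<integral>\<^sup>+x. ennreal ((sqrt (p (\<theta> + k) x) - sqrt (p \<theta> x) - (1/2) * (k \<bullet> score \<theta> x) * sqrt (p \<theta> x))\<^sup>2) \<partial>\<mu>"
  \<comment> \<open>The limit of quotients in the extended reals is restated as an inequality, with
    k = 0 excluded because of the division. The same threshold keeps \<open>\<theta> + k\<close> in
    \<open>\<Theta>\<close>, which is open.\<close>
  have DQM_le: "\<exists>\<eta>>0. \<forall>k. k \<noteq> 0 \<longrightarrow> norm k < \<eta> \<longrightarrow> \<theta> + k \<in> \<Theta> \<and>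
      ?I k \<le> ennreal (\<epsilon> * (norm k)\<^sup>2)" if \<epsilon>: "0 < \<epsilon>" for \<epsilon>
  proof -
    have "\<forall>\<^sub>F k in at 0. ?I k / ennreal ((norm k)\<^sup>2) < ennreal \<epsilon>"
      by (rule order_tendstoD(2)[OF DQM[OF theta]]) (use \<epsilon> in simp)
    then obtain \<eta>1 where \<eta>1: "0 < \<eta>1" "\<And>k. k \<noteq> 0 \<Longrightarrow> norm k < \<eta>1 \<Longrightarrow> ?I k / ennreal ((norm k)\<^sup>2) < ennreal \<epsilon>"
      unfolding eventually_at by (auto simp: dist_norm)
    obtain \<eta>2 where \<eta>2: "0 < \<eta>2" "ball \<theta> \<eta>2 \<subseteq> \<Theta>"
      using open_Theta theta by (auto simp: open_contains_ball)
    show ?thesis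
    proof (intro exI[of _ "min \<eta>1 \<eta>2"] conjI allI impI)
      fix k :: "real^'m" assume k: "k \<noteq> 0" "norm k < min \<eta>1 \<eta>2"
      have "\<theta> + k \<in> ball \<theta> \<eta>2" using k by (simp add: dist_norm)
      then show "\<theta> + k \<in> \<Theta>" using \<eta>2 by auto
      have n0: "ennreal ((norm k)\<^sup>2) \<noteq> 0" using k by simp
      have "?I k = (?I k / ennreal ((norm k)\<^sup>2)) * ennreal ((norm k)\<^sup>2)"
        using n0 by (simp add: ennreal_divide_times ennreal_times_divide[symmetric] mult_divide_eq_ennreal ennreal_mult_divide_eq)
      also have "\<dots> \<le> ennreal \<epsilon> * ennreal ((norm k)\<^sup>2)"
        using \<eta>1(2)[of k] k by (intro mult_right_mono less_imp_le) auto
      also have "\<dots> = ennreal (\<epsilon> * (norm k)\<^sup>2)" using \<epsilon> by (simp add: ennreal_mult')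
      finally show "?I k \<le> ennreal (\<epsilon> * (norm k)\<^sup>2)" .
    qed (use \<eta>1 \<eta>2 in auto)
  qed
  have mean: "(\<integral>x. u \<bullet> score \<theta> x \<partial>P \<theta>) = 0" for u
  proof (cases "u = 0")
    case False
    have [measurable]: "score \<theta> \<in> borel_measurable \<mu>" "p \<theta> \<in> borel_measurable \<mu>" using l_meas p_meas theta by auto
    have small: "\<forall>\<^sub>F t in at_right 0. t *\<^sub>R u \<noteq> 0 \<and> norm (t *\<^sub>R u) < \<eta> \<and> 0 < t" if "0 < \<eta>" for \<eta>
    proof -
      have "((\<lambda>t. norm (t *\<^sub>R u)) \<longlongrightarrow> norm ((0::real) *\<^sub>R u)) (at_right 0)" by (intro tendsto_intros)
      then have "\<forall>\<^sub>F t in at_right 0. norm (t *\<^sub>R u) < \<eta>" by (rule order_tendstoD) (use that in simp)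
      moreover have "\<forall>\<^sub>F t::real in at_right 0. 0 < t" by (auto simp: eventually_at_filter)
      ultimately show ?thesis by eventually_elim (use False in auto)
    qed
    have "(\<integral>x. (u \<bullet> score \<theta> x) * p \<theta> x \<partial>\<mu>) = 0"
    proof (rule DQM_mean_zero[where pt="\<lambda>t. p (\<theta> + t *\<^sub>R u)"])
      show "prob_space (density \<mu> (\<lambda>x. ennreal (p \<theta> x)))" using P_prob[OF theta] by (simp add: P_def)
      have "integrable (density \<mu> (\<lambda>x. ennreal (p \<theta> x))) (\<lambda>x. (u \<bullet> score \<theta> x)\<^sup>2)"
        using S.inner_sq_int[of u] by (simp add: P_def)
      then show "integrable \<mu> (\<lambda>x. (u \<bullet> score \<theta> x)\<^sup>2 * p \<theta> x)"
        using p_nonneg[OF theta] by (subst (asm) integrable_density) (auto simp: mult.commute)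
      obtain \<eta> where \<eta>: "0 < \<eta>" "\<And>k. k \<noteq> 0 \<Longrightarrow> norm k < \<eta> \<Longrightarrow> \<theta> + k \<in> \<Theta>" using DQM_le[of 1] by auto
      show "\<forall>\<^sub>F t in at_right 0. p (\<theta> + t *\<^sub>R u) \<in> borel_measurable \<mu> \<and> (\<forall>x. 0 \<le> p (\<theta> + t *\<^sub>R u) x) \<and>
         prob_space (density \<mu> (\<lambda>x. ennreal (p (\<theta> + t *\<^sub>R u) x)))"
        using small[OF \<eta>(1)]
      proof eventually_elim
        case (elim t)
        then have "\<theta> + t *\<^sub>R u \<in> \<Theta>" using \<eta>(2) by blast
        then show ?case using p_meas p_nonneg P_prob by (auto simp: P_def[symmetric])
      qed
    next
      fix \<epsilon> :: real assume \<epsilon>: "0 < \<epsilon>"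
      \<comment> \<open>Along the ray the increment is t u, so dividing the tolerance by |u|^2 makes
        the bound come out as \<epsilon> t^2.\<close>
      have \<epsilon>': "0 < \<epsilon> / (norm u)\<^sup>2" using \<epsilon> False by simp
      obtain \<eta> where \<eta>: "0 < \<eta>" "\<And>k. k \<noteq> 0 \<Longrightarrow> norm k < \<eta> \<Longrightarrow>
        ?I k
         \<le> ennreal (\<epsilon> / (norm u)\<^sup>2 * (norm k)\<^sup>2)" using DQM_le[OF \<epsilon>'] by blast
      show "\<forall>\<^sub>F t in at_right 0. (\<integral>\<^sup>+x. ennreal ((sqrt (p (\<theta> + t *\<^sub>R u) x) - sqrt (p \<theta> x) -
          t / 2 * (u \<bullet> score \<theta> x) * sqrt (p \<theta> x))\<^sup>2) \<partial>\<mu>) \<le> ennreal (\<epsilon> * t\<^sup>2)"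
        using small[OF \<eta>(1)]
      proof eventually_elim
        case (elim t)
        have "?I (t *\<^sub>R u)
         \<le> ennreal (\<epsilon> / (norm u)\<^sup>2 * (norm (t *\<^sub>R u))\<^sup>2)" using \<eta>(2) elim by blast
        moreover have "\<epsilon> / (norm u)\<^sup>2 * (norm (t *\<^sub>R u))\<^sup>2 = \<epsilon> * t\<^sup>2" using False by (simp add: power_mult_distrib)
        ultimately show ?case by (simp add: mult.assoc)
      qed
    qed (use p_nonneg[OF theta] in auto)
    then show ?thesis
      unfolding P_def using p_nonneg[OF theta] by (subst integral_density) (auto simp: mult.commute)
  qed simp
  interpret E: exp_family "P \<theta>" s
  proof
    show "s \<in> borel_measurable (P \<theta>)" unfolding s_def by measurable
    show "integrable (P \<theta>) (\<lambda>x. exp (h \<bullet> s x))" for h unfolding hs by (rule S.exp_int)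
    show "(\<integral>x. h \<bullet> s x \<partial>P \<theta>) = 0" for h unfolding hs by (rule mean)
    show "(\<integral>x. (h \<bullet> s x)\<^sup>2 \<partial>P \<theta>) = (norm h)\<^sup>2" for h
      using V[of h h] unfolding hs J_inner[OF theta] by (simp add: power2_eq_square power2_norm_eq_inner[unfolded power2_eq_square])
  qed
  let ?H = "\<lambda>h. \<integral>\<^sup>+x. ennreal ((sqrt (p (\<theta> + V *v h) x) - sqrt (p \<theta> x * (exp (h \<bullet> s x) / E.M h)))\<^sup>2) \<partial>\<mu>"
  have close: "\<exists>\<eta>>0. \<forall>h. norm h < \<eta> \<longrightarrow> \<theta> + V *v h \<in> \<Theta> \<and>
      ?H h \<le> ennreal (\<epsilon> * (norm h)\<^sup>2)"
    if \<epsilon>: "0 < \<epsilon>" for \<epsilon>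
  proof -
    \<comment> \<open>Each error in \<open>Hellinger_tilt\<close> is allotted half of \<epsilon>
      |h|^2: that of the model through \<open>\<epsilon>1\<close> and the operator bound
      \<open>Bv\<close>, the fourth-order error of the tilt through the square root in
      \<open>\<eta>'\<close>.\<close>
    define \<epsilon>1 where "\<epsilon>1 = \<epsilon> / (4 * Bv\<^sup>2)"
    have \<epsilon>1: "0 < \<epsilon>1" using \<epsilon> Bv by (simp add: \<epsilon>1_def)
    obtain \<eta> where \<eta>: "0 < \<eta>" "\<And>k. k \<noteq> 0 \<Longrightarrow> norm k < \<eta> \<Longrightarrow> \<theta> + k \<in> \<Theta> \<and>
      ?I k
       \<le> ennreal (\<epsilon>1 * (norm k)\<^sup>2)" using DQM_le[OF \<epsilon>1] by blast
    have C4: "0 \<le> E.C4" by (simp add: E.C4_def)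
    define \<eta>' where "\<eta>' = min (\<eta> / Bv) (min 1 (sqrt (\<epsilon> / (4 * (E.C4 + 1)))))"
    have \<eta>'0: "0 < \<eta>'" using \<eta> Bv \<epsilon> C4 by (simp add: \<eta>'_def)
    show ?thesis
    proof (intro exI[of _ \<eta>'] conjI allI impI)
      fix h :: "real^'m" assume h: "norm h < \<eta>'"
      have h1: "norm h \<le> 1" using h by (simp add: \<eta>'_def)
      have VhB: "norm (V *v h) < \<eta>"
        using Bv(2)[of h] h Bv(1) by (simp add: \<eta>'_def pos_less_divide_eq)
      have Vh: "\<theta> + V *v h \<in> \<Theta> \<and> (\<integral>\<^sup>+x. ennreal ((sqrt (p (\<theta> + V *v h) x) - sqrt (p \<theta> x) - (1/2) * (h \<bullet> s x) * sqrt (p \<theta> x))\<^sup>2) \<partial>\<mu>)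
        \<le> ennreal (\<epsilon>1 * (norm (V *v h))\<^sup>2)"
      proof (cases "V *v h = 0")
        case True
        then show ?thesis using theta by (simp add: hs)
      next
        case False
        then show ?thesis using \<eta>(2)[OF False VhB] unfolding hs by simp
      qed
      then show "\<theta> + V *v h \<in> \<Theta>" by simp
      have "?H h
         \<le> ennreal (2 * (\<epsilon>1 * (norm (V *v h))\<^sup>2) + 2 * E.C4 * norm h ^ 4)"
        using Vh \<epsilon>1 by (intro E.Hellinger_tilt[OF P_def p_meas[OF theta] p_nonneg[OF theta] p_meas h1]) auto
      also have "\<dots> \<le> ennreal (\<epsilon> * (norm h)\<^sup>2)"
      proof (rule ennreal_leI)
        have "(norm (V *v h))\<^sup>2 \<le> (norm h * Bv)\<^sup>2" using Bv(2) by (intro power_mono) auto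
        then have "\<epsilon>1 * (norm (V *v h))\<^sup>2 \<le> \<epsilon>1 * (norm h * Bv)\<^sup>2" using \<epsilon>1 by (intro mult_left_mono) auto
        also have "\<dots> = \<epsilon> / 4 * (norm h)\<^sup>2" using Bv by (simp add: \<epsilon>1_def power_mult_distrib)
        finally have 1: "\<epsilon>1 * (norm (V *v h))\<^sup>2 \<le> \<epsilon> / 4 * (norm h)\<^sup>2" .
        have "(norm h)\<^sup>2 \<le> \<epsilon> / (4 * (E.C4 + 1))"
        proof -
          have "norm h \<le> sqrt (\<epsilon> / (4 * (E.C4 + 1)))" using h by (simp add: \<eta>'_def)
          then have "(norm h)\<^sup>2 \<le> (sqrt (\<epsilon> / (4 * (E.C4 + 1))))\<^sup>2" by (intro power_mono) auto
          then show ?thesis using \<epsilon> C4 by simp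
        qed
        then have "(E.C4 + 1) * (norm h)\<^sup>2 \<le> (E.C4 + 1) * (\<epsilon> / (4 * (E.C4 + 1)))" using C4 by (intro mult_left_mono) auto
        also have "\<dots> = \<epsilon> / 4"
        proof -
          have "u * (\<epsilon> / (4 * u)) = \<epsilon> / 4" if "0 < u" for u using that by simp
          from this[of "E.C4 + 1"] show ?thesis using C4 by linarith
        qed
        finally have "(E.C4 + 1) * (norm h)\<^sup>2 * (norm h)\<^sup>2 \<le> \<epsilon> / 4 * (norm h)\<^sup>2" by (intro mult_right_mono) auto
        then have "E.C4 * norm h ^ 4 + norm h ^ 4 \<le> \<epsilon> / 4 * (norm h)\<^sup>2"
          by (simp add: algebra_simps flip: power_add)
        moreover have "0 \<le> norm h ^ 4" by simp
        ultimately have 2: "E.C4 * norm h ^ 4 \<le> \<epsilon> / 4 * (norm h)\<^sup>2" by linarith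
        show "2 * (\<epsilon>1 * (norm (V *v h))\<^sup>2) + 2 * E.C4 * norm h ^ 4 \<le> \<epsilon> * (norm h)\<^sup>2"
          using 1 2 by (simp add: mult.assoc)
      qed
      finally show "?H h
         \<le> ennreal (\<epsilon> * (norm h)\<^sup>2)" .
    qed (rule \<eta>'0)
  qed

  \<comment> \<open>Sample sizes and local scales\<close>
  let ?\<gamma> = "measure (std_gauss :: (real^'m) measure)"
  let ?K = "2 * (?\<gamma> (cball 0 c) - ?\<gamma> (cball 0 (c / q)))"
  let ?lhs = "SUP a \<in> {0::real..}. liminf (\<lambda>n.
            INF \<Lambda> \<in> markov_kernels (powM \<mu> n) (powM \<mu> (rn n)).
              SUP \<theta>' \<in> \<Theta> \<inter> cball \<theta> (a / sqrt (real n)).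
                tv_norm (powM (P \<theta>') n \<bind> \<Lambda>) (powM (P \<theta>') (rn n)))"
  have rn_bounds: "real n \<le> real (rn n)" "real (rn n) \<le> r * real n" "r * real n - 1 \<le> real (rn n)" for n
  proof -
    have "1 * real n \<le> r * real n" using r_ge by (intro mult_right_mono) auto
    then have fl: "int n \<le> \<lfloor>r * real n\<rfloor>" by (simp add: le_floor_iff)
    then have eq: "real (rn n) = of_int \<lfloor>r * real n\<rfloor>" unfolding rn_def by simp
    show "real n \<le> real (rn n)" unfolding eq using fl by linarith
    show "real (rn n) \<le> r * real n" "r * real n - 1 \<le> real (rn n)" unfolding eq by linarith+
  qed
  \<comment> \<open>The shift g / sqrt n equals \<open>\<rho> n\<close> g / sqrt (rn n): seen from
    the larger sample, the local parameter is \<open>\<rho> n\<close> g.\<close>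
  define \<rho> where "\<rho> n = sqrt (real (rn n) / real n)" for n
  have rn_top: "filterlim rn at_top sequentially"
    by (rule filterlim_at_top_mono[OF filterlim_ident]) (use rn_bounds(1) in simp)
  have \<rho>_lim: "\<rho> \<longlonglongrightarrow> q"
  proof -
    have "(\<lambda>n. real (rn n) / real n) \<longlonglongrightarrow> r"
    proof (rule real_tendsto_sandwich)
      have "(\<lambda>n. r - 1 / real n) \<longlonglongrightarrow> r - 0"
        by (intro tendsto_diff tendsto_const lim_1_over_n)
      then show "(\<lambda>n. r - 1 / real n) \<longlonglongrightarrow> r" by simp
      show "(\<lambda>n. r) \<longlonglongrightarrow> r" by simp
      show "\<forall>\<^sub>F n in sequentially. r - 1 / real n \<le> real (rn n) / real n"
        using eventually_gt_at_top[of 0]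
      proof eventually_elim
        case (elim n)
        then show ?case using divide_right_mono[OF rn_bounds(3)[of n], of "real n"] by (simp add: diff_divide_distrib)
      qed
      show "\<forall>\<^sub>F n in sequentially. real (rn n) / real n \<le> r"
        using eventually_gt_at_top[of 0]
      proof eventually_elim
        case (elim n)
        then show ?case using rn_bounds(2)[of n] by (simp add: field_simps)
      qed
    qed
    then show ?thesis unfolding \<rho>_def q_def by (rule tendsto_real_sqrt)
  qed

  \<comment> \<open>The risk of an arbitrary kernel, up to an error e\<close>
  have "ereal ?K \<le> ?lhs + ereal e" if e: "0 < e" for e
  proof -
    \<comment> \<open>The advantage of the test loses \<open>e1\<close> four times, through
      \<open>\<delta>\<close>, \<open>T\<close>, \<open>R\<close> and the limits, and 2
      \<open>e1\<close> in each of two passages to the tilted family. The factor 2 of the norm turns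
      these 8 \<open>e1\<close> into 16 \<open>e1\<close>, which is below \<open>e\<close>.\<close>
    define e1 where "e1 = e / 20"
    have e1: "0 < e1" using e by (simp add: e1_def)
    \<comment> \<open>The closed balls decrease to the closed ball of radius c / q, so continuity
      from above applies.\<close>
    obtain \<delta> where \<delta>: "0 < \<delta>" "?\<gamma> (cball 0 ((c + 2 * \<delta>) / q)) < ?\<gamma> (cball 0 (c / q)) + e1"
    proof -
      let ?B = "\<lambda>k. cball (0::real^'m) ((c + 2 * (1 / real (Suc k))) / q)"
      have "(\<lambda>k. ?\<gamma> (?B k)) \<longlonglongrightarrow> ?\<gamma> (\<Inter>k. ?B k)"
      proof (rule std_gauss.finite_Lim_measure_decseq)
        show "decseq ?B" unfolding decseq_def
        proof (intro allI impI)
          fix i j :: nat assume "i \<le> j"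
          then have "1 / real (Suc j) \<le> 1 / real (Suc i)" by (simp add: frac_le)
          then have "(c + 2 * (1 / real (Suc j))) / q \<le> (c + 2 * (1 / real (Suc i))) / q"
            using q0 by (intro divide_right_mono) auto
          then show "?B j \<subseteq> ?B i" by auto
        qed
      qed auto
      moreover have "(\<Inter>k. ?B k) = cball 0 (c / q)"
      proof -
        have lim: "norm x \<le> c / q" if x: "\<And>k. norm x \<le> (c + 2 * (1 / real (Suc k))) / q" for x :: "real^'m"
        proof (rule LIMSEQ_le_const)
          have "(\<lambda>k. (c + 2 * (1 / real (Suc k))) / q) \<longlonglongrightarrow> (c + 2 * 0) / q"
            using q0 LIMSEQ_Suc[OF lim_1_over_n] by (intro tendsto_intros) auto
          then show "(\<lambda>k. (c + 2 * (1 / real (Suc k))) / q) \<longlonglongrightarrow> c / q" by simp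
        qed (use x in auto)
        have le: "c / q \<le> (c + 2 * (1 / real (Suc k))) / q" for k
          using q0 by (intro divide_right_mono) auto
        show ?thesis
        proof (intro equalityI subsetI)
          fix x assume x: "x \<in> (\<Inter>k. ?B k)"
          have "norm x \<le> (c + 2 * (1 / real (Suc k))) / q" for k
            using x by (simp only: INT_iff mem_cball_0 UNIV_I simp_thms)
          then show "x \<in> cball 0 (c / q)" using lim by (simp only: mem_cball_0)
        next
          fix x :: "real^'m" assume "x \<in> cball 0 (c / q)"
          then have "norm x \<le> (c + 2 * (1 / real (Suc k))) / q" for k
            using order_trans[OF _ le] by (simp only: mem_cball_0)
          then show "x \<in> (\<Inter>k. ?B k)" by (simp only: INT_iff mem_cball_0) blast
        qed
      qed
      ultimately have "(\<lambda>k. ?\<gamma> (?B k)) \<longlonglongrightarrow> ?\<gamma> (cball 0 (c / q))" by simp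
      then have "\<forall>\<^sub>F k in sequentially. ?\<gamma> (?B k) < ?\<gamma> (cball 0 (c / q)) + e1"
        by (rule order_tendstoD) (use e1 in simp)
      then obtain k where "?\<gamma> (?B k) < ?\<gamma> (cball 0 (c / q)) + e1" by (auto simp: eventually_sequentially)
      then show ?thesis by (intro that[of "1 / real (Suc k)"]) auto
    qed
    obtain T where T: "0 < T" "?\<gamma> {y. T < norm y} < e1" using std_gauss_tail[OF e1] .
    \<comment> \<open>The truncation radius exceeds the prior radius by the fixed amount 2 T, so the
      volume ratio tends to 1 as the prior spreads.\<close>
    obtain R where R: "0 < R" "((R + 2 * T) / R) ^ DIM(real^'m) < 1 + e1"
    proof -
      have "((\<lambda>R::real. ((R + 2 * T) / R) ^ DIM(real^'m)) \<longlongrightarrow> 1 ^ DIM(real^'m)) at_top"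
      proof (intro tendsto_power)
        have "((\<lambda>R::real. 1 + 2 * T / R) \<longlongrightarrow> 1 + 0) at_top"
          by (intro tendsto_add tendsto_const tendsto_divide_0[OF tendsto_const] filterlim_at_top_imp_at_infinity filterlim_ident)
        moreover have "\<forall>\<^sub>F R::real in at_top. 1 + 2 * T / R = (R + 2 * T) / R"
          using eventually_gt_at_top[of 0] by eventually_elim (simp add: field_simps)
        ultimately show "((\<lambda>R::real. (R + 2 * T) / R) \<longlongrightarrow> 1) at_top"
          using Lim_transform_eventually by fastforce
      qed
      then have "\<forall>\<^sub>F R::real in at_top. ((R + 2 * T) / R) ^ DIM(real^'m) < 1 + e1"
        by (rule order_tendstoD) (use e1 in simp)
      then have "\<forall>\<^sub>F R::real in at_top. ((R + 2 * T) / R) ^ DIM(real^'m) < 1 + e1 \<and> 0 < R"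
        using eventually_gt_at_top by (rule eventually_conj)
      then show ?thesis using that eventually_happens'[OF trivial_limit_at_top_linorder] by blast
    qed
    let ?G = "?\<gamma> (cball 0 ((c + 2 * \<delta>) / q))"
    let ?L0 = "?\<gamma> (cball 0 c) - ?G * ((R + 2 * T) / R) ^ DIM(real^'m) - ?\<gamma> {y. T < norm y} - e1"
    have L0: "?K / 2 - 4 * e1 \<le> ?L0"
    proof -
      have "?G * ((R + 2 * T) / R) ^ DIM(real^'m) \<le> ?G * (1 + e1)" using R by (intro mult_left_mono) auto
      also have "\<dots> \<le> ?G + e1" using mult_right_mono[of ?G 1 e1] e1 by (simp add: distrib_left)
      finally show ?thesis using \<delta>(2) T(2) e1 by (simp add: field_simps)
    qed
    \<comment> \<open>With h = g / sqrt m, the product of m factors accumulates m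
      \<open>\<epsilon>1\<close> |h|^2 = \<open>\<epsilon>1\<close> |g|^2, which is at most
      \<open>e1\<^sup>2\<close>. The factor \<open>r\<close> accommodates the target sample, whose
      local parameter can be sqrt r times as long.\<close>
    define \<epsilon>1 where "\<epsilon>1 = e1\<^sup>2 / (r * R\<^sup>2)"
    have \<epsilon>1: "0 < \<epsilon>1" using e1 r_ge R by (simp add: \<epsilon>1_def)
    obtain \<eta> where \<eta>: "0 < \<eta>" "\<And>h. norm h < \<eta> \<Longrightarrow> \<theta> + V *v h \<in> \<Theta>"
      "\<And>h. norm h < \<eta> \<Longrightarrow> ?H h
        \<le> ennreal (\<epsilon>1 * (norm h)\<^sup>2)" using close[OF \<epsilon>1] by blast
    \<comment> \<open>The sample size \<open>m\<close> is left free because the passage to the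
      tilted family is made twice: with \<open>n\<close> observations for the input of the kernel
      and with \<open>rn n\<close> for the target.\<close>
    have transfer: "\<bar>(\<integral>x. F x \<partial>powM (P (\<theta> + V *v ((1 / sqrt (real m)) *\<^sub>R g))) m) - E.tilt m g F\<bar> \<le> 2 * e1"
      if F: "F \<in> borel_measurable (powM \<mu> m)" and F01: "\<And>x. x \<in> space (powM \<mu> m) \<Longrightarrow> 0 \<le> F x" "\<And>x. x \<in> space (powM \<mu> m) \<Longrightarrow> F x \<le> 1"
        and m: "0 < m" and g: "norm g < \<eta> * sqrt (real m)" "(norm g)\<^sup>2 \<le> r * R\<^sup>2" for F m g
    proof -
      define h where "h = (1 / sqrt (real m)) *\<^sub>R g"
      have m0: "0 < sqrt (real m)" using m by simp
      have hn: "norm h < \<eta>" using g(1) m0 by (simp add: h_def pos_divide_less_eq)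
      have th: "\<theta> + V *v h \<in> \<Theta>" by (rule \<eta>(2)[OF hn])
      have nh: "real m * (norm h)\<^sup>2 = (norm g)\<^sup>2" using m by (simp add: h_def power_divide)
      let ?q = "\<lambda>x. p \<theta> x * (exp (h \<bullet> s x) / E.M h)"
      have M0: "0 < E.M h" by (rule E.M_pos)
      have [measurable]: "p \<theta> \<in> borel_measurable \<mu>" "s \<in> borel_measurable \<mu>"
        using p_meas[OF theta] E.s_meas by (auto simp: measurable_cong_sets[OF sets_P refl])
      have Qh: "density \<mu> (\<lambda>x. ennreal (?q x)) = E.Q h"
      proof -
        define Mh where "Mh = E.M h"
        have "E.Q h = density (density \<mu> (\<lambda>x. ennreal (p \<theta> x))) (\<lambda>x. ennreal (exp (h \<bullet> s x) / Mh))"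
          unfolding E.Q_def Mh_def[symmetric] by (simp only: P_def)
        also have "\<dots> = density \<mu> (\<lambda>x. ennreal (p \<theta> x) * ennreal (exp (h \<bullet> s x) / Mh))"
          by (rule density_density_eq) measurable
        finally show ?thesis by (simp only: Mh_def ennreal_mult'[OF p_nonneg[OF theta]])
      qed
      have se: "sets (powM \<mu> m) = sets (powM (P \<theta>) m)" by (rule sets_powM_cong) (simp add: sets_P)
      have "\<bar>(\<integral>x. F x \<partial>powM (density \<mu> (\<lambda>x. ennreal (p (\<theta> + V *v h) x))) m) - (\<integral>x. F x \<partial>powM (density \<mu> (\<lambda>x. ennreal (?q x))) m)\<bar> \<le> 2 * e1"
      proof (rule powM_Hellinger_bound[where \<epsilon>="\<epsilon>1 * (norm h)\<^sup>2"])
        show "p (\<theta> + V *v h) \<in> borel_measurable \<mu>" by (rule p_meas[OF th])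
        show "0 \<le> p (\<theta> + V *v h) x" for x by (rule p_nonneg[OF th])
        show "0 \<le> ?q x" for x using p_nonneg[OF theta] M0 by simp
        show "prob_space (density \<mu> (\<lambda>x. ennreal (p (\<theta> + V *v h) x)))" using P_prob[OF th] by (simp only: P_def)
        show "prob_space (density \<mu> (\<lambda>x. ennreal (?q x)))" unfolding Qh by (rule E.prob_space_Q)
        show "(\<integral>\<^sup>+x. ennreal ((sqrt (p (\<theta> + V *v h) x) - sqrt (?q x))\<^sup>2) \<partial>\<mu>) \<le> ennreal (\<epsilon>1 * (norm h)\<^sup>2)"
          by (rule \<eta>(3)[OF hn])
        have "real m * (\<epsilon>1 * (norm h)\<^sup>2) = \<epsilon>1 * (norm g)\<^sup>2" using nh by (simp add: algebra_simps)
        also have "\<dots> \<le> \<epsilon>1 * (r * R\<^sup>2)" using g(2) \<epsilon>1 by (intro mult_left_mono) auto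
        also have "\<dots> = e1\<^sup>2" using r_ge R by (simp add: \<epsilon>1_def)
        finally show "real m * (\<epsilon>1 * (norm h)\<^sup>2) \<le> e1\<^sup>2" .
      qed (use F F01 \<epsilon>1 e1 in auto)
      moreover have "(\<integral>x. F x \<partial>powM (E.Q h) m) = E.tilt m g F"
        unfolding h_def by (rule E.integral_powM_Q) (use F in \<open>simp only: measurable_cong_sets[OF se refl]\<close>)
      ultimately show ?thesis unfolding Qh P_def[symmetric] h_def[symmetric] by simp
    qed
    \<comment> \<open>With this radius the parameters \<open>\<theta>\<close> + V g / sqrt n, for
      |g| <= R, all lie in the neighbourhood of \<open>\<theta>\<close> over which the supremum is
      taken.\<close>
    define a where "a = Bv * R"
    let ?S = "\<lambda>n \<Lambda>. SUP \<theta>' \<in> \<Theta> \<inter> cball \<theta> (a / sqrt (real n)). tv_norm (powM (P \<theta>') n \<bind> \<Lambda>) (powM (P \<theta>') (rn n))"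
    have small: "\<forall>\<^sub>F n in sequentially. R / sqrt (real n) < \<eta>"
    proof (rule order_tendstoD)
      show "(\<lambda>n. R / sqrt (real n)) \<longlonglongrightarrow> 0"
        by (intro tendsto_divide_0[OF tendsto_const] filterlim_at_top_imp_at_infinity
            filterlim_compose[OF sqrt_at_top filterlim_real_sequentially])
    qed (rule \<eta>(1))
    have "\<forall>\<^sub>F n in sequentially. ereal (?K - 16 * e1) \<le> (INF \<Lambda> \<in> markov_kernels (powM \<mu> n) (powM \<mu> (rn n)). ?S n \<Lambda>)"
      using E.eventually_gap[OF rn_top \<rho>_lim q0 c \<delta>(1) R(1) T(1) e1] small eventually_gt_at_top[of 0]
    proof eventually_elim
      case (elim n)
      note gap = elim(1)
      have n0: "0 < sqrt (real n)" and nn: "0 < n" using elim(3) by simp_all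
      have N0: "0 < rn n" using rn_bounds(1)[of n] elim(3) by linarith
      have seN: "sets (powM (P t) m) = sets (powM \<mu> m)" for t m by (rule sets_powM_cong[OF sets_P])
      have spN: "space (powM (P t) m) = space (powM \<mu> m)" for t m by (rule sets_eq_imp_space_eq[OF seN])
      show ?case
      proof (rule INF_greatest)
        fix \<Lambda> assume "\<Lambda> \<in> markov_kernels (powM \<mu> n) (powM \<mu> (rn n))"
        then have \<Lambda>: "\<Lambda> \<in> powM \<mu> n \<rightarrow>\<^sub>M prob_algebra (powM \<mu> (rn n))" by (simp add: markov_kernels_def)
        \<comment> \<open>The space of probability measures depends only on the sigma-algebra, so a
          kernel between products of \<open>\<mu>\<close> is also one between products of any
          \<open>P t\<close>.\<close>
        have pa: "prob_algebra (powM (P t) m) = prob_algebra (powM \<mu> m)" for t m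
          unfolding prob_algebra_def subprob_algebra_cong[OF seN] ..
        have \<Lambda>P: "\<Lambda> \<in> powM (P t) n \<rightarrow>\<^sub>M prob_algebra (powM (P t') (rn n))" for t t'
          using \<Lambda> unfolding pa by (simp only: measurable_cong_sets[OF seN refl])
        have \<Lambda>s: "\<Lambda> \<in> powM \<mu> n \<rightarrow>\<^sub>M subprob_algebra (powM \<mu> (rn n))" using \<Lambda> by (rule measurable_prob_algebraD)
        define A where "A g = {y \<in> space (powM (P \<theta>) (rn n)). norm (E.z (rn n) y - \<rho> n *\<^sub>R g) \<le> c + \<delta>}" for g
        have A_sets: "A g \<in> sets (powM \<mu> (rn n))" for g
        proof -
          have "A g \<in> sets (powM (P \<theta>) (rn n))" unfolding A_def by measurable
          then show ?thesis by (simp only: seN)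
        qed
        \<comment> \<open>The supremum is an extended real, so the argument runs with real upper
          bounds \<open>t\<close>; infinite values are treated separately at the end.\<close>
        have key: "?K - 16 * e1 \<le> t" if t: "?S n \<Lambda> \<le> ereal t" for t
        proof -
          have "E.tilt (rn n) (\<rho> n *\<^sub>R g) (indicator (A g)) - E.tilt n g (\<lambda>x. measure (\<Lambda> x) (A g)) \<le> t / 2 + 4 * e1"
            if g: "g \<in> cball 0 R" for g
          proof -
            define h where "h = (1 / sqrt (real n)) *\<^sub>R g"
            define \<theta>' where "\<theta>' = \<theta> + V *v h"
            have gR: "norm g \<le> R" using g by simp
            have h\<rho>: "h = (1 / sqrt (real (rn n))) *\<^sub>R (\<rho> n *\<^sub>R g)"
              unfolding h_def \<rho>_def using N0 nn by (simp add: real_sqrt_divide)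
            have g1: "norm g < \<eta> * sqrt (real n)"
              using elim(2) gR n0 by (simp add: pos_divide_less_eq)
            have hn: "norm h < \<eta>" using g1 n0 by (simp add: h_def pos_divide_less_eq)
            have th: "\<theta>' \<in> \<Theta>" unfolding \<theta>'_def by (rule \<eta>(2)[OF hn])
            have "norm (V *v h) \<le> norm h * Bv" by (rule Bv(2))
            also have "\<dots> \<le> (R / sqrt (real n)) * Bv"
              using gR Bv(1) n0 by (intro mult_right_mono) (auto simp: h_def divide_right_mono)
            finally have "\<theta>' \<in> cball \<theta> (a / sqrt (real n))" by (simp add: \<theta>'_def dist_norm a_def mult.commute)
            then have tv: "tv_norm (powM (P \<theta>') n \<bind> \<Lambda>) (powM (P \<theta>') (rn n)) \<le> ereal t"
              using th t by (auto simp: SUP_le_iff)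
            have pr: "prob_space (powM (P \<theta>') m)" for m by (intro prob_space_powM P_prob th)
            have in_pa: "powM (P \<theta>') n \<in> space (prob_algebra (powM (P \<theta>') n))"
              using pr by (simp add: space_prob_algebra)
            have sb: "sets (powM (P \<theta>') n \<bind> \<Lambda>) = sets (powM (P \<theta>') (rn n))"
              by (rule sets_bind'[OF in_pa \<Lambda>P])
            have "ereal (2 * (measure (powM (P \<theta>') (rn n)) (A g) - measure (powM (P \<theta>') n \<bind> \<Lambda>) (A g))) \<le>
                tv_norm (powM (P \<theta>') n \<bind> \<Lambda>) (powM (P \<theta>') (rn n))"
              by (rule tv_norm_ge_event[OF prob_space_bind'[OF in_pa \<Lambda>P] pr sb]) (simp only: sb seN A_sets)
            then have d: "measure (powM (P \<theta>') (rn n)) (A g) - measure (powM (P \<theta>') n \<bind> \<Lambda>) (A g) \<le> t / 2"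
              using order_trans[OF _ tv] by fastforce
            have mb: "measure (powM (P \<theta>') n \<bind> \<Lambda>) (A g) = (\<integral>x. measure (\<Lambda> x) (A g) \<partial>powM (P \<theta>') n)"
              by (rule subprob_space.measure_bind[OF prob_space_imp_subprob_space[OF pr] measurable_prob_algebraD[OF \<Lambda>P]])
                 (simp only: seN A_sets)
            have mi: "measure (powM (P \<theta>') (rn n)) (A g) = (\<integral>x. indicator (A g) x \<partial>powM (P \<theta>') (rn n))"
              using A_sets[of g] sets.sets_into_space[OF A_sets[of g]] by (simp add: Int_absorb2 spN)
            have g\<rho>: "norm (\<rho> n *\<^sub>R g) = norm h * sqrt (real (rn n))"
              unfolding h\<rho> using N0 by simp
            have "(\<rho> n)\<^sup>2 \<le> r" unfolding \<rho>_def using rn_bounds(2)[of n] nn by (simp add: field_simps)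
            then have g2: "(norm (\<rho> n *\<^sub>R g))\<^sup>2 \<le> r * R\<^sup>2"
              using gR r_ge by (simp add: power_mult_distrib) (intro mult_mono power_mono, auto)
            have 1: "\<bar>(\<integral>x. indicator (A g) x \<partial>powM (P \<theta>') (rn n)) - E.tilt (rn n) (\<rho> n *\<^sub>R g) (indicator (A g))\<bar> \<le> 2 * e1"
              unfolding \<theta>'_def h\<rho>
            proof (rule transfer[OF _ _ _ N0 _ g2])
              show "norm (\<rho> n *\<^sub>R g) < \<eta> * sqrt (real (rn n))" unfolding g\<rho> using hn N0 by (intro mult_strict_right_mono) auto
            qed (use A_sets in auto)
            have "(norm g)\<^sup>2 \<le> R\<^sup>2" using gR by (intro power_mono) auto
            also have "\<dots> \<le> r * R\<^sup>2" using r_ge mult_right_mono[of 1 r "R\<^sup>2"] by simp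
            finally have g3: "(norm g)\<^sup>2 \<le> r * R\<^sup>2" .
            have 2: "\<bar>(\<integral>x. measure (\<Lambda> x) (A g) \<partial>powM (P \<theta>') n) - E.tilt n g (\<lambda>x. measure (\<Lambda> x) (A g))\<bar> \<le> 2 * e1"
              unfolding \<theta>'_def h_def
            proof (rule transfer[OF _ _ _ nn g1 g3])
              show "(\<lambda>x. measure (\<Lambda> x) (A g)) \<in> borel_measurable (powM \<mu> n)"
                using \<Lambda>s A_sets by measurable
              show "measure (\<Lambda> x) (A g) \<le> 1" if "x \<in> space (powM \<mu> n)" for x
                using measurable_space[OF \<Lambda> that] by (auto simp: space_prob_algebra intro: prob_space.prob_le_1)
            qed simp
            show ?thesis using 1 2 d unfolding mb mi by linarith
          qed
          then have "?L0 \<le> t / 2 + 4 * e1"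
            using gap[rule_format, OF \<Lambda>P, of "t / 2 + 4 * e1"] unfolding A_def by blast
          then show ?thesis using L0 by linarith
        qed
        show "ereal (?K - 16 * e1) \<le> ?S n \<Lambda>"
        proof (cases "?S n \<Lambda>")
          case (real x)
          then show ?thesis using key[of x] by simp
        next
          case MInf
          then have "?K - 16 * e1 \<le> ?K - 16 * e1 - 1" by (intro key) simp
          then show ?thesis by simp
        qed simp
      qed
    qed
    then have "ereal (?K - 16 * e1) \<le> liminf (\<lambda>n. INF \<Lambda> \<in> markov_kernels (powM \<mu> n) (powM \<mu> (rn n)). ?S n \<Lambda>)"
      by (rule Liminf_bounded)
    also have "\<dots> \<le> ?lhs"
      using Bv(1) R(1) by (intro SUP_upper) (simp add: a_def)
    finally have "ereal (?K - 16 * e1) + ereal (16 * e1) \<le> ?lhs + ereal (16 * e1)" by (rule add_right_mono)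
    also have "\<dots> \<le> ?lhs + ereal e"
      using e by (intro add_left_mono) (simp add: e1_def)
    also have "ereal (?K - 16 * e1) + ereal (16 * e1) = ereal ?K" by (simp only: plus_ereal.simps diff_add_cancel)
    finally show ?thesis .
  qed
  then have "ereal ?K \<le> ?lhs" by (rule ereal_le_epsilon2)
  with D_le show ?thesis by (rule order_trans)
qed

end
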